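(* Let $d$ be a positive integer, let $G$ be a graph and let $\omega\in\mathbb{C}^{E(G)}$ be a generic $d$-stress of $G$. Then $\mathcal{M}(L_{d,G}(\omega))=\mathcal{S}_d(G)^*$; that is, the algebraic matroid of the contact locus $L_{d,G}(\omega)$ is the dual matroid of the $d$-dimensional generic stress matroid $\mathcal{S}_d(G)$ of $G$.
   Context: Graphs are finite and simple, with a nonempty edge set. For a finite set $E$ and an irreducible affine variety $X\subseteq\mathbb{C}^E$, the algebraic matroid $\mathcal{M}(X)$ is the matroid on ground set $E$ in which $E_0\subseteq E$ is independent if and only if the coordinate projection of $X$ to $\mathbb{C}^{E_0}$ is Zariski dense in $\mathbb{C}^{E_0}$. For $\omega\in\mathbb{C}^E$, $\omega^\perp=\{x\in\mathbb{C}^E:\sum_{e}\omega_ex_e=0\}$; for a linear subspace $L$, $L^\perp=\{\omega\in\mathbb{C}^E:L\subseteq\omega^\perp\}$. $T_x(X)$ is the (linear) tangent space of $X$ at $x$. All closures are Zariski closures. If $X$ is an irreducible variety defined over $\mathbb{Q}$ (i.e. by polynomials with rational coefficients), a point $x\in X$ is $X$-generic if the only rational polynomials vanishing at $x$ are those vanishing on all of $X$. For $G=(V,E)$, let $m_{d,G}:(\mathbb{C}^d)^V\to\mathbb{C}^E$ be given by $m_{d,G}(p)=\big(\sum_{i=1}^d(p(u)_i-p(v)_i)^2\big)_{uv\in E}$, and let $M_{d,G}=\overline{m_{d,G}((\mathbb{C}^d)^V)}$ be the measurement variety; it is a homogeneous irreducible affine variety defined over $\mathbb{Q}$. Its dual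 variety $M_{d,G}^*$ (the generic stress variety) is the Zariski closure of $\bigcup\{T_x(M_{d,G})^\perp: x\in M_{d,G}\text{ smooth}\}$; it is an irreducible homogeneous variety defined over $\mathbb{Q}$. The $d$-dimensional generic stress matroid of $G$ is $\mathcal{S}_d(G)=\mathcal{M}(M_{d,G}^* )$. A vector $\omega\in\mathbb{C}^E$ is a generic $d$-stress of $G$ if it is an $M_{d,G}^*$-generic point. The contact locus of $\omega$ is $L_{d,G}(\omega)=\overline{\{x\in M_{d,G}: x\text{ is smooth and }T_x(M_{d,G})\subseteq\omega^\perp\}}$; for a generic $d$-stress $\omega$ it is a linear subspace of $\mathbb{C}^E$. *)

theory Defs
  imports
    "HOL-Analysis.Analysis"
    "HOL-Library.Poly_Mapping"
    "HOL-Library.Function_Algebras"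
begin

section \<open>Coordinate spaces and polynomials\<close>

text \<open>
  Points of the coordinate space over a finite index set \<open>I\<close> are functions that vanish outside
  \<open>I\<close> (rather than being \<open>undefined\<close> there), so that the pointwise operations make the space a
  complex vector space.
\<close>

definition cspace :: "'i set \<Rightarrow> ('i \<Rightarrow> complex) set" where
  "cspace I = {x. \<forall>i. i \<notin> I \<longrightarrow> x i = 0}"

definition cscale :: "complex \<Rightarrow> ('i \<Rightarrow> complex) \<Rightarrow> 'i \<Rightarrow> complex" where
  "cscale c x = (\<lambda>i. c * x i)"

interpretation cfun: vector_space "cscale :: complex \<Rightarrow> ('i \<Rightarrow> complex) \<Rightarrow> 'i \<Rightarrow> complex"
  by standard (auto simp: cscale_def fun_eq_iff algebra_simps)

text \<open>A polynomial maps exponent vectors to coefficients, both finitely supported.\<close>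

type_synonym 'i cpoly = "('i \<Rightarrow>\<^sub>0 nat) \<Rightarrow>\<^sub>0 complex"

definition poly_eval :: "'i cpoly \<Rightarrow> ('i \<Rightarrow> complex) \<Rightarrow> complex" where
  "poly_eval f x =
     (\<Sum>m\<in>Poly_Mapping.keys f. Poly_Mapping.lookup f m *
        (\<Prod>i\<in>Poly_Mapping.keys m. x i ^ Poly_Mapping.lookup m i))"

definition cpolys :: "'i set \<Rightarrow> 'i cpoly set" where
  "cpolys I = {f. \<forall>m\<in>Poly_Mapping.keys f. Poly_Mapping.keys m \<subseteq> I}"

definition rational_cpolys :: "'i set \<Rightarrow> 'i cpoly set" where
  "rational_cpolys I = {f \<in> cpolys I. \<forall>m. Poly_Mapping.lookup f m \<in> \<rat>}"

definition partial_deriv :: "'i \<Rightarrow> 'i cpoly \<Rightarrow> ('i \<Rightarrow> complex) \<Rightarrow> complex" where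
  "partial_deriv i f x = deriv (\<lambda>t. poly_eval f (x(i := t))) (x i)"


section \<open>Affine varieties\<close>

definition vanishing_ideal :: "'i set \<Rightarrow> ('i \<Rightarrow> complex) set \<Rightarrow> 'i cpoly set" where
  "vanishing_ideal I S = {f \<in> cpolys I. \<forall>x\<in>S. poly_eval f x = 0}"

definition zariski_closure :: "'i set \<Rightarrow> ('i \<Rightarrow> complex) set \<Rightarrow> ('i \<Rightarrow> complex) set" where
  "zariski_closure I S = {x \<in> cspace I. \<forall>f\<in>vanishing_ideal I S. poly_eval f x = 0}"

definition generic_point :: "'i set \<Rightarrow> ('i \<Rightarrow> complex) set \<Rightarrow> ('i \<Rightarrow> complex) \<Rightarrow> bool" where
  "generic_point I X x \<longleftrightarrow>
     x \<in> X \<and> (\<forall>f\<in>rational_cpolys I. poly_eval f x = 0 \<longrightarrow> (\<forall>y\<in>X. poly_eval f y = 0))"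

text \<open>
  The dimension of an irreducible variety is the transcendence degree of its function field over
  the complex numbers. As this is the field of fractions of the coordinate ring, it is the largest
  number of algebraically independent elements of the coordinate ring, i.e. of polynomial
  functions on \<open>X\<close>.
\<close>

definition alg_independent_on ::
    "('i \<Rightarrow> complex) set \<Rightarrow> nat \<Rightarrow> (nat \<Rightarrow> 'i cpoly) \<Rightarrow> bool" where
  "alg_independent_on X n f \<longleftrightarrow>
     (\<forall>g\<in>cpolys {..<n}. (\<forall>x\<in>X. poly_eval g (\<lambda>k. poly_eval (f k) x) = 0) \<longrightarrow> g = 0)"

definition variety_dim :: "'i set \<Rightarrow> ('i \<Rightarrow> complex) set \<Rightarrow> nat" where
  "variety_dim I X =
     (GREATEST n. \<exists>f. (\<forall>k<n. f k \<in> cpolys I) \<and> alg_independent_on X n f)"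

definition tangent_space ::
    "'i set \<Rightarrow> ('i \<Rightarrow> complex) set \<Rightarrow> ('i \<Rightarrow> complex) \<Rightarrow> ('i \<Rightarrow> complex) set" where
  "tangent_space I X x =
     {v \<in> cspace I. \<forall>f\<in>vanishing_ideal I X. (\<Sum>i\<in>I. partial_deriv i f x * v i) = 0}"

definition smooth_point :: "'i set \<Rightarrow> ('i \<Rightarrow> complex) set \<Rightarrow> ('i \<Rightarrow> complex) \<Rightarrow> bool" where
  "smooth_point I X x \<longleftrightarrow> x \<in> X \<and> cfun.dim (tangent_space I X x) = variety_dim I X"

definition hyperplane_perp :: "'i set \<Rightarrow> ('i \<Rightarrow> complex) \<Rightarrow> ('i \<Rightarrow> complex) set" where
  "hyperplane_perp I \<omega> = {x \<in> cspace I. (\<Sum>i\<in>I. \<omega> i * x i) = 0}"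

definition subspace_perp :: "'i set \<Rightarrow> ('i \<Rightarrow> complex) set \<Rightarrow> ('i \<Rightarrow> complex) set" where
  "subspace_perp I L = {\<omega> \<in> cspace I. L \<subseteq> hyperplane_perp I \<omega>}"

definition dual_variety :: "'i set \<Rightarrow> ('i \<Rightarrow> complex) set \<Rightarrow> ('i \<Rightarrow> complex) set" where
  "dual_variety I X =
     zariski_closure I (\<Union>x\<in>{x. smooth_point I X x}. subspace_perp I (tangent_space I X x))"


section \<open>Matroids\<close>

text \<open>A matroid is given by its ground set and its collection of independent sets.\<close>

type_synonym 'e matroid = "'e set \<times> 'e set set"

definition matroid_bases :: "'e matroid \<Rightarrow> 'e set set" where
  "matroid_bases M = {B \<in> snd M. \<forall>A\<in>snd M. B \<subseteq> A \<longrightarrow> A = B}"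

text \<open>The bases of the dual matroid are the complements of the bases.\<close>

definition dual_matroid :: "'e matroid \<Rightarrow> 'e matroid" where
  "dual_matroid M = (fst M, {A. \<exists>B\<in>matroid_bases M. A \<subseteq> fst M - B})"

definition coord_proj :: "'i set \<Rightarrow> ('i \<Rightarrow> complex) \<Rightarrow> 'i \<Rightarrow> complex" where
  "coord_proj J x = (\<lambda>i. if i \<in> J then x i else 0)"

definition algebraic_matroid :: "'e set \<Rightarrow> ('e \<Rightarrow> complex) set \<Rightarrow> 'e matroid" where
  "algebraic_matroid E X = (E, {J. J \<subseteq> E \<and> zariski_closure J (coord_proj J ` X) = cspace J})"


section \<open>Graphs, measurement varieties and generic stresses\<close>

definition finite_simple_graph :: "'v set \<Rightarrow> 'v set set \<Rightarrow> bool" where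
  "finite_simple_graph V E \<longleftrightarrow>
     finite V \<and> (\<forall>e\<in>E. \<exists>u\<in>V. \<exists>v\<in>V. u \<noteq> v \<and> e = {u, v})"

text \<open>
  A \<open>d\<close>-dimensional configuration of \<open>V\<close> is a point of \<open>cspace (V \<times> {..<d})\<close>; the \<open>i\<close>-th coordinate
  of the vertex \<open>u\<close> is \<open>p (u, i)\<close>.
\<close>

definition sq_dist :: "nat \<Rightarrow> ('v \<times> nat \<Rightarrow> complex) \<Rightarrow> 'v \<Rightarrow> 'v \<Rightarrow> complex" where
  "sq_dist d p u v = (\<Sum>i<d. (p (u, i) - p (v, i))\<^sup>2)"

text \<open>The value on an edge does not depend on the order of its ends: see \<open>measurement_edge\<close>.\<close>

definition measurement ::
    "nat \<Rightarrow> 'v set set \<Rightarrow> ('v \<times> nat \<Rightarrow> complex) \<Rightarrow> 'v set \<Rightarrow> complex" where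
  "measurement d E p =
     (\<lambda>e. if e \<in> E then (THE z. \<exists>u v. e = {u, v} \<and> z = sq_dist d p u v) else 0)"

lemma sq_dist_commute: "sq_dist d p u v = sq_dist d p v u"
  by (simp add: sq_dist_def power2_commute)

lemma measurement_edge:
  assumes "{u, v} \<in> E"
  shows "measurement d E p {u, v} = sq_dist d p u v"
proof -
  have "(THE z. \<exists>a b. {u, v} = {a, b} \<and> z = sq_dist d p a b) = sq_dist d p u v"
    by (rule the_equality) (auto simp: doubleton_eq_iff sq_dist_commute)
  then show ?thesis
    using assms by (simp add: measurement_def)
qed

definition measurement_variety ::
    "nat \<Rightarrow> 'v set \<Rightarrow> 'v set set \<Rightarrow> ('v set \<Rightarrow> complex) set" where
  "measurement_variety d V E = zariski_closure E (measurement d E ` cspace (V \<times> {..<d}))"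

definition generic_stress_variety ::
    "nat \<Rightarrow> 'v set \<Rightarrow> 'v set set \<Rightarrow> ('v set \<Rightarrow> complex) set" where
  "generic_stress_variety d V E = dual_variety E (measurement_variety d V E)"

definition generic_stress_matroid :: "nat \<Rightarrow> 'v set \<Rightarrow> 'v set set \<Rightarrow> 'v set matroid" where
  "generic_stress_matroid d V E = algebraic_matroid E (generic_stress_variety d V E)"

definition generic_stress ::
    "nat \<Rightarrow> 'v set \<Rightarrow> 'v set set \<Rightarrow> ('v set \<Rightarrow> complex) \<Rightarrow> bool" where
  "generic_stress d V E \<omega> \<longleftrightarrow> generic_point E (generic_stress_variety d V E) \<omega>"

definition contact_locus ::
    "nat \<Rightarrow> 'v set \<Rightarrow> 'v set set \<Rightarrow> ('v set \<Rightarrow> complex) \<Rightarrow> ('v set \<Rightarrow> complex) set" where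
  "contact_locus d V E \<omega> =
     zariski_closure E
       {x. smooth_point E (measurement_variety d V E) x \<and>
           tangent_space E (measurement_variety d V E) x \<subseteq> hyperplane_perp E \<omega>}"

end

theory Submission
  imports Defs "HOL-Computational_Algebra.Polynomial"
begin

text \<open>
  The measurement map is a rational quadratic map \<open>m p = B p p\<close>, and only this is used. The variety \<open>M\<close>
  is its closed image, and generically the tangent space at \<open>m p\<close> is the image of \<open>B p\<close>, so the
  conormal vectors are the stresses, i.e. the \<open>\<omega>\<close> orthogonal to the image of \<open>B p\<close>. Let \<open>T\<close> be the
  tangent space of the dual variety at the generic stress \<open>\<omega>\<close>. The contact locus is the orthogonal
  complement of \<open>T\<close> up to density, the matroid of the dual variety is the matroid of \<open>T\<close>, and the matroids
  of orthogonal linear spaces are dual to each other.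

  Generic smoothness is replaced by derivations: a vector satisfying the linearized rational relations
  of a point of complex affine space is the value on that point of a derivation of the field of complex
  numbers. Applying such a derivation \<open>D\<close> with \<open>D \<omega> \<in> T\<close> to \<open>\<Sum>\<omega>\<^sub>e x\<^sub>e = 0\<close>, for \<open>x\<close> in the
  contact locus, shows that \<open>x\<close> is orthogonal to \<open>T\<close>. Conversely, if \<open>v\<close> is orthogonal to all
  \<open>B p r\<close> with \<open>p\<close> and \<open>r\<close> in the kernel of the stress matrix of \<open>\<omega>\<close>, then \<open>v\<close> is the velocity of a
  polynomial path of stresses through \<open>\<omega>\<close>, hence \<open>v\<close> lies in \<open>T\<close>.
\<close>

section \<open>Polynomial functions\<close>

text \<open>Genericity is assumed of \<omega> alone, whereas tangent spaces of \<open>M\<close> are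
  computed at points \<open>m p\<close>. A configuration \<open>p\<close> with stress \<omega> is
  only known to satisfy \<open>\<Delta> p \<noteq> 0\<close>, so regularity has to be an open
  condition given by one rational polynomial \<Delta>. Genericity of \<omega> then transfers the
  existence of a kernel vector with \<open>\<Delta> p \<noteq> 0\<close> from a dense set of
  stresses to \<omega>.

  For such a \<open>p\<close>, let W consist of all \<open>B p r\<close> with \<open>r\<close> in
  the kernel of the stress matrix. Reciprocity puts W into the complement of \<open>T\<close>,
  integration of first-order deformations puts the complement of W into \<open>T\<close>, and double
  annihilators turn this into equality.

  \<open>T\<close> is cut out by rational polynomials because these are the relations that a
  derivation of the complex numbers, which kills the rationals, has to respect. For the dual
  variety, density of a projection leaves the derivatives of the projected coordinates of \<omega>
  free; conversely, polynomial paths with arbitrary velocity force density.\<close>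

inductive_set poly_funs :: "complex set \<Rightarrow> 'i set \<Rightarrow> (('i \<Rightarrow> complex) \<Rightarrow> complex) set"
  for F I where
    const: "c \<in> F \<Longrightarrow> (\<lambda>x. c) \<in> poly_funs F I"
  | var: "i \<in> I \<Longrightarrow> (\<lambda>x. x i) \<in> poly_funs F I"
  | add: "f \<in> poly_funs F I \<Longrightarrow> g \<in> poly_funs F I \<Longrightarrow> (\<lambda>x. f x + g x) \<in> poly_funs F I"
  | mult: "f \<in> poly_funs F I \<Longrightarrow> g \<in> poly_funs F I \<Longrightarrow> (\<lambda>x. f x * g x) \<in> poly_funs F I"

lemma poly_funs_mono:
  assumes "F \<subseteq> F'" "I \<subseteq> I'"
  shows "poly_funs F I \<subseteq> poly_funs F' I'"
proof
  fix f assume "f \<in> poly_funs F I"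
  then show "f \<in> poly_funs F' I'"
    by induction (use assms in \<open>auto intro: poly_funs.intros\<close>)
qed

lemma poly_funs_UNIV: "f \<in> poly_funs F I \<Longrightarrow> f \<in> poly_funs UNIV I"
  using poly_funs_mono[of F UNIV I I] by auto

lemma poly_funs_cong:
  assumes "f \<in> poly_funs F I" "\<And>i. i \<in> I \<Longrightarrow> x i = y i"
  shows "f x = f y"
  using assms by (induction) auto

text \<open>Requiring only -1 in \<open>F\<close> lets \<open>F\<close> be a mere set of
  coefficients, such as the rationals with finitely many numbers added; sums and products of -1
  supply 1 and 0.\<close>

lemma poly_funs_one: "-1 \<in> F \<Longrightarrow> (\<lambda>x. 1) \<in> poly_funs F I"
  using poly_funs.mult[OF poly_funs.const poly_funs.const, of "-1" F "-1" I] by simp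

lemma poly_funs_zero: "-1 \<in> F \<Longrightarrow> (\<lambda>x. 0) \<in> poly_funs F I"
  using poly_funs.add[OF poly_funs_one poly_funs.const, of F "-1" I] by simp

lemma poly_funs_uminus: "-1 \<in> F \<Longrightarrow> f \<in> poly_funs F I \<Longrightarrow> (\<lambda>x. - f x) \<in> poly_funs F I"
  using poly_funs.mult[OF poly_funs.const, of "-1" F f I] by simp

lemma poly_funs_diff:
  "-1 \<in> F \<Longrightarrow> f \<in> poly_funs F I \<Longrightarrow> g \<in> poly_funs F I \<Longrightarrow> (\<lambda>x. f x - g x) \<in> poly_funs F I"
  using poly_funs.add[OF _ poly_funs_uminus, of f F I g] by simp

lemma poly_funs_sum:
  assumes "-1 \<in> F" "\<And>k. k \<in> K \<Longrightarrow> f k \<in> poly_funs F I"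
  shows "(\<lambda>x. \<Sum>k\<in>K. f k x) \<in> poly_funs F I"
  using assms(2) by (induction K rule: infinite_finite_induct)
    (auto intro: poly_funs.intros poly_funs_zero[OF assms(1)])

lemma poly_funs_power:
  assumes "-1 \<in> F" "f \<in> poly_funs F I"
  shows "(\<lambda>x. f x ^ n) \<in> poly_funs F I"
  by (induction n) (auto intro: poly_funs.intros poly_funs_one assms)

lemma poly_funs_prod:
  assumes "-1 \<in> F" "\<And>k. k \<in> K \<Longrightarrow> f k \<in> poly_funs F I"
  shows "(\<lambda>x. \<Prod>k\<in>K. f k x) \<in> poly_funs F I"
  using assms(2) by (induction K rule: infinite_finite_induct)
    (auto intro: poly_funs.intros poly_funs_one[OF assms(1)])

lemma poly_funs_comp:
  assumes "f \<in> poly_funs F I" "\<And>i. i \<in> I \<Longrightarrow> \<phi> i \<in> poly_funs F A"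
  shows "(\<lambda>p. f (\<lambda>i. \<phi> i p)) \<in> poly_funs F A"
  using assms by induction (auto intro: poly_funs.intros)

lemma countable_poly_funs:
  assumes "countable F" "countable I"
  shows "countable (poly_funs F I)"
proof -
  define base where "base = (\<lambda>c x. c) ` F \<union> (\<lambda>i x. x i) ` I"
  define step :: "(('a \<Rightarrow> complex) \<Rightarrow> complex) set \<Rightarrow> _" where
    "step S = S \<union> (\<lambda>(f, g) x. f x + g x) ` (S \<times> S) \<union> (\<lambda>(f, g) x. f x * g x) ` (S \<times> S)" for S
  define lv where "lv n = (step ^^ n) base" for n
  have "countable (lv n)" for n
    unfolding lv_def
    by (induction n) (use assms in \<open>auto simp: base_def step_def\<close>)
  moreover have mono: "lv m \<subseteq> lv n" if "m \<le> n" for m n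
    using that by (induction rule: dec_induct) (auto simp: lv_def step_def)
  have "poly_funs F I \<subseteq> (\<Union>n. lv n)"
  proof
    fix f assume "f \<in> poly_funs F I"
    then show "f \<in> (\<Union>n. lv n)"
    proof induction
      case (const c)
      then show ?case by (auto intro!: exI[of _ 0] simp: lv_def base_def)
    next
      case (var i)
      then show ?case by (auto intro!: exI[of _ 0] simp: lv_def base_def)
    next
      case (add f g)
      then obtain m n where "f \<in> lv m" "g \<in> lv n" by auto
      then have fg: "f \<in> lv (max m n)" "g \<in> lv (max m n)" using mono[of m "max m n"] mono[of n "max m n"] by auto
      have "(\<lambda>x. f x + g x) \<in> step (lv (max m n))"
        using fg by (force simp: step_def)
      then have "(\<lambda>x. f x + g x) \<in> lv (Suc (max m n))"
        by (simp add: lv_def)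
      then show ?case by blast
    next
      case (mult f g)
      then obtain m n where "f \<in> lv m" "g \<in> lv n" by auto
      then have fg: "f \<in> lv (max m n)" "g \<in> lv (max m n)" using mono[of m "max m n"] mono[of n "max m n"] by auto
      have "(\<lambda>x. f x * g x) \<in> step (lv (max m n))"
        using fg by (force simp: step_def)
      then have "(\<lambda>x. f x * g x) \<in> lv (Suc (max m n))"
        by (simp add: lv_def)
      then show ?case by blast
    qed
  qed
  ultimately show ?thesis
    by (meson countable_UN countable_subset uncountable_def UNIV_I countableI_type)
qed

section \<open>Differentials\<close>

definition pd :: "'i \<Rightarrow> (('i \<Rightarrow> complex) \<Rightarrow> complex) \<Rightarrow> ('i \<Rightarrow> complex) \<Rightarrow> complex" where
  "pd i f x = deriv (\<lambda>t. f (x(i := t))) (x i)"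

definition dd :: "'i set \<Rightarrow> (('i \<Rightarrow> complex) \<Rightarrow> complex) \<Rightarrow> ('i \<Rightarrow> complex) \<Rightarrow> ('i \<Rightarrow> complex) \<Rightarrow> complex"
  where "dd I f x v = (\<Sum>i\<in>I. pd i f x * v i)"

lemma poly_funs_differentiable:
  assumes "f \<in> poly_funs F I"
  shows "(\<lambda>t. f (x(i := t))) field_differentiable (at s)"
  using assms
proof induction
  case (var j)
  then show ?case by (cases "j = i") auto
qed (auto intro: field_differentiable_add field_differentiable_mult)

lemma pd_const: "pd i (\<lambda>x. c) x = 0"
  by (simp add: pd_def)

lemma pd_var: "pd i (\<lambda>x. x j) x = (if i = j then 1 else 0)"
  by (auto simp: pd_def)

lemma pd_add:
  assumes "f \<in> poly_funs F I" "g \<in> poly_funs F I"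
  shows "pd i (\<lambda>x. f x + g x) x = pd i f x + pd i g x"
  using assms unfolding pd_def
  by (subst deriv_add) (auto intro: poly_funs_differentiable)

lemma pd_mult:
  assumes "f \<in> poly_funs F I" "g \<in> poly_funs F I"
  shows "pd i (\<lambda>x. f x * g x) x = f x * pd i g x + pd i f x * g x"
  using assms unfolding pd_def
  by (subst deriv_mult) (auto intro: poly_funs_differentiable)

lemma pd_poly_funs:
  assumes "-1 \<in> F" "f \<in> poly_funs F I"
  shows "pd i f \<in> poly_funs F I"
  using assms(2)
proof induction
  case (const c)
  then show ?case using poly_funs_zero[OF assms(1)] by (simp add: pd_const[abs_def])
next
  case (var j)
  then show ?case
    using poly_funs_zero[OF assms(1)] poly_funs_one[OF assms(1)] by (cases "i = j") (simp_all add: pd_var[abs_def])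
next
  case (add f g)
  have "pd i (\<lambda>x. f x + g x) = (\<lambda>x. pd i f x + pd i g x)"
    using add by (auto simp: pd_add)
  then show ?case using add by (auto intro: poly_funs.intros)
next
  case (mult f g)
  have "pd i (\<lambda>x. f x * g x) = (\<lambda>x. f x * pd i g x + pd i f x * g x)"
    using mult by (auto simp: pd_mult)
  then show ?case using mult by (auto intro: poly_funs.intros)
qed

lemma dd_const: "dd I (\<lambda>x. c) x v = 0"
  by (simp add: dd_def pd_const)

lemma dd_var: "finite I \<Longrightarrow> j \<in> I \<Longrightarrow> dd I (\<lambda>x. x j) x v = v j"
  by (simp add: dd_def pd_var if_distrib[of "\<lambda>u. u * _"] cong: if_cong)

lemma dd_add:
  assumes "f \<in> poly_funs F I" "g \<in> poly_funs F I"
  shows "dd I (\<lambda>x. f x + g x) x v = dd I f x v + dd I g x v"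
  using assms by (simp add: dd_def pd_add algebra_simps sum.distrib)

lemma dd_mult:
  assumes "f \<in> poly_funs F I" "g \<in> poly_funs F I"
  shows "dd I (\<lambda>x. f x * g x) x v = f x * dd I g x v + dd I f x v * g x"
  using assms by (simp add: dd_def pd_mult algebra_simps sum.distrib sum_distrib_left)

lemma dd_uminus:
  assumes "f \<in> poly_funs F I"
  shows "dd I (\<lambda>x. - f x) x v = - dd I f x v"
  using dd_mult[OF poly_funs.const[OF UNIV_I] poly_funs_UNIV[OF assms], of "-1" x v]
  by (simp add: dd_const)

lemma dd_cong: "(\<And>i. i \<in> I \<Longrightarrow> v i = w i) \<Longrightarrow> dd I f x v = dd I f x w"
  by (simp add: dd_def)

lemma dd_scale_right: "dd I f x (\<lambda>i. c * v i) = c * dd I f x v"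
  by (simp add: dd_def sum_distrib_left algebra_simps)

lemma dd_sum_right: "dd I f x (\<lambda>i. \<Sum>k\<in>K. v k i) = (\<Sum>k\<in>K. dd I f x (v k))"
  by (simp add: dd_def sum_distrib_left) (rule sum.swap)

text \<open>The chain rule; induction on the outer function reduces it to the sum and product
  rules.\<close>

lemma dd_comp:
  assumes "finite I" "f \<in> poly_funs UNIV I" "\<And>i. i \<in> I \<Longrightarrow> \<phi> i \<in> poly_funs UNIV A"
  shows "dd A (\<lambda>p. f (\<lambda>i. \<phi> i p)) p q = dd I f (\<lambda>i. \<phi> i p) (\<lambda>i. dd A (\<phi> i) p q)"
  using assms(2)
proof induction
  case (const c)
  then show ?case by (simp add: dd_const)
next
  case (var i)
  then show ?case by (simp add: dd_var assms)
next
  case (add f g)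
  have c: "(\<lambda>p. f (\<lambda>i. \<phi> i p)) \<in> poly_funs UNIV A" "(\<lambda>p. g (\<lambda>i. \<phi> i p)) \<in> poly_funs UNIV A"
    using add assms(3) by (auto intro: poly_funs_comp)
  show ?case
    using add by (simp add: dd_add[OF c] dd_add[OF add(1,2)])
next
  case (mult f g)
  have c: "(\<lambda>p. f (\<lambda>i. \<phi> i p)) \<in> poly_funs UNIV A" "(\<lambda>p. g (\<lambda>i. \<phi> i p)) \<in> poly_funs UNIV A"
    using mult assms(3) by (auto intro: poly_funs_comp)
  show ?case
    using mult by (simp add: dd_mult[OF c] dd_mult[OF mult(1,2)])
qed

text \<open>The linear coefficient of a polynomial function along a polynomial path is its differential;
  this replaces differentiation with respect to the path parameter.\<close>

lemma poly_funs_path: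
  assumes "finite I" "f \<in> poly_funs F I"
  obtains Q where "\<And>t. f (\<lambda>i. poly (P i) t) = poly Q t"
    "coeff Q 1 = dd I f (\<lambda>i. coeff (P i) 0) (\<lambda>i. coeff (P i) 1)"
proof -
  have "f \<in> poly_funs UNIV I" using assms(2) by (rule poly_funs_UNIV)
  then have "\<exists>Q. (\<forall>t. f (\<lambda>i. poly (P i) t) = poly Q t) \<and>
      coeff Q 1 = dd I f (\<lambda>i. coeff (P i) 0) (\<lambda>i. coeff (P i) 1)"
  proof induction
    case (const c)
    then show ?case by (intro exI[of _ "[:c:]"]) (simp add: dd_const)
  next
    case (var i)
    then show ?case by (intro exI[of _ "P i"]) (simp add: dd_var assms)
  next
    case (add f g)
    then obtain Q R where "\<forall>t. f (\<lambda>i. poly (P i) t) = poly Q t" "\<forall>t. g (\<lambda>i. poly (P i) t) = poly R t"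
      "coeff Q 1 = dd I f (\<lambda>i. coeff (P i) 0) (\<lambda>i. coeff (P i) 1)"
      "coeff R 1 = dd I g (\<lambda>i. coeff (P i) 0) (\<lambda>i. coeff (P i) 1)" by blast
    then show ?case
      by (intro exI[of _ "Q + R"]) (simp add: dd_add[OF add(1,2)])
  next
    case (mult f g)
    then obtain Q R where QR: "\<forall>t. f (\<lambda>i. poly (P i) t) = poly Q t" "\<forall>t. g (\<lambda>i. poly (P i) t) = poly R t"
      "coeff Q 1 = dd I f (\<lambda>i. coeff (P i) 0) (\<lambda>i. coeff (P i) 1)"
      "coeff R 1 = dd I g (\<lambda>i. coeff (P i) 0) (\<lambda>i. coeff (P i) 1)" by blast
    have "f (\<lambda>i. coeff (P i) 0) = coeff Q 0" "g (\<lambda>i. coeff (P i) 0) = coeff R 0"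
      using QR(1,2)[rule_format, of 0] by (simp_all add: poly_0_coeff_0)
    then show ?case
      using QR by (intro exI[of _ "Q * R"]) (simp add: dd_mult[OF mult(1,2)] coeff_mult)
  qed
  then show ?thesis using that by blast
qed

section \<open>Vanishing on dense sets, and generic points\<close>

lemma poly_eq_0_cofinite:
  fixes Q R :: "complex poly"
  assumes "R \<noteq> 0" "\<And>t. poly R t \<noteq> 0 \<Longrightarrow> poly Q t = 0"
  shows "Q = 0"
proof -
  have "poly (Q * R) t = 0" for t using assms(2) by (cases "poly R t = 0") auto
  then have "Q * R = 0" by (metis poly_all_0_iff_0)
  then show ?thesis using assms(1) by simp
qed

text \<open>On the line from \<open>x\<close> (parameter 0) to \<open>a\<close> (parameter 1),
  \<open>g\<close> is a nonzero univariate polynomial, so \<open>f\<close> vanishes at all but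
  finitely many points of the line, hence on all of it.\<close>

lemma poly_funs_zero_if_zero_off:
  assumes I: "finite I" and f: "f \<in> poly_funs F I" and g: "g \<in> poly_funs F' I"
    and a: "a \<in> cspace I" "g a \<noteq> 0"
    and z: "\<And>x. x \<in> cspace I \<Longrightarrow> g x \<noteq> 0 \<Longrightarrow> f x = 0"
    and x: "x \<in> cspace I"
  shows "f x = 0"
proof -
  define P where "P i = [:x i, a i - x i:]" for i
  obtain Q where Q: "\<And>t. f (\<lambda>i. poly (P i) t) = poly Q t"
    using poly_funs_path[OF I f] by metis
  obtain R where R: "\<And>t. g (\<lambda>i. poly (P i) t) = poly R t"
    using poly_funs_path[OF I g] by metis
  have c: "(\<lambda>i. poly (P i) t) \<in> cspace I" for t
    using a x by (auto simp: cspace_def P_def)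
  have "poly R 1 \<noteq> 0" using R[of 1] a by (simp add: P_def)
  then have "R \<noteq> 0" by auto
  then have "Q = 0" using z[OF c] by (intro poly_eq_0_cofinite[of R]) (auto simp: Q R)
  then show ?thesis using Q[of 0] by (simp add: P_def)
qed

lemma infinite_Rats: "infinite (\<rat> :: complex set)"
proof
  assume "finite (\<rat> :: complex set)"
  moreover have "range (of_nat :: nat \<Rightarrow> complex) \<subseteq> \<rat>" by auto
  ultimately show False
    by (meson finite_subset inj_of_nat range_inj_infinite)
qed

text \<open>Coordinates are freed one at a time: in each of them, a univariate polynomial with
  infinitely many rational zeros vanishes.\<close>

lemma poly_funs_zero_if_zero_on_Rats:
  assumes I: "finite I" and f: "f \<in> poly_funs F I"
    and z: "\<And>x. x \<in> cspace I \<Longrightarrow> (\<And>i. x i \<in> \<rat>) \<Longrightarrow> f x = 0"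
    and x: "x \<in> cspace I"
  shows "f x = 0"
proof -
  \<comment> \<open>\<open>J\<close> is the set of coordinates that are already allowed to be
    irrational.\<close>
  have "finite J \<Longrightarrow> J \<subseteq> I \<Longrightarrow> \<forall>x\<in>cspace I. (\<forall>i. i \<notin> J \<longrightarrow> x i \<in> \<rat>) \<longrightarrow> f x = 0" for J
  proof (induction J rule: finite_induct)
    case empty
    then show ?case using z by auto
  next
    case (insert j J)
    show ?case
    proof (intro ballI impI)
      fix x assume x: "x \<in> cspace I" "\<forall>i. i \<notin> insert j J \<longrightarrow> x i \<in> \<rat>"
      define P where "P i = (if i = j then [:0, 1:] else [:x i:])" for i
      have P: "(\<lambda>i. poly (P i) t) = x(j := t)" for t by (auto simp: P_def)
      obtain Q where Q: "\<And>t. f (\<lambda>i. poly (P i) t) = poly Q t"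
        using poly_funs_path[OF I f] by metis
      have "poly Q t = 0" if "t \<in> \<rat>" for t
      proof -
        have "x(j := t) \<in> cspace I" using x insert.prems by (auto simp: cspace_def)
        moreover have "\<forall>i. i \<notin> J \<longrightarrow> (x(j := t)) i \<in> \<rat>" using x that by auto
        ultimately show ?thesis using insert Q[of t] P by auto
      qed
      then have "\<rat> \<subseteq> {t. poly Q t = 0}" by auto
      then have "Q = 0" using infinite_Rats poly_roots_finite[of Q] finite_subset by auto
      then show "f x = 0" using Q[of "x j"] P by simp
    qed
  qed
  from this[OF I] show ?thesis using x by (auto simp: cspace_def)
qed

text \<open>For all but finitely many values of one coordinate, a nonzero polynomial stays nonzero
  in the others. Countably many such finite exclusions do not exhaust the complex numbers.\<close>

lemma exists_generic_point:
  assumes F: "countable F" and I: "finite I"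
  obtains p where "p \<in> cspace I"
    "\<And>f. f \<in> poly_funs F I \<Longrightarrow> f p = 0 \<Longrightarrow> (\<forall>y\<in>cspace I. f y = 0)"
proof -
  \<comment> \<open>The induction runs over arbitrary countable sets of polynomials, because fixing
    a coordinate at \<open>t\<close> produces coefficients outside \<open>F\<close>.\<close>
  have "\<And>G. countable G \<Longrightarrow> G \<subseteq> poly_funs UNIV I \<Longrightarrow> \<exists>p\<in>cspace I. \<forall>f\<in>G. f p = 0 \<longrightarrow> (\<forall>y\<in>cspace I. f y = 0)"
    using I
  proof (induction I rule: finite_induct)
    case empty
    show ?case
    proof (intro bexI[of _ "\<lambda>_. 0"] ballI impI)
      fix f :: "('a \<Rightarrow> complex) \<Rightarrow> complex" and y :: "'a \<Rightarrow> complex"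
      assume "f (\<lambda>_. 0) = 0" "y \<in> cspace {}"
      moreover from this have "y = (\<lambda>_. 0)" by (auto simp: cspace_def)
      ultimately show "f y = 0" by simp
    qed (simp add: cspace_def)
  next
    case (insert i I)
    have fin: "finite (insert i I)" using insert by simp
    have sub: "(\<lambda>y. f (y(i := t))) \<in> poly_funs UNIV I" if "f \<in> poly_funs UNIV (insert i I)" for f t
    proof -
      show ?thesis
      proof (rule poly_funs_comp[OF that, where \<phi> = "\<lambda>j p. (p(i := t)) j"])
        fix j assume j: "j \<in> insert i I"
        show "(\<lambda>p. (p(i := t)) j) \<in> poly_funs UNIV I"
          using j by (cases "j = i") (auto intro: poly_funs.intros)
      qed
    qed
    define bad where "bad f = {t. \<forall>y\<in>cspace I. f (y(i := t)) = 0}" for f :: "('a \<Rightarrow> complex) \<Rightarrow> complex"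
    define G' where "G' = {f\<in>G. \<exists>y\<in>cspace (insert i I). f y \<noteq> 0}"
    have "finite (bad f)" if f: "f \<in> G'" for f
    proof -
      have fU: "f \<in> poly_funs UNIV (insert i I)" using f insert.prems by (auto simp: G'_def)
      obtain y where y: "y \<in> cspace (insert i I)" "f y \<noteq> 0" using f G'_def by auto
      define P where "P j = (if j = i then [:0, 1:] else [:y j:])" for j
      have P: "(\<lambda>j. poly (P j) t) = y(i := t)" for t by (auto simp: P_def)
      obtain Q where Q: "\<And>t. f (\<lambda>i. poly (P i) t) = poly Q t"
        using poly_funs_path[OF fin fU] by metis
      have "poly Q (y i) \<noteq> 0" using Q[of "y i"] y P by simp
      then have "Q \<noteq> 0" by auto
      moreover have "bad f \<subseteq> {t. poly Q t = 0}"
      proof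
        fix t assume "t \<in> bad f"
        moreover have "y(i := 0) \<in> cspace I" using y by (auto simp: cspace_def)
        ultimately have "f ((y(i := 0))(i := t)) = 0" unfolding bad_def by blast
        then show "t \<in> {t. poly Q t = 0}" using Q[of t] P by simp
      qed
      ultimately show ?thesis using poly_roots_finite finite_subset by blast
    qed
    then have "countable (\<Union>f\<in>G'. bad f)"
      using insert.prems G'_def by (intro countable_UN) (auto intro: countable_finite)
    then obtain t where t: "t \<notin> (\<Union>f\<in>G'. bad f)"
      using uncountable_UNIV_complex by (metis UNIV_eq_I)
    have "\<exists>p\<in>cspace I. \<forall>f\<in>(\<lambda>f y. f (y(i := t))) ` G. f p = 0 \<longrightarrow> (\<forall>y\<in>cspace I. f y = 0)"
      using insert.prems sub by (intro insert.IH) auto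
    then obtain p where p0: "p \<in> cspace I"
      "\<forall>f\<in>(\<lambda>f y. f (y(i := t))) ` G. f p = 0 \<longrightarrow> (\<forall>y\<in>cspace I. f y = 0)" by blast
    have p: "\<forall>y\<in>cspace I. f (y(i := t)) = 0" if "f \<in> G" "f (p(i := t)) = 0" for f
      using bspec[OF p0(2) imageI[OF that(1)]] that(2) by blast
    show ?case
    proof (intro bexI[of _ "p(i := t)"] ballI impI)
      show "p(i := t) \<in> cspace (insert i I)" using p0 by (auto simp: cspace_def)
      fix f y assume f: "f \<in> G" "f (p(i := t)) = 0" and y: "y \<in> cspace (insert i I)"
      show "f y = 0"
      proof (rule ccontr)
        assume "f y \<noteq> 0"
        then have "f \<in> G'" using f y G'_def by auto
        moreover have "t \<in> bad f" using p[OF f] unfolding bad_def by blast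
        ultimately show False using t by auto
      qed
    qed
  qed
  moreover have "poly_funs F I \<subseteq> poly_funs UNIV I" by (rule poly_funs_mono) auto
  ultimately have "\<exists>p\<in>cspace I. \<forall>f\<in>poly_funs F I. f p = 0 \<longrightarrow> (\<forall>y\<in>cspace I. f y = 0)"
    using countable_poly_funs[OF F countable_finite[OF I]] by simp
  then show ?thesis using that by blast
qed

section \<open>Derivations of the complex numbers\<close>

definition derivation :: "(complex \<Rightarrow> complex) \<Rightarrow> bool" where
  "derivation D \<longleftrightarrow> (\<forall>a b. D (a + b) = D a + D b) \<and> (\<forall>a b. D (a * b) = a * D b + D a * b)"

lemma derivation_0: "derivation D \<Longrightarrow> D 0 = 0"
  unfolding derivation_def by (metis add_cancel_left_left)

lemma derivation_1: "derivation D \<Longrightarrow> D 1 = 0"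
  unfolding derivation_def by (metis add_cancel_left_left mult_1 mult_1_right)

lemma derivation_sum:
  assumes "derivation D"
  shows "D (sum f K) = (\<Sum>k\<in>K. D (f k))"
  using assms derivation_0[OF assms]
  by (induction K rule: infinite_finite_induct) (auto simp: derivation_def)

lemma derivation_Rats:
  assumes D: "derivation D" and x: "x \<in> \<rat>"
  shows "D x = 0"
proof -
  have neg: "D (- a) = - D a" for a
    using D derivation_0[OF D] unfolding derivation_def
    by (metis add.right_inverse add_eq_0_iff)
  have nat: "D (of_nat n) = 0" for n
    using D by (induction n) (auto simp: derivation_0 derivation_1 derivation_def)
  have int: "D (of_int k) = 0" for k
    by (cases k rule: int_cases2) (auto simp: nat neg)
  obtain a b where ab: "b \<noteq> 0" "x = of_int a / of_int b"
    using x by (metis Rats_cases' less_irrefl)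
  have "D (of_int b * x) = of_int b * D x"
    using D int[of b] by (simp add: derivation_def)
  moreover have "of_int b * x = of_int a" using ab by simp
  ultimately show ?thesis using int[of a] ab by simp
qed

lemma derivation_poly_fun:
  assumes D: "derivation D" and F: "\<And>c. c \<in> F \<Longrightarrow> D c = 0" and I: "finite I"
    and f: "f \<in> poly_funs F I"
  shows "D (f x) = dd I f x (\<lambda>i. D (x i))"
  using f
proof induction
  case (const c)
  then show ?case by (simp add: dd_const F)
next
  case (var i)
  then show ?case by (simp add: dd_var I)
next
  case (add f g)
  then show ?case using D by (simp add: dd_add[OF add(1,2)] derivation_def)
next
  case (mult f g)
  then show ?case using D by (simp add: dd_mult[OF mult(1,2)] derivation_def)
qed

text \<open>The function \<open>g\<close> is obtained from \<open>f\<close> by applying \<open>D\<close> to the coefficients.\<close>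

lemma derivation_poly_fun_coeffs:
  assumes D: "derivation D" and I: "finite I" and f: "f \<in> poly_funs UNIV I"
  obtains g where "g \<in> poly_funs UNIV I" "\<And>x. D (f x) = g x + dd I f x (\<lambda>i. D (x i))"
proof -
  have "\<exists>g\<in>poly_funs UNIV I. \<forall>x. D (f x) = g x + dd I f x (\<lambda>i. D (x i))"
    using f
  proof induction
    case (const c)
    then show ?case by (intro bexI[of _ "\<lambda>x. D c"]) (auto simp: dd_const intro: poly_funs.intros)
  next
    case (var i)
    then show ?case by (intro bexI[of _ "\<lambda>x. 0"]) (auto simp: dd_var I intro: poly_funs.intros)
  next
    case (add f g)
    then obtain f' g' where "f' \<in> poly_funs UNIV I" "\<forall>x. D (f x) = f' x + dd I f x (\<lambda>i. D (x i))"
      "g' \<in> poly_funs UNIV I" "\<forall>x. D (g x) = g' x + dd I g x (\<lambda>i. D (x i))" by blast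
    then show ?case using D
      by (intro bexI[of _ "\<lambda>x. f' x + g' x"])
        (auto simp: dd_add[OF add(1,2)] derivation_def intro: poly_funs.intros)
  next
    case (mult f g)
    then obtain f' g' where "f' \<in> poly_funs UNIV I" "\<forall>x. D (f x) = f' x + dd I f x (\<lambda>i. D (x i))"
      "g' \<in> poly_funs UNIV I" "\<forall>x. D (g x) = g' x + dd I g x (\<lambda>i. D (x i))" by blast
    then show ?case using D mult
      by (intro bexI[of _ "\<lambda>x. f x * g' x + f' x * g x"])
        (auto simp: dd_mult[OF mult(1,2)] derivation_def algebra_simps intro!: poly_funs.intros)
  qed
  then show ?thesis using that by blast
qed

text \<open>A derivation defined on a subring is encoded by its graph, which is a subring of the dual
  numbers.\<close>

definition dual_subring :: "(complex \<times> complex) set \<Rightarrow> bool" where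
  "dual_subring S \<longleftrightarrow> (1, 0) \<in> S \<and>
     (\<forall>a b c d. (a, b) \<in> S \<longrightarrow> (c, d) \<in> S \<longrightarrow> (a + c, b + d) \<in> S \<and> (a * c, a * d + b * c) \<in> S) \<and>
     (\<forall>a b. (a, b) \<in> S \<longrightarrow> (- a, - b) \<in> S)"

text \<open>For an additive group of pairs, having only 0 above 0 means being the graph of a partial
  function.\<close>

definition single_valued0 :: "(complex \<times> complex) set \<Rightarrow> bool" where
  "single_valued0 S \<longleftrightarrow> (\<forall>b. (0, b) \<in> S \<longrightarrow> b = 0)"

text \<open>A pair (p, q) stands for the polynomial p + eps q over the dual numbers, where eps^2 =
  0.\<close>

definition poly_pairs :: "(complex \<times> complex) set \<Rightarrow> (complex poly \<times> complex poly) set" where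
  "poly_pairs S = {(p, q). \<forall>k. (coeff p k, coeff q k) \<in> S}"

text \<open>The value of p + eps q at t + eps w, expanded by p(t + eps w) = p(t) + eps p'(t)
  w.\<close>

definition dual_eval :: "complex \<Rightarrow> complex \<Rightarrow> complex poly \<times> complex poly \<Rightarrow> complex \<times> complex" where
  "dual_eval t w = (\<lambda>(p, q). (poly p t, poly q t + poly (pderiv p) t * w))"

section \<open>Adjoining one element to the domain of a partial derivation\<close>

context
  fixes S assumes S: "dual_subring S"
begin

lemma dual_subring_add: "(a, b) \<in> S \<Longrightarrow> (c, d) \<in> S \<Longrightarrow> (a + c, b + d) \<in> S"
  using S by (simp add: dual_subring_def)

lemma dual_subring_mult: "(a, b) \<in> S \<Longrightarrow> (c, d) \<in> S \<Longrightarrow> (a * c, a * d + b * c) \<in> S"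
  using S by (simp add: dual_subring_def)

lemma dual_subring_uminus: "(a, b) \<in> S \<Longrightarrow> (- a, - b) \<in> S"
  using S by (simp add: dual_subring_def)

lemma dual_subring_one: "(1, 0) \<in> S"
  using S by (simp add: dual_subring_def)

lemma dual_subring_zero: "(0, 0) \<in> S"
  using dual_subring_add[OF dual_subring_one dual_subring_uminus[OF dual_subring_one]] by simp

lemma dual_subring_sum:
  "(\<And>k. k \<in> K \<Longrightarrow> (f k, g k) \<in> S) \<Longrightarrow> (sum f K, sum g K) \<in> S"
  by (induction K rule: infinite_finite_induct) (auto simp: dual_subring_zero dual_subring_add)

lemma dual_subring_of_nat: "(of_nat n, 0) \<in> S"
  using dual_subring_sum[of "{..<n}" "\<lambda>_. 1" "\<lambda>_. 0"] dual_subring_one by simp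

lemma poly_pairs_add:
  "(p, q) \<in> poly_pairs S \<Longrightarrow> (p', q') \<in> poly_pairs S \<Longrightarrow> (p + p', q + q') \<in> poly_pairs S"
  by (auto simp: poly_pairs_def dual_subring_add)

lemma poly_pairs_uminus: "(p, q) \<in> poly_pairs S \<Longrightarrow> (- p, - q) \<in> poly_pairs S"
  by (auto simp: poly_pairs_def dual_subring_uminus)

lemma poly_pairs_mult:
  assumes "(p, q) \<in> poly_pairs S" "(p', q') \<in> poly_pairs S"
  shows "(p * p', p * q' + q * p') \<in> poly_pairs S"
  using assms
  by (auto simp: poly_pairs_def coeff_mult simp flip: sum.distrib intro!: dual_subring_sum dual_subring_mult)

lemma poly_pairs_monom: "(a, b) \<in> S \<Longrightarrow> (monom a n, monom b n) \<in> poly_pairs S"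
  by (auto simp: poly_pairs_def coeff_monom dual_subring_zero)

lemma poly_pairs_pderiv:
  assumes "(p, q) \<in> poly_pairs S"
  shows "(pderiv p, pderiv q) \<in> poly_pairs S"
proof -
  have "(of_nat (Suc k) * coeff p (Suc k), of_nat (Suc k) * coeff q (Suc k)) \<in> S" for k
    using dual_subring_mult[OF dual_subring_of_nat[of "Suc k"], of "coeff p (Suc k)" "coeff q (Suc k)"] assms
    by (simp add: poly_pairs_def)
  then show ?thesis by (auto simp: poly_pairs_def coeff_pderiv)
qed

text \<open>Evaluation at t + eps w is a ring homomorphism on polynomials over the dual numbers, so
  its image is again a subring.\<close>

lemma dual_subring_adjoin: "dual_subring (dual_eval t w ` poly_pairs S)"
  unfolding dual_subring_def
proof (intro conjI allI impI)
  show "(1, 0) \<in> dual_eval t w ` poly_pairs S"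
    using poly_pairs_monom[OF dual_subring_one, of 0]
    by (force simp: dual_eval_def pderiv_monom poly_monom)
next
  fix a b c d
  assume "(a, b) \<in> dual_eval t w ` poly_pairs S" "(c, d) \<in> dual_eval t w ` poly_pairs S"
  then obtain p q p' q' where pq: "(p, q) \<in> poly_pairs S" "(p', q') \<in> poly_pairs S"
    and e: "(a, b) = dual_eval t w (p, q)" "(c, d) = dual_eval t w (p', q')" by auto
  have "(a + c, b + d) = dual_eval t w (p + p', q + q')"
    using e by (simp add: dual_eval_def pderiv_add algebra_simps)
  then show "(a + c, b + d) \<in> dual_eval t w ` poly_pairs S"
    using poly_pairs_add[OF pq] by blast
  have "(a * c, a * d + b * c) = dual_eval t w (p * p', p * q' + q * p')"
    using e by (simp add: dual_eval_def pderiv_mult algebra_simps)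
  then show "(a * c, a * d + b * c) \<in> dual_eval t w ` poly_pairs S"
    using poly_pairs_mult[OF pq] by blast
next
  fix a b assume "(a, b) \<in> dual_eval t w ` poly_pairs S"
  then obtain p q where pq: "(p, q) \<in> poly_pairs S" and e: "(a, b) = dual_eval t w (p, q)" by auto
  have "(- a, - b) = dual_eval t w (- p, - q)"
    using e by (simp add: dual_eval_def pderiv_minus algebra_simps)
  then show "(- a, - b) \<in> dual_eval t w ` poly_pairs S"
    using poly_pairs_uminus[OF pq] by blast
qed

lemma dual_subring_subset_adjoin: "S \<subseteq> dual_eval t w ` poly_pairs S"
proof
  fix x assume "x \<in> S"
  then show "x \<in> dual_eval t w ` poly_pairs S"
    using poly_pairs_monom[of "fst x" "snd x" 0]
    by (force simp: dual_eval_def pderiv_monom poly_monom)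
qed

lemma adjoined_mem: "(t, w) \<in> dual_eval t w ` poly_pairs S"
  using poly_pairs_monom[OF dual_subring_one, of 1]
  by (force simp: dual_eval_def pderiv_monom poly_monom)

text \<open>If \<open>t\<close> satisfies no nonzero polynomial over the domain of \<open>S\<close>,
  every \<open>w\<close> is consistent. Otherwise a relation of least degree determines
  \<open>w\<close>, and pseudo-division by it shows that all other relations are then
  respected.\<close>

lemma exists_single_valued_adjoin:
  assumes sv: "single_valued0 S"
  shows "\<exists>w. single_valued0 (dual_eval t w ` poly_pairs S)"
proof (cases "\<exists>p q. (p, q) \<in> poly_pairs S \<and> p \<noteq> 0 \<and> poly p t = 0")
  case False
  have q0: "q = 0" if "(0, q) \<in> poly_pairs S" for q
    using that sv by (auto simp: poly_pairs_def single_valued0_def intro: poly_eqI)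
  have "poly q t = 0" if "(p, q) \<in> poly_pairs S" "poly p t = 0" for p q
    using that False q0 by (metis poly_0)
  then show ?thesis
    by (intro exI[of _ 0]) (auto simp: single_valued0_def dual_eval_def)
next
  case True
  have q0: "q = 0" if "(0, q) \<in> poly_pairs S" for q
    using that sv by (auto simp: poly_pairs_def single_valued0_def intro: poly_eqI)
  define annih where "annih p \<longleftrightarrow> (\<exists>q. (p, q) \<in> poly_pairs S) \<and> p \<noteq> 0 \<and> poly p t = 0" for p
  obtain h where h: "annih h" and min: "\<And>p. annih p \<Longrightarrow> degree h \<le> degree p"
    using ex_has_least_nat[of annih _ degree] True unfolding annih_def by blast
  obtain k where hk: "(h, k) \<in> poly_pairs S" using h by (auto simp: annih_def)
  have h0: "h \<noteq> 0" "poly h t = 0" using h by (auto simp: annih_def)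
  have deg: "degree h > 0"
    using h0 by (metis degree_eq_zeroE gr0I mult_zero_right pCons_0_0 poly_0 poly_pCons add.right_neutral)
  then have "pderiv h \<noteq> 0" by (simp add: pderiv_eq_0_iff)
  \<comment> \<open>The derivative is nonzero, has coefficients in the domain of \<open>S\<close>
    and smaller degree, so by minimality \<open>t\<close> is not a root of it.\<close>
  then have dh: "poly (pderiv h) t \<noteq> 0"
    using min[of "pderiv h"] poly_pairs_pderiv[OF hk] deg
    unfolding annih_def degree_pderiv by (metis diff_less less_one linorder_not_less)
  \<comment> \<open>The solution of k(t) + h'(t) w = 0, which says that (h, k) does not put a
    nonzero value above 0.\<close>
  define w where "w = - poly k t / poly (pderiv h) t"
  define val where "val p q = poly q t + poly (pderiv p) t * w" for p q
  have val_h: "val h k = 0" using dh by (simp add: val_def w_def)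
  have "val p q = 0" if "(p, q) \<in> poly_pairs S" "poly p t = 0" for p q
    using that
  proof (induction "degree p" arbitrary: p q rule: less_induct)
    case less
    show ?case
    proof (cases "p = 0")
      case True
      then show ?thesis using less.prems q0[of q] by (simp add: val_def)
    next
      case False
      then have le: "degree h \<le> degree p" using less.prems by (intro min) (auto simp: annih_def)
      define j where "j = degree p - degree h"
      define c c' l l' where "c = lead_coeff h" "c' = coeff k (degree h)" "l = lead_coeff p"
        "l' = coeff q (degree p)"
      note defs = this
      have cc: "(c, c') \<in> S" "(l, l') \<in> S" using hk less.prems by (auto simp: defs poly_pairs_def)
      have c0: "c \<noteq> 0" using h0 by (simp add: defs)
      \<comment> \<open>A step of pseudo-division over the dual numbers: the domain of
        \<open>S\<close> is only a ring, so \<open>p\<close> is multiplied by the leading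
        coefficient of \<open>h\<close> instead of dividing by it.\<close>
      define p1 q1 p2 q2 where "p1 = monom c 0 * p" "q1 = monom c 0 * q + monom c' 0 * p"
        "p2 = monom l j * h" "q2 = monom l j * k + monom l' j * h"
      note defs2 = this
      have m1: "(p1, q1) \<in> poly_pairs S"
        unfolding defs2 by (rule poly_pairs_mult[OF poly_pairs_monom[OF cc(1)] less.prems(1)])
      have m2: "(p2, q2) \<in> poly_pairs S"
        unfolding defs2 by (rule poly_pairs_mult[OF poly_pairs_monom[OF cc(2)] hk])
      have m: "(p1 - p2, q1 - q2) \<in> poly_pairs S"
        using poly_pairs_add[OF m1 poly_pairs_uminus[OF m2]] by simp
      have v1: "val p1 q1 = c * val p q"
        using less.prems(2)
        by (simp add: val_def defs2 pderiv_mult pderiv_monom poly_monom algebra_simps)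
      have v2: "val p2 q2 = l * t ^ j * val h k"
        using h0(2) by (simp add: val_def defs2 pderiv_mult poly_monom algebra_simps)
      have "val (p1 - p2) (q1 - q2) = val p1 q1 - val p2 q2"
        by (simp add: val_def pderiv_diff algebra_simps)
      then have v: "val (p1 - p2) (q1 - q2) = c * val p q"
        using v1 v2 val_h by simp
      have z: "poly (p1 - p2) t = 0" using less.prems h0 by (simp add: defs2)
      have "val (p1 - p2) (q1 - q2) = 0"
      proof (cases "degree (p1 - p2) < degree p")
        case True
        then show ?thesis using less.hyps m z by blast
      next
        \<comment> \<open>The coefficients of \<open>p1\<close> and \<open>p2\<close> in degree
          \<open>degree p\<close> are both \<open>c * l\<close>, so without a drop in degree the
          difference is 0.\<close>
        case False
        have d1: "degree p1 \<le> degree p" unfolding defs2 using degree_mult_le[of "monom c 0" p]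
          by (simp add: degree_monom_eq c0)
        have l0: "l \<noteq> 0" using \<open>p \<noteq> 0\<close> by (simp add: defs)
        have d2: "degree p2 = degree p"
          using h0 l0 le by (simp add: defs2 degree_mult_eq degree_monom_eq monom_eq_0_iff j_def)
        have "coeff p1 (degree p) = c * l"
          by (simp add: defs2 defs coeff_monom_mult)
        moreover have "coeff p2 (degree p) = l * c"
          using le by (simp add: defs2 defs coeff_monom_mult j_def)
        ultimately have "coeff (p1 - p2) (degree p) = 0" by simp
        moreover have "degree (p1 - p2) = degree p"
          using False degree_diff_le[OF d1, of p2] d2 by simp
        ultimately have "p1 - p2 = 0" by (metis leading_coeff_0_iff)
        then show ?thesis using m q0[of "q1 - q2"] by (simp add: val_def)
      qed
      then show ?thesis using v c0 by simp
    qed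
  qed
  then show ?thesis
    by (intro exI[of _ w]) (auto simp: single_valued0_def dual_eval_def val_def)
qed

end

text \<open>By Zorn's lemma there is a maximal single-valued dual subring above \<open>S0\<close>.
  Its domain is everything, since a missing element could be adjoined, so it is the graph of a
  derivation.\<close>

theorem derivation_extension:
  assumes S0: "dual_subring S0" "single_valued0 S0"
  obtains D where "derivation D" "\<And>a b. (a, b) \<in> S0 \<Longrightarrow> D a = b"
proof -
  define \<A> where "\<A> = {S. S0 \<subseteq> S \<and> dual_subring S \<and> single_valued0 S}"
  have "\<exists>M\<in>\<A>. \<forall>X\<in>\<A>. M \<subseteq> X \<longrightarrow> X = M"
  proof (rule subset_Zorn_nonempty)
    show "\<A> \<noteq> {}" using S0 by (auto simp: \<A>_def)
  next
    fix \<C> assume ne: "\<C> \<noteq> {}" and ch: "subset.chain \<A> \<C>"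
    have mem: "S0 \<subseteq> S" "dual_subring S" "single_valued0 S" if "S \<in> \<C>" for S
      using ch that by (auto simp: subset_chain_def \<A>_def)
    have both: "\<exists>S\<in>\<C>. x \<in> S \<and> y \<in> S" if "x \<in> \<Union>\<C>" "y \<in> \<Union>\<C>" for x y
      using that ch unfolding subset_chain_def by blast
    have "dual_subring (\<Union>\<C>)"
      unfolding dual_subring_def
    proof (intro conjI allI impI)
      show "(1, 0) \<in> \<Union>\<C>" using ne mem(2) dual_subring_one by blast
      show "(a + c, b + d) \<in> \<Union>\<C>" "(a * c, a * d + b * c) \<in> \<Union>\<C>"
        if "(a, b) \<in> \<Union>\<C>" "(c, d) \<in> \<Union>\<C>" for a b c d
        using both[OF that] mem(2) dual_subring_add dual_subring_mult by blast+
      show "(- a, - b) \<in> \<Union>\<C>" if "(a, b) \<in> \<Union>\<C>" for a b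
        using that mem(2) dual_subring_uminus by blast
    qed
    then show "\<Union>\<C> \<in> \<A>" using ne mem by (auto simp: \<A>_def single_valued0_def)
  qed
  then obtain S where S: "S0 \<subseteq> S" "dual_subring S" "single_valued0 S"
    and max: "\<And>X. X \<in> \<A> \<Longrightarrow> S \<subseteq> X \<Longrightarrow> X = S" by (auto simp: \<A>_def)
  have total: "\<exists>b. (a, b) \<in> S" for a
  proof -
    obtain w where w: "single_valued0 (dual_eval a w ` poly_pairs S)"
      using exists_single_valued_adjoin[OF S(2,3)] by blast
    have "dual_eval a w ` poly_pairs S = S"
      using w S(1) dual_subring_adjoin[OF S(2)] dual_subring_subset_adjoin[OF S(2)]
      by (intro max) (simp_all add: \<A>_def subset_trans[OF S(1)])
    then show ?thesis using adjoined_mem[OF S(2), of a w] by auto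
  qed
  define D where "D a = (SOME b. (a, b) \<in> S)" for a
  have D: "(a, D a) \<in> S" for a unfolding D_def using total by (rule someI_ex)
  have uniq: "b = c" if "(a, b) \<in> S" "(a, c) \<in> S" for a b c
  proof -
    have "b + - c = 0"
      using dual_subring_add[OF S(2) that(1) dual_subring_uminus[OF S(2) that(2)]] S(3)
      unfolding single_valued0_def by (metis add.right_inverse)
    then show ?thesis by simp
  qed
  have "derivation D"
    unfolding derivation_def
    using uniq D dual_subring_add[OF S(2) D D] dual_subring_mult[OF S(2) D D] by blast
  moreover have "D a = b" if "(a, b) \<in> S0" for a b
    using uniq D S(1) that by blast
  ultimately show ?thesis using that by blast
qed

text \<open>The pairs \<open>(f x, dd I f x v)\<close> form a dual subring, and
  \<open>tangent\<close> says precisely that it is single-valued. Constants of \<open>F\<close> are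
  paired with 0 and the coordinates \<open>x i\<close> with \<open>v i\<close>.\<close>

corollary exists_derivation:
  assumes F: "-1 \<in> F" and I: "finite I"
    and tangent: "\<And>f. f \<in> poly_funs F I \<Longrightarrow> f x = 0 \<Longrightarrow> dd I f x v = 0"
  obtains D where "derivation D" "\<And>c. c \<in> F \<Longrightarrow> D c = 0" "\<And>i. i \<in> I \<Longrightarrow> D (x i) = v i"
proof -
  define S0 where "S0 = (\<lambda>f. (f x, dd I f x v)) ` poly_funs F I"
  have mem: "(f x, dd I f x v) \<in> S0" if "f \<in> poly_funs F I" for f
    using that by (auto simp: S0_def)
  have "dual_subring S0"
    unfolding dual_subring_def
  proof (intro conjI allI impI)
    show "(1, 0) \<in> S0" using mem[OF poly_funs_one[OF F]] by (simp add: dd_const)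
  next
    fix a b c d assume "(a, b) \<in> S0" "(c, d) \<in> S0"
    then obtain f g where fg: "f \<in> poly_funs F I" "g \<in> poly_funs F I"
      and e: "a = f x" "b = dd I f x v" "c = g x" "d = dd I g x v" by (auto simp: S0_def)
    show "(a + c, b + d) \<in> S0" using mem[OF poly_funs.add[OF fg]] by (simp add: e dd_add[OF fg])
    show "(a * c, a * d + b * c) \<in> S0" using mem[OF poly_funs.mult[OF fg]] by (simp add: e dd_mult[OF fg])
  next
    fix a b assume "(a, b) \<in> S0"
    then obtain f where "f \<in> poly_funs F I" "a = f x" "b = dd I f x v" by (auto simp: S0_def)
    then show "(- a, - b) \<in> S0" using mem[OF poly_funs_uminus[OF F]] by (force simp: dd_uminus)
  qed
  moreover have "single_valued0 S0" using tangent by (auto simp: single_valued0_def S0_def)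
  ultimately obtain D where D: "derivation D" "\<And>a b. (a, b) \<in> S0 \<Longrightarrow> D a = b"
    using derivation_extension by blast
  show ?thesis
  proof
    show "derivation D" by fact
    show "D c = 0" if "c \<in> F" for c
      using D(2)[OF mem[OF poly_funs.const[OF that]]] by (simp add: dd_const)
    show "D (x i) = v i" if "i \<in> I" for i
      using D(2)[OF mem[OF poly_funs.var[OF that]]] by (simp add: dd_var I that)
  qed
qed

section \<open>Zariski density\<close>

text \<open>The degree bound \<open>K\<close> is uniform in \<open>u\<close>, so the expansion
  remains one finite sum when \<open>u\<close> itself varies with a path parameter.\<close>

lemma poly_funs_taylor:
  assumes "f \<in> poly_funs UNIV I"
  shows "\<exists>H K. (\<forall>k. (\<lambda>u. coeff (H u) k) \<in> poly_funs UNIV I) \<and> (\<forall>u. degree (H u) \<le> K) \<and>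
    (\<forall>u s. f (\<lambda>i. a i + s * u i) = poly (H u) s)"
  using assms
proof induction
  case (const c)
  have "(\<lambda>u. coeff [:c:] k) \<in> poly_funs UNIV I" for k by (rule poly_funs.const) simp
  then show ?case
    by (intro exI[of _ "\<lambda>u. [:c:]"] exI[of _ 0]) auto
next
  case (var i)
  have "(\<lambda>u. coeff [:a i, u i:] k) \<in> poly_funs UNIV I" for k
  proof -
    consider "k = 0" | "k = 1" | n where "k = Suc (Suc n)"
      by (metis One_nat_def not0_implies_Suc)
    then show ?thesis
      by cases (use var in \<open>auto intro: poly_funs.intros\<close>)
  qed
  then show ?case
    by (intro exI[of _ "\<lambda>u. [:a i, u i:]"] exI[of _ 1]) auto
next
  case (add f g)
  then obtain H K H' K' where
    H: "\<forall>k. (\<lambda>u. coeff (H u) k) \<in> poly_funs UNIV I" "\<forall>u. degree (H u) \<le> K"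
      "\<forall>u s. f (\<lambda>i. a i + s * u i) = poly (H u) s" and
    H': "\<forall>k. (\<lambda>u. coeff (H' u) k) \<in> poly_funs UNIV I" "\<forall>u. degree (H' u) \<le> K'"
      "\<forall>u s. g (\<lambda>i. a i + s * u i) = poly (H' u) s" by blast
  have "degree (H u + H' u) \<le> max K K'" for u
    using H(2) H'(2) by (intro degree_add_le) (auto intro: le_trans)
  moreover have "(\<lambda>u. coeff (H u + H' u) k) \<in> poly_funs UNIV I" for k
    using H(1) H'(1) by (auto intro: poly_funs.intros)
  ultimately show ?case
    using H(3) H'(3) by (intro exI[of _ "\<lambda>u. H u + H' u"] exI[of _ "max K K'"]) auto
next
  case (mult f g)
  then obtain H K H' K' where
    H: "\<forall>k. (\<lambda>u. coeff (H u) k) \<in> poly_funs UNIV I" "\<forall>u. degree (H u) \<le> K"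
      "\<forall>u s. f (\<lambda>i. a i + s * u i) = poly (H u) s" and
    H': "\<forall>k. (\<lambda>u. coeff (H' u) k) \<in> poly_funs UNIV I" "\<forall>u. degree (H' u) \<le> K'"
      "\<forall>u s. g (\<lambda>i. a i + s * u i) = poly (H' u) s" by blast
  have "degree (H u * H' u) \<le> K + K'" for u
    using degree_mult_le[of "H u" "H' u"] H(2)[rule_format, of u] H'(2)[rule_format, of u] by linarith
  moreover have "(\<lambda>u. coeff (H u * H' u) k) \<in> poly_funs UNIV I" for k
    unfolding coeff_mult using H(1) H'(1) by (intro poly_funs_sum) (auto intro: poly_funs.intros)
  ultimately show ?case
    using H(3) H'(3) by (intro exI[of _ "\<lambda>u. H u * H' u"] exI[of _ "K + K'"]) auto
qed

text \<open>If the tangent vectors at \<open>a\<close> of paths along which \<open>g\<close> vanishes are arbitrary, then the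
  lowest homogeneous component of \<open>g\<close> at \<open>a\<close> vanishes identically. This replaces the fact that a
  polynomial map with surjective differential is dominant.\<close>

lemma zero_if_zero_along_paths:
  assumes J: "finite J" and g: "g \<in> poly_funs UNIV J"
    and paths: "\<And>u. u \<in> cspace J \<Longrightarrow> \<exists>P. (\<forall>j\<in>J. coeff (P j) 0 = a j \<and> coeff (P j) 1 = u j) \<and>
      (\<forall>t. g (\<lambda>j. poly (P j) t) = 0)"
    and y: "y \<in> cspace J"
  shows "g y = 0"
proof -
  obtain H K where H: "\<And>k. (\<lambda>u. coeff (H u) k) \<in> poly_funs UNIV J" "\<And>u. degree (H u) \<le> K"
    "\<And>u s. g (\<lambda>i. a i + s * u i) = poly (H u) s"
    using poly_funs_taylor[OF g, of a] by blast
  \<comment> \<open>Write a path as a + t V(t) with V(0) = u. Then g along it is the sum of t^i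
    H_i(V(t)), where H_i is the i-th coefficient of \<open>H\<close>. The terms below
    \<open>k\<close> vanish identically by induction, so the coefficient of t^k is H_k(u).\<close>
  have zero: "coeff (H u) k = 0" if "u \<in> cspace J" for u k
    using that
  proof (induction k arbitrary: u rule: less_induct)
    case (less k)
    obtain P where P: "\<And>j. j \<in> J \<Longrightarrow> coeff (P j) 0 = a j" "\<And>j. j \<in> J \<Longrightarrow> coeff (P j) 1 = u j"
      "\<And>t. g (\<lambda>j. poly (P j) t) = 0"
      using paths[OF less.prems] by blast
    \<comment> \<open>The quotient (P - a) / t, set to 0 outside \<open>J\<close> so that its values
      stay in \<open>cspace J\<close>, where the induction hypothesis applies.\<close>
    define V where "V j = (if j \<in> J then poly_shift 1 (P j) else 0)" for j
    have PV: "P j = pCons (a j) (V j)" if "j \<in> J" for j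
      using that P(1)[OF that] by (intro poly_eqI) (simp add: V_def coeff_pCons coeff_poly_shift split: nat.split)
    have V0: "poly (V j) 0 = u j" for j
      using P(2)[of j] less.prems by (cases "j \<in> J") (auto simp: V_def poly_0_coeff_0 coeff_poly_shift cspace_def)
    have Vc: "(\<lambda>j. poly (V j) t) \<in> cspace J" for t by (auto simp: V_def cspace_def)
    have "\<exists>C. \<forall>t. coeff (H (\<lambda>j. poly (V j) t)) i = poly C t" for i
      using poly_funs_path[OF J H(1)[of i], of V] by metis
    then obtain C where C: "\<And>i t. coeff (H (\<lambda>j. poly (V j) t)) i = poly (C i) t" by metis
    have Cz: "C i = 0" if "i < k" for i
    proof -
      have "poly (C i) t = 0" for t using less.IH[OF that Vc] C by metis
      then show ?thesis using poly_all_0_iff_0 by blast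
    qed
    have "poly (\<Sum>i\<le>K. C i * monom 1 i) t = 0" for t
    proof -
      have "0 = g (\<lambda>j. a j + t * poly (V j) t)"
        using P(3)[of t] PV by (subst (asm) poly_funs_cong[OF g, of _ "\<lambda>j. a j + t * poly (V j) t"]) auto
      also have "\<dots> = poly (H (\<lambda>j. poly (V j) t)) t" by (rule H(3))
      also have "\<dots> = (\<Sum>i\<le>K. coeff (H (\<lambda>j. poly (V j) t)) i * t ^ i)"
        unfolding poly_altdef using H(2)
        by (intro sum.mono_neutral_left) (auto simp: coeff_eq_0)
      finally show ?thesis by (simp add: poly_sum poly_monom C)
    qed
    then have s0: "(\<Sum>i\<le>K. C i * monom 1 i) = 0" using poly_all_0_iff_0 by blast
    show ?case
    proof (cases "k \<le> K")
      case False
      then show ?thesis using H(2)[of u] by (intro coeff_eq_0) auto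
    next
      case True
      have "0 = coeff (\<Sum>i\<le>K. C i * monom 1 i) k" using s0 by simp
      also have "\<dots> = (\<Sum>i\<le>K. coeff (C i * monom 1 i) k)" by (simp add: coeff_sum)
      also have "\<dots> = (\<Sum>i\<in>{k}. coeff (C i * monom 1 i) k)"
      proof (rule sum.mono_neutral_right)
        show "\<forall>i\<in>{..K} - {k}. coeff (C i * monom 1 i) k = 0"
        proof
          fix i assume "i \<in> {..K} - {k}"
          then show "coeff (C i * monom 1 i) k = 0"
            using Cz[of i] by (cases "i < k") (auto simp: coeff_monom_mult mult.commute[of "C i"])
        qed
      qed (use True in auto)
      also have "\<dots> = coeff (C k) 0" by (simp add: coeff_monom_mult mult.commute[of "C k"])
      also have "\<dots> = poly (C k) 0" by (simp add: poly_0_coeff_0)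
      also have "\<dots> = coeff (H u) k" using C[of 0 k] V0 by simp
      finally show ?thesis by simp
    qed
  qed
  define u where "u j = (if j \<in> J then y j - a j else 0)" for j
  have "u \<in> cspace J" by (simp add: u_def cspace_def)
  then have "H u = 0" using zero by (intro poly_eqI) simp
  then have "g (\<lambda>i. a i + 1 * u i) = 0" using H(3)[of 1 u] by simp
  moreover have "g (\<lambda>i. a i + 1 * u i) = g y" by (rule poly_funs_cong[OF g]) (simp add: u_def)
  ultimately show ?thesis by simp
qed

section \<open>Formal polynomials and polynomial functions\<close>

definition mon :: "('i \<Rightarrow>\<^sub>0 nat) \<Rightarrow> ('i \<Rightarrow> complex) \<Rightarrow> complex" where
  "mon m x = (\<Prod>i\<in>Poly_Mapping.keys m. x i ^ Poly_Mapping.lookup m i)"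

lemma mon_superset:
  assumes "finite I" "Poly_Mapping.keys m \<subseteq> I"
  shows "mon m x = (\<Prod>i\<in>I. x i ^ Poly_Mapping.lookup m i)"
  unfolding mon_def using assms by (intro prod.mono_neutral_left) (auto simp: in_keys_iff)

lemma mon_add: "mon (m + m') x = mon m x * mon m' x"
proof -
  let ?I = "Poly_Mapping.keys m \<union> Poly_Mapping.keys m'"
  have "mon (m + m') x = (\<Prod>i\<in>?I. x i ^ Poly_Mapping.lookup (m + m') i)"
    by (rule mon_superset) (auto dest: subsetD[OF Poly_Mapping.keys_add])
  also have "\<dots> = (\<Prod>i\<in>?I. x i ^ Poly_Mapping.lookup m i) * (\<Prod>i\<in>?I. x i ^ Poly_Mapping.lookup m' i)"
    by (simp add: lookup_add power_add prod.distrib)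
  also have "\<dots> = mon m x * mon m' x"
    by (subst (1 2) mon_superset[of ?I]) auto
  finally show ?thesis .
qed

lemma poly_eval_superset:
  assumes "finite K" "Poly_Mapping.keys f \<subseteq> K"
  shows "poly_eval f x = (\<Sum>m\<in>K. Poly_Mapping.lookup f m * mon m x)"
  unfolding poly_eval_def mon_def[symmetric] using assms
  by (intro sum.mono_neutral_left) (auto simp: in_keys_iff)

lemma poly_eval_zero: "poly_eval 0 x = 0"
  by (simp add: poly_eval_def)

lemma poly_eval_add: "poly_eval (f + g) x = poly_eval f x + poly_eval g x"
proof -
  let ?K = "Poly_Mapping.keys f \<union> Poly_Mapping.keys g"
  have "poly_eval (f + g) x = (\<Sum>m\<in>?K. Poly_Mapping.lookup (f + g) m * mon m x)"
    by (rule poly_eval_superset) (auto dest: subsetD[OF Poly_Mapping.keys_add])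
  also have "\<dots> = (\<Sum>m\<in>?K. Poly_Mapping.lookup f m * mon m x) + (\<Sum>m\<in>?K. Poly_Mapping.lookup g m * mon m x)"
    by (simp add: lookup_add algebra_simps sum.distrib)
  also have "\<dots> = poly_eval f x + poly_eval g x"
    by (subst (1 2) poly_eval_superset[of ?K]) auto
  finally show ?thesis .
qed

lemma poly_eval_sum: "poly_eval (sum f K) x = (\<Sum>k\<in>K. poly_eval (f k) x)"
  by (induction K rule: infinite_finite_induct) (auto simp: poly_eval_zero poly_eval_add)

lemma poly_eval_single: "poly_eval (Poly_Mapping.single m c) x = c * mon m x"
  by (subst poly_eval_superset[of "{m}"]) (auto simp: lookup_single)

lemma poly_eval_in_poly_funs:
  assumes F: "-1 \<in> F" and f: "f \<in> cpolys I"
    and c: "\<And>m. m \<in> Poly_Mapping.keys f \<Longrightarrow> Poly_Mapping.lookup f m \<in> F"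
  shows "poly_eval f \<in> poly_funs F I"
proof -
  have "(\<lambda>x. Poly_Mapping.lookup f m * (\<Prod>i\<in>Poly_Mapping.keys m. x i ^ Poly_Mapping.lookup m i))
      \<in> poly_funs F I" if "m \<in> Poly_Mapping.keys f" for m
    using that f c
    by (intro poly_funs.mult poly_funs.const poly_funs_prod poly_funs_power poly_funs.var F)
      (auto simp: cpolys_def)
  then show ?thesis
    unfolding poly_eval_def[abs_def] by (intro poly_funs_sum F)
qed

text \<open>Here \<open>F\<close> has to be closed under sums and products, because multiplying
  formal polynomials collects coefficients. It is instantiated by all complex numbers and by the
  rationals.\<close>

lemma poly_fun_is_poly_eval:
  assumes F: "0 \<in> F" "1 \<in> F" "\<And>a b. a \<in> F \<Longrightarrow> b \<in> F \<Longrightarrow> a + b \<in> F"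
      "\<And>a b. a \<in> F \<Longrightarrow> b \<in> F \<Longrightarrow> a * b \<in> F"
    and f: "f \<in> poly_funs F I"
  shows "\<exists>g\<in>cpolys I. (\<forall>m. Poly_Mapping.lookup g m \<in> F) \<and> poly_eval g = f"
proof -
  let ?A = "{g \<in> cpolys I. \<forall>m. Poly_Mapping.lookup g m \<in> F}"
  have zero: "0 \<in> ?A" using F by (simp add: cpolys_def)
  have single: "Poly_Mapping.single m c \<in> ?A" if "c \<in> F" "Poly_Mapping.keys m \<subseteq> I" for m c
    using that F by (auto simp: cpolys_def lookup_single when_def)
  have sum_closed: "g + h \<in> ?A" if "g \<in> ?A" "h \<in> ?A" for g h
    using that F(3) Poly_Mapping.keys_add[of g h] by (fastforce simp: cpolys_def lookup_add)
  have sums_closed: "(\<And>k. k \<in> K \<Longrightarrow> g k \<in> ?A) \<Longrightarrow> sum g K \<in> ?A" for K :: "('a \<Rightarrow>\<^sub>0 nat) set" and g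
    by (induction K rule: infinite_finite_induct) (use zero sum_closed in auto)
  have "\<exists>g\<in>?A. \<forall>x. poly_eval g x = f x"
    using f
  proof induction
    case (const c)
    then show ?case
      using single[of c 0] by (intro bexI[of _ "Poly_Mapping.single 0 c"]) (auto simp: poly_eval_single mon_def)
  next
    case (var i)
    then show ?case
      using single[of 1 "Poly_Mapping.single i 1"] F(2)
      by (intro bexI[of _ "Poly_Mapping.single (Poly_Mapping.single i 1) 1"])
        (auto simp: poly_eval_single mon_def)
  next
    case (add f g)
    then obtain f' g' where "f' \<in> ?A" "\<forall>x. poly_eval f' x = f x" "g' \<in> ?A" "\<forall>x. poly_eval g' x = g x"
      by blast
    then show ?case using sum_closed[of f' g']
      by (intro bexI[of _ "f' + g'"]) (simp_all add: poly_eval_add)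
  next
    case (mult f g)
    then obtain f' g' where A: "f' \<in> ?A" "\<forall>x. poly_eval f' x = f x" "g' \<in> ?A" "\<forall>x. poly_eval g' x = g x"
      by blast
    define p where "p = (\<Sum>m\<in>Poly_Mapping.keys f'. \<Sum>m'\<in>Poly_Mapping.keys g'.
      Poly_Mapping.single (m + m') (Poly_Mapping.lookup f' m * Poly_Mapping.lookup g' m'))"
    have "Poly_Mapping.keys (m + m') \<subseteq> I"
      if "m \<in> Poly_Mapping.keys f'" "m' \<in> Poly_Mapping.keys g'" for m m'
      using that A(1,3) Poly_Mapping.keys_add[of m m'] unfolding cpolys_def by blast
    then have "p \<in> ?A"
      unfolding p_def using A(1,3) F(4) by (intro sums_closed single) auto
    moreover have "poly_eval p x = f x * g x" for x
    proof -
      have "poly_eval p x = poly_eval f' x * poly_eval g' x"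
        unfolding p_def poly_eval_sum poly_eval_single mon_add
          poly_eval_superset[OF finite_keys subset_refl, of f'] poly_eval_superset[OF finite_keys subset_refl, of g']
          sum_product
        by (simp add: algebra_simps)
      then show ?thesis using A by simp
    qed
    ultimately show ?case by blast
  qed
  then show ?thesis by blast
qed

lemma poly_eval_cpolys: "poly_eval ` cpolys I = poly_funs UNIV I"
  using poly_eval_in_poly_funs[of UNIV _ I] poly_fun_is_poly_eval[of UNIV _ I] by fastforce

lemma poly_eval_rational_cpolys: "poly_eval ` rational_cpolys I = poly_funs \<rat> I"
  using poly_eval_in_poly_funs[of \<rat> _ I] poly_fun_is_poly_eval[of \<rat> _ I]
  by (fastforce simp: rational_cpolys_def)

text \<open>With the other variables fixed, the sum is a univariate polynomial in
  \<open>x i\<close>. Its coefficient of degree k collects the monomials with exponent k at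
  \<open>i\<close> and vanishes, which leaves one variable fewer.\<close>

lemma monomials_independent:
  fixes e :: "'m \<Rightarrow> 'i \<Rightarrow> nat" and c :: "'m \<Rightarrow> complex"
  assumes "finite I" "finite M" "\<And>m m'. m \<in> M \<Longrightarrow> m' \<in> M \<Longrightarrow> (\<forall>i\<in>I. e m i = e m' i) \<Longrightarrow> m = m'"
    and "\<And>x. (\<Sum>m\<in>M. c m * (\<Prod>i\<in>I. x i ^ e m i)) = 0" and "m \<in> M"
  shows "c m = 0"
  using assms
proof (induction I arbitrary: M m rule: finite_induct)
  case empty
  then have "M = {m}" by blast
  then show ?case using empty.prems(3) by simp
next
  case (insert i I)
  define N where "N k = {m\<in>M. e m i = k}" for k
  have "(\<Sum>m\<in>N k. c m * (\<Prod>i\<in>I. x i ^ e m i)) = 0" for x k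
  proof -
    define Q where "Q = (\<Sum>m\<in>M. monom (c m * (\<Prod>i\<in>I. x i ^ e m i)) (e m i))"
    have "poly Q t = 0" for t
    proof -
      have "poly Q t = (\<Sum>m\<in>M. c m * (\<Prod>j\<in>insert i I. (x(i := t)) j ^ e m j))"
        unfolding Q_def poly_sum
      proof (rule sum.cong)
        fix m assume "m \<in> M"
        have "(\<Prod>j\<in>I. (x(i := t)) j ^ e m j) = (\<Prod>j\<in>I. x j ^ e m j)"
          using insert.hyps by (intro prod.cong) auto
        then show "poly (monom (c m * (\<Prod>i\<in>I. x i ^ e m i)) (e m i)) t =
            c m * (\<Prod>j\<in>insert i I. (x(i := t)) j ^ e m j)"
          using insert.hyps by (simp add: poly_monom)
      qed simp
      then show ?thesis using insert.prems(3) by simp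
    qed
    then have "Q = 0" using poly_all_0_iff_0 by blast
    then have "0 = coeff Q k" by simp
    also have "\<dots> = (\<Sum>m\<in>M. if e m i = k then c m * (\<Prod>i\<in>I. x i ^ e m i) else 0)"
      by (simp add: Q_def coeff_sum)
    finally have "0 = (\<Sum>m\<in>M. if e m i = k then c m * (\<Prod>i\<in>I. x i ^ e m i) else 0)" .
    then show ?thesis using insert.prems(1) by (simp add: N_def sum.If_cases Int_def)
  qed
  moreover have "finite (N (e m i))" using insert.prems by (simp add: N_def)
  moreover have "m' = m''" if "m' \<in> N (e m i)" "m'' \<in> N (e m i)" "\<forall>j\<in>I. e m' j = e m'' j" for m' m''
    using that insert.prems(2)[of m' m''] by (auto simp: N_def)
  moreover have "m \<in> N (e m i)" using insert.prems by (simp add: N_def)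
  ultimately show ?case using insert.IH[of "N (e m i)" m] by blast
qed

lemma cpoly_eq_0:
  assumes I: "finite I" and g: "g \<in> cpolys I" and z: "\<And>x. x \<in> cspace I \<Longrightarrow> poly_eval g x = 0"
  shows "g = 0"
proof -
  have keys: "Poly_Mapping.keys m \<subseteq> I" if "m \<in> Poly_Mapping.keys g" for m
    using g that by (auto simp: cpolys_def)
  have "Poly_Mapping.lookup g m = 0" if m: "m \<in> Poly_Mapping.keys g" for m
  proof (rule monomials_independent[of I "Poly_Mapping.keys g" Poly_Mapping.lookup, OF I finite_keys _ _ m])
    fix m1 m2 assume m: "m1 \<in> Poly_Mapping.keys g" "m2 \<in> Poly_Mapping.keys g"
      and eq: "\<forall>i\<in>I. Poly_Mapping.lookup m1 i = Poly_Mapping.lookup m2 i"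
    show "m1 = m2"
    proof (rule poly_mapping_eqI)
      fix k
      show "Poly_Mapping.lookup m1 k = Poly_Mapping.lookup m2 k"
      proof (cases "k \<in> I")
        case False
        then have "k \<notin> Poly_Mapping.keys m1" "k \<notin> Poly_Mapping.keys m2" using keys m by auto
        then show ?thesis by (simp add: in_keys_iff)
      qed (use eq in simp)
    qed
  next
    fix x
    have "(\<Sum>m\<in>Poly_Mapping.keys g. Poly_Mapping.lookup g m * (\<Prod>i\<in>I. x i ^ Poly_Mapping.lookup m i))
        = poly_eval g x"
      unfolding poly_eval_superset[OF finite_keys subset_refl]
      by (intro sum.cong refl) (simp add: mon_superset[OF I keys])
    also have "poly_eval g x = poly_eval g (\<lambda>i. if i \<in> I then x i else 0)"
    proof (rule poly_funs_cong[of "poly_eval g" UNIV I])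
      show "poly_eval g \<in> poly_funs UNIV I" using g poly_eval_cpolys[of I] by blast
    qed simp
    also have "\<dots> = 0" by (rule z) (simp add: cspace_def)
    finally show "(\<Sum>m\<in>Poly_Mapping.keys g. Poly_Mapping.lookup g m * (\<Prod>i\<in>I. x i ^ Poly_Mapping.lookup m i)) = 0" .
  qed
  then have "Poly_Mapping.lookup g m = 0" for m by (cases "m \<in> Poly_Mapping.keys g") (auto simp: in_keys_iff)
  then show ?thesis by (intro poly_mapping_eqI) simp
qed

lemma partial_deriv_eq_pd: "partial_deriv i f x = pd i (poly_eval f) x"
  by (simp add: partial_deriv_def pd_def)

section \<open>Linear algebra in coordinate spaces\<close>

text \<open>Bilinear, without complex conjugation, in agreement with
  \<open>hyperplane_perp\<close>.\<close>

definition pairing :: "'i set \<Rightarrow> ('i \<Rightarrow> complex) \<Rightarrow> ('i \<Rightarrow> complex) \<Rightarrow> complex" where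
  "pairing I w x = (\<Sum>i\<in>I. w i * x i)"

definition annihilator :: "'i set \<Rightarrow> ('i \<Rightarrow> complex) set \<Rightarrow> ('i \<Rightarrow> complex) set" where
  "annihilator I U = {x \<in> cspace I. \<forall>u\<in>U. pairing I u x = 0}"

definition unit_vec :: "'i \<Rightarrow> 'i \<Rightarrow> complex" where
  "unit_vec i = (\<lambda>j. if j = i then 1 else 0)"

lemma sum_apply: "(sum f K :: 'i \<Rightarrow> complex) x = (\<Sum>k\<in>K. f k x)"
  by (induction K rule: infinite_finite_induct) simp_all

lemma cscale_apply: "cscale c x i = c * x i"
  by (simp add: cscale_def)

lemma pairing_commute: "pairing I w x = pairing I x w"
  by (simp add: pairing_def mult.commute)

lemma pairing_add_right: "pairing I w (x + y) = pairing I w x + pairing I w y"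
  by (simp add: pairing_def algebra_simps sum.distrib)

lemma pairing_scale_right: "pairing I w (cscale c x) = c * pairing I w x"
  by (simp add: pairing_def cscale_def sum_distrib_left algebra_simps)

lemma pairing_zero_right: "pairing I w 0 = 0"
  by (simp add: pairing_def)

lemma pairing_diff_right: "pairing I w (x - y) = pairing I w x - pairing I w y"
  by (simp add: pairing_def algebra_simps sum_subtractf)

lemma pairing_diff_left: "pairing I (v - w) x = pairing I v x - pairing I w x"
  by (simp add: pairing_def algebra_simps sum_subtractf)

lemma pairing_sum_right: "pairing I w (sum f K) = (\<Sum>k\<in>K. pairing I w (f k))"
  unfolding pairing_def sum_apply sum_distrib_left by (rule sum.swap)

lemma pairing_unit_vec: "finite I \<Longrightarrow> i \<in> I \<Longrightarrow> pairing I (unit_vec i) x = x i"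
  by (simp add: pairing_def unit_vec_def if_distrib[of "\<lambda>u. u * _"] cong: if_cong)

lemma cspace_0: "0 \<in> cspace I"
  and cspace_add: "x \<in> cspace I \<Longrightarrow> y \<in> cspace I \<Longrightarrow> x + y \<in> cspace I"
  and cspace_diff: "x \<in> cspace I \<Longrightarrow> y \<in> cspace I \<Longrightarrow> x - y \<in> cspace I"
  and cspace_scale: "x \<in> cspace I \<Longrightarrow> cscale c x \<in> cspace I"
  and unit_vec_cspace: "i \<in> I \<Longrightarrow> unit_vec i \<in> cspace I"
  by (auto simp: cspace_def cscale_def unit_vec_def)

lemma cspace_sum: "(\<And>k. k \<in> K \<Longrightarrow> f k \<in> cspace I) \<Longrightarrow> sum f K \<in> cspace I"
  by (induction K rule: infinite_finite_induct) (auto simp: cspace_0 cspace_add)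

lemma cspace_eqI:
  assumes "x \<in> cspace I" "y \<in> cspace I" "\<And>i. i \<in> I \<Longrightarrow> x i = y i"
  shows "x = y"
proof
  show "x i = y i" for i using assms by (cases "i \<in> I") (auto simp: cspace_def)
qed

lemma cspace_expand:
  assumes "finite I" "x \<in> cspace I"
  shows "x = (\<Sum>i\<in>I. cscale (x i) (unit_vec i))"
proof
  fix j
  have "(\<Sum>i\<in>I. cscale (x i) (unit_vec i)) j = (\<Sum>i\<in>I. if j = i then x i else 0)"
    by (simp add: sum_apply cscale_def unit_vec_def if_distrib[of "\<lambda>u. _ * u"] cong: if_cong)
  also have "\<dots> = x j" using assms by (auto simp: cspace_def)
  finally show "x j = (\<Sum>i\<in>I. cscale (x i) (unit_vec i)) j" by simp
qed

lemma subspace_cspace: "cfun.subspace (cspace I)"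
  by (auto simp: cfun.subspace_def cspace_0 cspace_add cspace_scale)

lemma subspace_annihilator: "cfun.subspace (annihilator I U)"
  by (auto simp: cfun.subspace_def annihilator_def cspace_0 cspace_add cspace_scale
      pairing_zero_right pairing_add_right pairing_scale_right)

text \<open>A basis of \<open>U\<close> together with \<open>y\<close> is independent, so some
  functional is 0 on the basis and 1 at \<open>y\<close>; its values on unit vectors are the
  coordinates of \<open>w\<close>.\<close>

lemma separating_functional:
  assumes I: "finite I" and U: "cfun.subspace U" "U \<subseteq> cspace I" and y: "y \<in> cspace I" "y \<notin> U"
  obtains w where "w \<in> cspace I" "\<And>u. u \<in> U \<Longrightarrow> pairing I w u = 0" "pairing I w y \<noteq> 0"
proof -
  interpret C: vector_space "(*) :: complex \<Rightarrow> complex \<Rightarrow> complex"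
    by standard (auto simp: algebra_simps)
  interpret P: vector_space_pair "cscale :: complex \<Rightarrow> ('a \<Rightarrow> complex) \<Rightarrow> _" "(*) :: complex \<Rightarrow> complex \<Rightarrow> complex"
    ..
  obtain B where B: "B \<subseteq> U" "cfun.independent B" "U \<subseteq> cfun.span B"
    using cfun.maximal_independent_subset by blast
  have spB: "cfun.span B = U" using B U(1) cfun.span_minimal by blast
  then have ind: "cfun.independent (insert y B)"
    using B(2) y(2) by (simp add: cfun.independent_insertI)
  obtain g where g: "Vector_Spaces.linear cscale (*) g" "\<forall>x\<in>insert y B. g x = (if x = y then 1 else 0)"
    using P.linear_independent_extend[OF ind, of "\<lambda>x. if x = y then 1 else 0"] by blast
  interpret g: Vector_Spaces.linear "cscale :: complex \<Rightarrow> ('a \<Rightarrow> complex) \<Rightarrow> _" "(*) :: complex \<Rightarrow> complex \<Rightarrow> complex" g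
    by (rule g)
  have gB: "g b = 0" if "b \<in> B" for b using g(2) that B(1) y(2) by auto
  have gU: "g u = 0" if "u \<in> U" for u
  proof -
    have "u \<in> cfun.span B" using that spB by simp
    then show ?thesis
      by (induction rule: cfun.span_induct_alt) (simp_all only: g.zero g.add g.scale gB mult_zero_right add_0)
  qed
  define w where "w i = (if i \<in> I then g (unit_vec i) else 0)" for i
  have gw: "g x = pairing I w x" if "x \<in> cspace I" for x
    by (subst cspace_expand[OF I that]) (simp add: g.sum g.scale pairing_def w_def mult.commute)
  show ?thesis
  proof
    show "w \<in> cspace I" by (simp add: w_def cspace_def)
    show "pairing I w u = 0" if "u \<in> U" for u using gw[of u] gU[OF that] that U(2) by auto
    show "pairing I w y \<noteq> 0" using gw[OF y(1)] g(2) by auto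
  qed
qed

lemma in_subspace_if_annihilated:
  assumes "finite I" "cfun.subspace U" "U \<subseteq> cspace I" "y \<in> cspace I"
    and "\<And>w. w \<in> annihilator I U \<Longrightarrow> pairing I w y = 0"
  shows "y \<in> U"
proof (rule ccontr)
  assume "y \<notin> U"
  then obtain w where "w \<in> cspace I" "\<And>u. u \<in> U \<Longrightarrow> pairing I w u = 0" "pairing I w y \<noteq> 0"
    using separating_functional[OF assms(1-4)] by blast
  then show False using assms(5)[of w] by (auto simp: annihilator_def pairing_commute)
qed

text \<open>Fraction-free Gaussian elimination over the ring of polynomial functions. The generic point
  \<open>z0\<close> decides which coefficients are zero, \<open>S\<close> is the set of free variables, and \<open>\<kappa> j\<close> is the
  solution obtained by setting the free variable \<open>j\<close> to \<open>h\<close> and the other free variables to \<open>0\<close>.\<close>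

definition solution_basis :: "complex set \<Rightarrow> 'a set \<Rightarrow> ('a \<Rightarrow> complex) set \<Rightarrow> ('a \<Rightarrow> complex) \<Rightarrow>
    'i set \<Rightarrow> ('k \<Rightarrow> ('a \<Rightarrow> complex) \<Rightarrow> 'i \<Rightarrow> complex) \<Rightarrow> 'k set \<Rightarrow> 'i set \<Rightarrow>
    (('a \<Rightarrow> complex) \<Rightarrow> complex) \<Rightarrow> ('i \<Rightarrow> ('a \<Rightarrow> complex) \<Rightarrow> 'i \<Rightarrow> complex) \<Rightarrow> bool" where
  "solution_basis F A Z z0 I eqn K S h \<kappa> \<longleftrightarrow> S \<subseteq> I \<and> h \<in> poly_funs F A \<and> h z0 \<noteq> 0 \<and>
    (\<forall>j\<in>S. \<forall>i. (\<lambda>z. \<kappa> j z i) \<in> poly_funs F A) \<and> (\<forall>j\<in>S. \<forall>z. \<kappa> j z \<in> cspace I) \<and>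
    (\<forall>j\<in>S. \<forall>z\<in>Z. \<forall>k\<in>K. pairing I (eqn k z) (\<kappa> j z) = 0) \<and>
    (\<forall>i\<in>S. \<forall>j\<in>S. \<forall>z. \<kappa> j z i = (if i = j then h z else 0)) \<and>
    (\<forall>z\<in>Z. \<forall>y\<in>cspace I. (\<forall>k\<in>K. pairing I (eqn k z) y = 0) \<longrightarrow>
      cscale (h z) y = (\<Sum>j\<in>S. cscale (y j) (\<kappa> j z)))"

lemma elimination:
  fixes eqn :: "'k \<Rightarrow> ('a \<Rightarrow> complex) \<Rightarrow> 'i \<Rightarrow> complex"
  assumes F: "-1 \<in> F" and z0: "z0 \<in> Z"
    and generic: "\<And>f. f \<in> poly_funs F A \<Longrightarrow> f z0 = 0 \<Longrightarrow> \<forall>z\<in>Z. f z = 0"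
    and I: "finite I" and K: "finite K"
    and eqn: "\<And>k i. k \<in> K \<Longrightarrow> i \<in> I \<Longrightarrow> (\<lambda>z. eqn k z i) \<in> poly_funs F A"
  shows "\<exists>S h \<kappa>. solution_basis F A Z z0 I eqn K S h \<kappa>"
  using K eqn
proof (induction K rule: finite_induct)
  case empty
  have "(\<lambda>z. unit_vec j i) \<in> poly_funs F A" for j i :: 'i
    using poly_funs_one[OF F, of A] poly_funs_zero[OF F, of A] by (simp add: unit_vec_def)
  then show ?case
    unfolding solution_basis_def
  proof (intro exI[of _ I] exI[of _ "\<lambda>_. 1 :: complex"] exI[of _ "\<lambda>j _. unit_vec j"]
      conjI ballI allI impI)
    show "(\<lambda>z. 1) \<in> poly_funs F A" by (rule poly_funs_one[OF F])
    show "cscale 1 y = (\<Sum>j\<in>I. cscale (y j) (unit_vec j))" if "y \<in> cspace I" for y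
      unfolding cfun.scale_one by (rule cspace_expand[OF I that])
  qed (simp_all add: unit_vec_cspace, simp add: unit_vec_def)
next
  case (insert k K)
  have "\<And>k' i. k' \<in> K \<Longrightarrow> i \<in> I \<Longrightarrow> (\<lambda>z. eqn k' z i) \<in> poly_funs F A" using insert.prems by auto
  then obtain S h \<kappa> where IH: "solution_basis F A Z z0 I eqn K S h \<kappa>" using insert.IH by blast
  have S: "S \<subseteq> I"
    and h: "h \<in> poly_funs F A" "h z0 \<noteq> 0"
    and \<kappa>: "\<And>j i. j \<in> S \<Longrightarrow> (\<lambda>z. \<kappa> j z i) \<in> poly_funs F A" "\<And>j z. j \<in> S \<Longrightarrow> \<kappa> j z \<in> cspace I"
    and sol: "\<And>j z k. j \<in> S \<Longrightarrow> z \<in> Z \<Longrightarrow> k \<in> K \<Longrightarrow> pairing I (eqn k z) (\<kappa> j z) = 0"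
    and diag: "\<And>i j z. i \<in> S \<Longrightarrow> j \<in> S \<Longrightarrow> \<kappa> j z i = (if i = j then h z else 0)"
    and span: "\<And>y z. z \<in> Z \<Longrightarrow> y \<in> cspace I \<Longrightarrow> (\<And>k. k \<in> K \<Longrightarrow> pairing I (eqn k z) y = 0) \<Longrightarrow>
      cscale (h z) y = (\<Sum>j\<in>S. cscale (y j) (\<kappa> j z))"
    using IH unfolding solution_basis_def by simp_all
  define a where "a j z = pairing I (eqn k z) (\<kappa> j z)" for j z
  have a: "a j \<in> poly_funs F A" if "j \<in> S" for j
    unfolding a_def[abs_def] pairing_def using that \<kappa>(1) insert.prems
    by (intro poly_funs_sum F poly_funs.mult) auto
  show ?case
  proof (cases "\<forall>j\<in>S. a j z0 = 0")
    \<comment> \<open>The new equation holds at \<open>z0\<close> for every basis solution, hence by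
      genericity throughout \<open>Z\<close>, so the solution basis can be kept.\<close>
    case True
    then have "pairing I (eqn k z) (\<kappa> j z) = 0" if "j \<in> S" "z \<in> Z" for j z
      using generic[OF a] that unfolding a_def by blast
    then have sol': "pairing I (eqn k' z) (\<kappa> j z) = 0" if "j \<in> S" "z \<in> Z" "k' \<in> insert k K" for j z k'
      using that sol by blast
    show ?thesis
      unfolding solution_basis_def
    proof (intro exI[of _ S] exI[of _ h] exI[of _ \<kappa>] conjI ballI allI impI)
      show "cscale (h z) y = (\<Sum>j\<in>S. cscale (y j) (\<kappa> j z))"
        if "z \<in> Z" "y \<in> cspace I" "\<forall>k\<in>insert k K. pairing I (eqn k z) y = 0" for z y
        using that by (intro span) simp_all
    qed (fact S h \<kappa> sol' diag | assumption)+
  next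
    case False
    then obtain j0 where j0: "j0 \<in> S" "a j0 z0 \<noteq> 0" by blast
    \<comment> \<open>The variable \<open>j0\<close> is the pivot: this combination satisfies the
      new equation, stays divisionless and is 0 for \<open>j = j0\<close>. On the diagonal,
      \<open>h\<close> is replaced by \<open>a j0 * h\<close>.\<close>
    define \<kappa>' where "\<kappa>' j z = cscale (a j0 z) (\<kappa> j z) - cscale (a j z) (\<kappa> j0 z)" for j z
    define S' where "S' = S - {j0}"
    have fS: "finite S" using S I finite_subset by blast
    have "(\<lambda>z. \<kappa>' j z i) \<in> poly_funs F A" if "j \<in> S'" for j i
      unfolding \<kappa>'_def cscale_def minus_apply using that j0 \<kappa>(1) a
      by (intro poly_funs_diff F poly_funs.mult) (auto simp: S'_def)
    note \<kappa>'1 = this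
    have \<kappa>'2: "\<kappa>' j z \<in> cspace I" if "j \<in> S'" for j z
      using that j0 \<kappa>(2) by (auto simp: \<kappa>'_def S'_def intro: cspace_diff cspace_scale)
    have sol': "pairing I (eqn k' z) (\<kappa>' j z) = 0" if "j \<in> S'" "z \<in> Z" "k' \<in> insert k K" for j z k'
      using that j0 sol
      by (auto simp: \<kappa>'_def S'_def pairing_diff_right pairing_scale_right simp flip: a_def)
    have diag': "\<kappa>' j z i = (if i = j then a j0 z * h z else 0)" if "i \<in> S'" "j \<in> S'" for i j z
      using that j0 diag by (auto simp: \<kappa>'_def S'_def cscale_def)
    have span': "cscale (a j0 z * h z) y = (\<Sum>j\<in>S'. cscale (y j) (\<kappa>' j z))"
      if z: "z \<in> Z" and y: "y \<in> cspace I" and eq: "\<forall>k\<in>insert k K. pairing I (eqn k z) y = 0" for y z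
    proof -
      have hy: "cscale (h z) y = (\<Sum>j\<in>S. cscale (y j) (\<kappa> j z))"
        using span[OF z y] eq by auto
      have "0 = pairing I (eqn k z) (cscale (h z) y)" using eq by (simp add: pairing_scale_right)
      also have "\<dots> = (\<Sum>j\<in>S. y j * a j z)"
        by (simp add: hy pairing_sum_right pairing_scale_right a_def)
      finally have s0: "(\<Sum>j\<in>S. y j * a j z) = 0" by simp
      have "(\<Sum>j\<in>S'. cscale (y j) (\<kappa>' j z)) = (\<Sum>j\<in>S. cscale (y j) (\<kappa>' j z))"
        unfolding S'_def using fS j0 by (intro sum.mono_neutral_left) (auto simp: \<kappa>'_def cscale_def)
      also have "\<dots> = cscale (a j0 z) (\<Sum>j\<in>S. cscale (y j) (\<kappa> j z)) - cscale (\<Sum>j\<in>S. y j * a j z) (\<kappa> j0 z)"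
        by (auto simp: fun_eq_iff \<kappa>'_def cscale_def sum_apply sum_distrib_left sum_distrib_right
            algebra_simps sum_subtractf)
      also have "\<dots> = cscale (a j0 z * h z) y"
        using hy[symmetric] s0 by (simp add: cscale_def fun_eq_iff)
      finally show ?thesis by simp
    qed
    show ?thesis
      unfolding solution_basis_def
    proof (intro exI[of _ S'] exI[of _ "\<lambda>z. a j0 z * h z"] exI[of _ \<kappa>'] conjI ballI allI impI)
      show "S' \<subseteq> I" using S by (auto simp: S'_def)
      show "(\<lambda>z. a j0 z * h z) \<in> poly_funs F A" using a[OF j0(1)] h(1) by (rule poly_funs.mult)
      show "a j0 z0 * h z0 \<noteq> 0" using j0(2) h(2) by simp
    qed (fact \<kappa>'1 \<kappa>'2 sol' diag' span' | assumption)+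
  qed
qed

section \<open>Quadratic measurement varieties\<close>

lemma zero_on_zariski_closure:
  assumes "f \<in> poly_funs UNIV I" "\<And>x. x \<in> S \<Longrightarrow> f x = 0" "x \<in> zariski_closure I S"
  shows "f x = 0"
proof -
  obtain g where "g \<in> cpolys I" "poly_eval g = f"
    using assms(1) unfolding poly_eval_cpolys[symmetric] by auto
  then show ?thesis using assms by (auto simp: zariski_closure_def vanishing_ideal_def)
qed

lemma subset_zariski_closure: "S \<subseteq> cspace I \<Longrightarrow> S \<subseteq> zariski_closure I S"
  by (auto simp: zariski_closure_def vanishing_ideal_def)

lemma in_zariski_closureI:
  assumes "x \<in> cspace I" "\<And>f. f \<in> poly_funs UNIV I \<Longrightarrow> (\<And>y. y \<in> S \<Longrightarrow> f y = 0) \<Longrightarrow> f x = 0"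
  shows "x \<in> zariski_closure I S"
proof -
  have "poly_eval g x = 0" if "g \<in> vanishing_ideal I S" for g
    using that poly_eval_cpolys[of I] by (intro assms(2)[of "poly_eval g"]) (auto simp: vanishing_ideal_def)
  then show ?thesis using assms(1) by (simp add: zariski_closure_def)
qed

lemma zariski_closure_cspace: "zariski_closure I S \<subseteq> cspace I"
  by (auto simp: zariski_closure_def)

lemma tangent_space_poly_funs:
  "tangent_space I X x =
     {v \<in> cspace I. \<forall>f\<in>poly_funs UNIV I. (\<forall>y\<in>X. f y = 0) \<longrightarrow> dd I f x v = 0}"
  unfolding tangent_space_def vanishing_ideal_def poly_eval_cpolys[symmetric] dd_def partial_deriv_eq_pd
  by auto

definition gradient :: "'i set \<Rightarrow> (('i \<Rightarrow> complex) \<Rightarrow> complex) \<Rightarrow> ('i \<Rightarrow> complex) \<Rightarrow> 'i \<Rightarrow> complex" where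
  "gradient I f x = (\<lambda>i. if i \<in> I then pd i f x else 0)"

lemma gradient_cspace: "gradient I f x \<in> cspace I"
  by (simp add: gradient_def cspace_def)

lemma pairing_gradient: "pairing I (gradient I f x) v = dd I f x v"
  by (simp add: pairing_def gradient_def dd_def)

lemma poly_fun_eq_0:
  assumes "f \<in> poly_funs F I" "\<And>y. y \<in> cspace I \<Longrightarrow> f y = 0"
  shows "f = (\<lambda>_. 0)"
proof
  fix x
  have "f x = f (\<lambda>i. if i \<in> I then x i else 0)" by (rule poly_funs_cong[OF assms(1)]) simp
  also have "\<dots> = 0" by (rule assms(2)) (simp add: cspace_def)
  finally show "f x = 0" .
qed

lemma diagonal_independent:
  assumes S: "finite S" and g: "g \<noteq> 0"
    and diag: "\<And>i j. i \<in> S \<Longrightarrow> j \<in> S \<Longrightarrow> \<mu> j i = (if i = j then g else (0::complex))"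
  shows "inj_on \<mu> S" "cfun.independent (\<mu> ` S)"
proof -
  show inj: "inj_on \<mu> S"
  proof (rule inj_onI)
    fix i j assume "i \<in> S" "j \<in> S" "\<mu> i = \<mu> j"
    then show "i = j" using diag[of i i] diag[of i j] g by (auto split: if_splits)
  qed
  show "cfun.independent (\<mu> ` S)"
  proof (rule cfun.independent_if_scalars_zero)
    fix f x assume s: "(\<Sum>x\<in>\<mu> ` S. cscale (f x) x) = 0" and "x \<in> \<mu> ` S"
    then obtain i where i: "i \<in> S" "x = \<mu> i" by auto
    have "0 = (\<Sum>x\<in>\<mu> ` S. cscale (f x) x) i" using s by simp
    also have "\<dots> = (\<Sum>j\<in>S. f (\<mu> j) * \<mu> j i)"
      by (simp add: sum.reindex[OF inj] sum_apply cscale_def)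
    also have "\<dots> = (\<Sum>j\<in>S. if i = j then f (\<mu> j) * g else 0)"
      using i diag by (intro sum.cong) auto
    also have "\<dots> = f x * g" using i S by simp
    finally show "f x = 0" using g by simp
  qed (use S in simp)
qed

locale quadratic_map =
  fixes A :: "'a set" and E :: "'e set" and b :: "'e \<Rightarrow> 'a \<Rightarrow> 'a \<Rightarrow> complex"
  assumes finite_A: "finite A" and finite_E: "finite E"
    and b_Rats: "b e a a' \<in> \<rat>" and b_sym: "b e a a' = b e a' a"
begin

definition B :: "('a \<Rightarrow> complex) \<Rightarrow> ('a \<Rightarrow> complex) \<Rightarrow> 'e \<Rightarrow> complex" where
  "B p q = (\<lambda>e. if e \<in> E then \<Sum>a\<in>A. \<Sum>a'\<in>A. b e a a' * (p a * q a') else 0)"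

definition m :: "('a \<Rightarrow> complex) \<Rightarrow> 'e \<Rightarrow> complex" where
  "m p = B p p"

definition M :: "('e \<Rightarrow> complex) set" where
  "M = zariski_closure E (m ` cspace A)"

text \<open>The image of the differential of \<open>m\<close> at \<open>p\<close>, which is 2
  \<open>B p\<close>; the factor does not change the image.\<close>

definition im :: "('a \<Rightarrow> complex) \<Rightarrow> ('e \<Rightarrow> complex) set" where
  "im p = B p ` cspace A"

text \<open>For frameworks, \<open>B p\<close> is the rigidity matrix, and these are the equilibrium
  stresses of \<open>p\<close>.\<close>

definition stress :: "('a \<Rightarrow> complex) \<Rightarrow> ('e \<Rightarrow> complex) set" where
  "stress p = annihilator E (im p)"

lemma B_cspace: "B p q \<in> cspace E"
  by (simp add: B_def cspace_def)

lemma B_commute: "B p q = B q p"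
proof
  fix e
  have "(\<Sum>a\<in>A. \<Sum>a'\<in>A. b e a a' * (p a * q a')) = (\<Sum>a'\<in>A. \<Sum>a\<in>A. b e a a' * (p a * q a'))"
    by (rule sum.swap)
  also have "\<dots> = (\<Sum>a'\<in>A. \<Sum>a\<in>A. b e a' a * (q a' * p a))"
    by (intro sum.cong refl) (simp add: b_sym[of e _ ] mult.commute)
  finally show "B p q e = B q p e" by (simp add: B_def)
qed

lemma B_add_right: "B p (q + r) = B p q + B p r"
  by (rule ext) (simp add: B_def algebra_simps sum.distrib)

lemma B_scale_right: "B p (cscale c q) = cscale c (B p q)"
  by (rule ext) (simp add: B_def cscale_def sum_distrib_left algebra_simps)

lemma B_add_left: "B (p + q) r = B p r + B q r"
  by (metis B_commute B_add_right)

lemma B_scale_left: "B (cscale c p) r = cscale c (B p r)"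
  by (metis B_commute B_scale_right)

lemma B_zero_right: "B p 0 = 0"
  by (rule ext) (simp add: B_def)

lemma B_sum_right: "B p (sum f K) = (\<Sum>k\<in>K. B p (f k))"
  by (induction K rule: infinite_finite_induct) (simp_all only: B_zero_right B_add_right sum.infinite sum.empty sum.insert not_False_eq_True)

lemma m_line: "m (p + cscale t q) e = m p e + 2 * t * B p q e + t\<^sup>2 * m q e"
  unfolding m_def B_add_left B_add_right B_scale_left B_scale_right B_commute[of q p]
  by (simp add: cscale_def algebra_simps power2_eq_square)

lemma m_cspace: "m p \<in> cspace E"
  by (simp add: m_def B_cspace)

lemma B_poly: "(\<And>a. a \<in> A \<Longrightarrow> (\<lambda>z. p z a) \<in> poly_funs \<rat> I) \<Longrightarrow> (\<And>a. a \<in> A \<Longrightarrow> (\<lambda>z. q z a) \<in> poly_funs \<rat> I) \<Longrightarrow>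
    (\<lambda>z. B (p z) (q z) e) \<in> poly_funs \<rat> I"
  by (cases "e \<in> E")
    (auto simp: B_def intro!: poly_funs_sum poly_funs.mult poly_funs.const b_Rats poly_funs_zero)

lemma m_poly: "(\<lambda>p. m p e) \<in> poly_funs \<rat> A"
  unfolding m_def by (rule B_poly) (auto intro: poly_funs.intros)

lemma m_poly_UNIV: "(\<lambda>p. m p e) \<in> poly_funs UNIV A"
  by (rule poly_funs_UNIV[OF m_poly])

lemma dd_m: "dd A (\<lambda>p. m p e) p q = 2 * B p q e"
proof -
  define P where "P a = [:p a, q a:]" for a
  obtain Q where Q: "\<And>t. m (\<lambda>a. poly (P a) t) e = poly Q t"
    "coeff Q 1 = dd A (\<lambda>p. m p e) (\<lambda>i. coeff (P i) 0) (\<lambda>i. coeff (P i) 1)"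
    using poly_funs_path[OF finite_A m_poly] by metis
  have "(\<lambda>a. poly (P a) t) = p + cscale t q" for t by (auto simp: P_def cscale_def)
  then have "poly Q t = poly [:m p e, 2 * B p q e, m q e:] t" for t
    using Q(1)[of t] by (simp add: m_line power2_eq_square algebra_simps)
  then have "Q = [:m p e, 2 * B p q e, m q e:]" using poly_eq_poly_eq_iff by blast
  then show ?thesis using Q(2) by (simp add: P_def)
qed

lemma dd_comp_m:
  assumes "f \<in> poly_funs UNIV E"
  shows "dd A (\<lambda>p. f (m p)) p q = 2 * dd E f (m p) (B p q)"
proof -
  have "dd A (\<lambda>p. f (\<lambda>e. m p e)) p q = dd E f (\<lambda>e. m p e) (\<lambda>e. dd A (\<lambda>p. m p e) p q)"
    by (rule dd_comp[OF finite_E assms m_poly_UNIV])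
  then show ?thesis by (simp add: dd_m dd_scale_right)
qed

lemma comp_m_poly:
  assumes "f \<in> poly_funs F E" "\<rat> \<subseteq> F"
  shows "(\<lambda>p. f (m p)) \<in> poly_funs F A"
proof -
  have "(\<lambda>p. f (\<lambda>e. m p e)) \<in> poly_funs F A"
    by (rule poly_funs_comp[OF assms(1)]) (rule subsetD[OF poly_funs_mono[OF assms(2) order_refl] m_poly])
  then show ?thesis by simp
qed

lemma m_in_M: "p \<in> cspace A \<Longrightarrow> m p \<in> M"
  using subset_zariski_closure[of "m ` cspace A" E] m_cspace by (auto simp: M_def)

lemma zero_on_M:
  assumes "f \<in> poly_funs UNIV E" "\<And>p. p \<in> cspace A \<Longrightarrow> f (m p) = 0" "x \<in> M"
  shows "f x = 0"
  using zero_on_zariski_closure[OF assms(1)] assms(2,3) unfolding M_def by blast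

lemma subspace_im: "cfun.subspace (im p)"
proof -
  have "0 \<in> im p" unfolding im_def by (rule image_eqI[of _ _ 0]) (simp_all only: B_zero_right cspace_0)
  moreover have "x + y \<in> im p" if "x \<in> im p" "y \<in> im p" for x y
    using that unfolding im_def by (auto simp flip: B_add_right intro!: imageI cspace_add)
  moreover have "cscale c x \<in> im p" if "x \<in> im p" for x c
    using that unfolding im_def by (auto simp flip: B_scale_right intro!: imageI cspace_scale)
  ultimately show ?thesis by (simp add: cfun.subspace_def)
qed

lemma im_cspace: "im p \<subseteq> cspace E"
  by (auto simp: im_def B_cspace)

lemma in_im_if_annihilated:
  assumes "v \<in> cspace E" "\<And>w. w \<in> stress p \<Longrightarrow> pairing E w v = 0"
  shows "v \<in> im p"
  using in_subspace_if_annihilated[OF finite_E subspace_im im_cspace] assms by (simp add: stress_def)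

lemma stress_pairing: "w \<in> stress p \<Longrightarrow> q \<in> cspace A \<Longrightarrow> pairing E w (B p q) = 0"
  by (auto simp: stress_def annihilator_def im_def pairing_commute)

lemma stress_iff:
  "w \<in> stress p \<longleftrightarrow> w \<in> cspace E \<and> (\<forall>a\<in>A. pairing E (B p (unit_vec a)) w = 0)"
proof
  assume "w \<in> stress p"
  then show "w \<in> cspace E \<and> (\<forall>a\<in>A. pairing E (B p (unit_vec a)) w = 0)"
    by (auto simp: stress_def annihilator_def im_def unit_vec_cspace)
next
  assume w: "w \<in> cspace E \<and> (\<forall>a\<in>A. pairing E (B p (unit_vec a)) w = 0)"
  have "pairing E w (B p q) = 0" if "q \<in> cspace A" for q
    using w by (subst cspace_expand[OF finite_A that])
      (simp add: B_sum_right B_scale_right pairing_sum_right pairing_scale_right pairing_commute)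
  then show "w \<in> stress p" using w by (auto simp: stress_def annihilator_def im_def pairing_commute)
qed

lemma im_tangent:
  assumes p: "p \<in> cspace A"
  shows "im p \<subseteq> tangent_space E M (m p)"
proof
  fix v assume "v \<in> im p"
  then obtain q where q: "q \<in> cspace A" "v = B p q" by (auto simp: im_def)
  have "dd E f (m p) v = 0" if f: "f \<in> poly_funs UNIV E" "\<forall>y\<in>M. f y = 0" for f
  proof -
    have "(\<lambda>p. f (m p)) = (\<lambda>_. 0)"
      using f m_in_M by (intro poly_fun_eq_0[OF comp_m_poly[OF f(1)]]) auto
    then have "dd A (\<lambda>p. f (m p)) p q = 0" by (simp add: dd_const)
    then show ?thesis using dd_comp_m[OF f(1)] q by simp
  qed
  then show "v \<in> tangent_space E M (m p)"
    using q B_cspace unfolding tangent_space_poly_funs by blast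
qed

text \<open>A derivation kills the rational coefficients of \<open>m\<close>, so its value on
  \<open>m p\<close> is the differential applied to the derivatives of the \<open>p a\<close>; the
  factor 2 is absorbed into \<open>q\<close>.\<close>

lemma derivation_m:
  assumes D: "derivation D"
  obtains q where "q \<in> cspace A" "\<And>e. D (m p e) = B p q e"
proof
  define q where "q a = (if a \<in> A then 2 * D (p a) else 0)" for a
  show "q \<in> cspace A" by (simp add: q_def cspace_def)
  fix e
  have "D (m p e) = dd A (\<lambda>p. m p e) p (\<lambda>a. D (p a))"
    by (rule derivation_poly_fun[OF D derivation_Rats[OF D] finite_A m_poly])
  also have "\<dots> = B p (cscale 2 (\<lambda>a. D (p a))) e" by (simp only: dd_m B_scale_right) (simp add: cscale_def)
  also have "\<dots> = B p q e" by (simp add: B_def q_def cscale_def)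
  finally show "D (m p e) = B p q e" .
qed

text \<open>At a generic configuration every tangent vector of \<open>M\<close> is the value on \<open>m p\<close> of a derivation of
  the complex numbers, hence lies in the image of the differential.\<close>

lemma generic_tangent_in_im:
  assumes p: "p \<in> cspace A"
    and generic: "\<And>f. f \<in> poly_funs \<rat> A \<Longrightarrow> f p = 0 \<Longrightarrow> \<forall>y\<in>cspace A. f y = 0"
    and v: "v \<in> cspace E"
    and tangent: "\<And>f. f \<in> poly_funs \<rat> E \<Longrightarrow> \<forall>y\<in>M. f y = 0 \<Longrightarrow> dd E f (m p) v = 0"
  shows "v \<in> im p"
proof -
  have tangent': "dd E f (m p) v = 0" if f: "f \<in> poly_funs \<rat> E" "f (m p) = 0" for f
  proof -
    have "\<forall>y\<in>cspace A. f (m y) = 0" using generic[OF comp_m_poly[OF f(1)]] f(2) by simp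
    then have "\<forall>y\<in>M. f y = 0" using zero_on_M[OF poly_funs_UNIV[OF f(1)]] by blast
    then show ?thesis using tangent f(1) by blast
  qed
  have "-1 \<in> (\<rat> :: complex set)" by simp
  then obtain D where D: "derivation D" "\<And>e. e \<in> E \<Longrightarrow> D (m p e) = v e"
    using exists_derivation[OF _ finite_E tangent'] by metis
  obtain q where q: "q \<in> cspace A" "\<And>e. D (m p e) = B p q e"
    using derivation_m[OF D(1)] by blast
  have "v = B p q" using D(2) q(2) by (intro cspace_eqI[OF v B_cspace]) simp
  then show ?thesis using q(1) by (simp add: im_def)
qed

end

context quadratic_map
begin

text \<open>A rational polynomial \<open>\<Delta>\<close> cuts out the degenerate configurations: off its zero set the stress
  space and the tangent space are spanned by polynomial vectors \<open>\<kappa> j p\<close> and \<open>\<mu> j p\<close>, and the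
  tangent space is the image of the differential. Equality of the tangent space with the image
  spreads from one generic configuration because the orthogonality of \<open>\<kappa>\<close> and \<open>\<mu>\<close> is a rational
  polynomial identity.\<close>

lemma exists_regular_locus:
  obtains \<Delta> g :: "('a \<Rightarrow> complex) \<Rightarrow> complex" and K S :: "'e set"
    and \<kappa> \<mu> :: "'e \<Rightarrow> ('a \<Rightarrow> complex) \<Rightarrow> 'e \<Rightarrow> complex"
  where "\<Delta> \<in> poly_funs \<rat> A" "\<exists>p\<in>cspace A. \<Delta> p \<noteq> 0" "K \<subseteq> E" "S \<subseteq> E"
    "\<And>j e. j \<in> K \<Longrightarrow> (\<lambda>p. \<kappa> j p e) \<in> poly_funs \<rat> A"
    "\<And>j p. j \<in> K \<Longrightarrow> p \<in> cspace A \<Longrightarrow> \<kappa> j p \<in> stress p"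
    "\<And>p \<omega>. p \<in> cspace A \<Longrightarrow> \<Delta> p \<noteq> 0 \<Longrightarrow> \<omega> \<in> stress p \<Longrightarrow> \<exists>c. \<omega> = (\<Sum>j\<in>K. cscale (c j) (\<kappa> j p))"
    "\<And>p. \<Delta> p \<noteq> 0 \<Longrightarrow> g p \<noteq> 0"
    "\<And>i j p. i \<in> S \<Longrightarrow> j \<in> S \<Longrightarrow> \<mu> j p i = (if i = j then g p else 0)"
    "\<And>j p. j \<in> S \<Longrightarrow> p \<in> cspace A \<Longrightarrow> \<Delta> p \<noteq> 0 \<Longrightarrow> \<mu> j p \<in> im p"
    "\<And>p v. p \<in> cspace A \<Longrightarrow> \<Delta> p \<noteq> 0 \<Longrightarrow> v \<in> im p \<Longrightarrow>
      cscale (g p) v = (\<Sum>j\<in>S. cscale (v j) (\<mu> j p))"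
    "\<And>p. p \<in> cspace A \<Longrightarrow> \<Delta> p \<noteq> 0 \<Longrightarrow> tangent_space E M (m p) = im p"
proof -
  have neg1: "-1 \<in> (\<rat> :: complex set)" by simp
  have span_alt_finite: "\<exists>t. finite t \<and> t \<subseteq> X \<and> x \<in> cfun.span t"
    if "x \<in> cfun.span X" for x and X :: "('e \<Rightarrow> complex) set"
  proof -
    obtain t r where t: "finite t" "t \<subseteq> X" "x = (\<Sum>a\<in>t. cscale (r a) a)"
      using \<open>x \<in> cfun.span X\<close> unfolding cfun.span_explicit by blast
    have "x \<in> cfun.span t"
      unfolding t(3) by (intro cfun.span_sum cfun.span_scale cfun.span_base)
    then show ?thesis using t by blast
  qed
  obtain p0 where p0: "p0 \<in> cspace A"
    and generic: "\<And>f. f \<in> poly_funs \<rat> A \<Longrightarrow> f p0 = 0 \<Longrightarrow> \<forall>y\<in>cspace A. f y = 0"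
    using exists_generic_point[OF countable_rat finite_A] by blast
  have B_unit_poly: "(\<lambda>p. B p (unit_vec a) e) \<in> poly_funs \<rat> A" for a e
    by (rule B_poly) (auto simp: unit_vec_def intro: poly_funs.intros)
  obtain K h \<kappa> where sol: "solution_basis \<rat> A (cspace A) p0 E (\<lambda>a p. B p (unit_vec a)) A K h \<kappa>"
    using elimination[where eqn = "\<lambda>a p. B p (unit_vec a)" and K = A, OF neg1 p0 generic finite_E finite_A B_unit_poly] by blast
  have K: "K \<subseteq> E" and h: "h \<in> poly_funs \<rat> A" "h p0 \<noteq> 0"
    and \<kappa>_poly: "\<And>j e. j \<in> K \<Longrightarrow> (\<lambda>p. \<kappa> j p e) \<in> poly_funs \<rat> A"
    and \<kappa>_cspace: "\<And>j p. j \<in> K \<Longrightarrow> \<kappa> j p \<in> cspace E"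
    and \<kappa>_sol: "\<And>j p a. j \<in> K \<Longrightarrow> p \<in> cspace A \<Longrightarrow> a \<in> A \<Longrightarrow> pairing E (B p (unit_vec a)) (\<kappa> j p) = 0"
    and \<kappa>_span: "\<And>w p. p \<in> cspace A \<Longrightarrow> w \<in> cspace E \<Longrightarrow>
      (\<And>a. a \<in> A \<Longrightarrow> pairing E (B p (unit_vec a)) w = 0) \<Longrightarrow>
      cscale (h p) w = (\<Sum>j\<in>K. cscale (w j) (\<kappa> j p))"
    using sol unfolding solution_basis_def by simp_all
  have \<kappa>_stress: "\<kappa> j p \<in> stress p" if "j \<in> K" "p \<in> cspace A" for j p
    using that \<kappa>_cspace \<kappa>_sol by (simp add: stress_iff)
  have stress_span: "\<exists>c. \<omega> = (\<Sum>j\<in>K. cscale (c j) (\<kappa> j p))"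
    if "p \<in> cspace A" "h p \<noteq> 0" "\<omega> \<in> stress p" for p \<omega>
  proof (intro exI)
    have "cscale (h p) \<omega> = (\<Sum>j\<in>K. cscale (\<omega> j) (\<kappa> j p))"
      using that by (intro \<kappa>_span) (auto simp: stress_iff)
    then have "cscale (inverse (h p)) (cscale (h p) \<omega>) = (\<Sum>j\<in>K. cscale (inverse (h p) * \<omega> j) (\<kappa> j p))"
      by (simp only: cfun.scale_sum_right cfun.scale_scale)
    then show "\<omega> = (\<Sum>j\<in>K. cscale (inverse (h p) * \<omega> j) (\<kappa> j p))" using that by simp
  qed
  \<comment> \<open>Restricting to rational equations keeps the entries of their gradients at
    \<open>m p\<close> rational polynomials in \<open>p\<close>.\<close>
  define VQ where "VQ = {f \<in> poly_funs \<rat> E. \<forall>x\<in>M. f x = 0}"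
  define X where "X = (\<lambda>f. gradient E f (m p0)) ` VQ"
  have X: "X \<subseteq> cspace E" by (auto simp: X_def gradient_cspace)
  \<comment> \<open>A vector annihilating all these gradients is tangent at \<open>m p0\<close> for
    the rational equations, so it lies in \<open>im p0\<close>, to which
    \<open>\<kappa> j p0\<close> is orthogonal.\<close>
  have "\<kappa> j p0 \<in> cfun.span X" if j: "j \<in> K" for j
  proof (rule in_subspace_if_annihilated[OF finite_E cfun.subspace_span cfun.span_minimal[OF X subspace_cspace] \<kappa>_cspace[OF j]])
    fix w assume w: "w \<in> annihilator E (cfun.span X)"
    have "dd E f (m p0) w = 0" if "f \<in> poly_funs \<rat> E" "\<forall>x\<in>M. f x = 0" for f
    proof -
      have "gradient E f (m p0) \<in> cfun.span X"
        using that by (intro cfun.span_base) (auto simp: X_def VQ_def)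
      then show ?thesis using w by (auto simp: annihilator_def pairing_gradient)
    qed
    then have "w \<in> im p0" using w by (intro generic_tangent_in_im[OF p0 generic]) (auto simp: annihilator_def)
    then show "pairing E w (\<kappa> j p0) = 0"
      using \<kappa>_stress[OF j p0] by (auto simp: stress_def annihilator_def)
  qed
  then have "\<exists>t. finite t \<and> t \<subseteq> X \<and> \<kappa> j p0 \<in> cfun.span t" if "j \<in> K" for j
    using that span_alt_finite by blast
  then obtain t where t: "\<And>j. j \<in> K \<Longrightarrow> finite (t j) \<and> t j \<subseteq> X \<and> \<kappa> j p0 \<in> cfun.span (t j)" by metis
  have "finite (\<Union>j\<in>K. t j)" "(\<Union>j\<in>K. t j) \<subseteq> (\<lambda>f. gradient E f (m p0)) ` VQ"
    using t finite_subset[OF K finite_E] unfolding X_def by auto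
  \<comment> \<open>Each \<open>\<kappa> j p0\<close> uses finitely many gradients, so finitely many
    equations suffice and elimination applies to them.\<close>
  then obtain Fs where Fs: "Fs \<subseteq> VQ" "finite Fs" "(\<Union>j\<in>K. t j) = (\<lambda>f. gradient E f (m p0)) ` Fs"
    using finite_subset_image by metis
  have grad_poly: "(\<lambda>p. gradient E f (m p) e) \<in> poly_funs \<rat> A" if "f \<in> Fs" for f e
  proof (cases "e \<in> E")
    case True
    have "pd e f \<in> poly_funs \<rat> E" using that Fs(1) by (intro pd_poly_funs[OF neg1]) (auto simp: VQ_def)
    then show ?thesis using comp_m_poly True by (simp add: gradient_def)
  qed (simp add: gradient_def poly_funs_zero[OF neg1])
  obtain S g \<mu> where sol: "solution_basis \<rat> A (cspace A) p0 E (\<lambda>f p. gradient E f (m p)) Fs S g \<mu>"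
    using elimination[where eqn = "\<lambda>f p. gradient E f (m p)" and K = Fs, OF neg1 p0 generic finite_E Fs(2) grad_poly] by blast
  have S: "S \<subseteq> E" and g: "g \<in> poly_funs \<rat> A" "g p0 \<noteq> 0"
    and \<mu>_poly: "\<And>j e. j \<in> S \<Longrightarrow> (\<lambda>p. \<mu> j p e) \<in> poly_funs \<rat> A"
    and \<mu>_cspace: "\<And>j p. j \<in> S \<Longrightarrow> \<mu> j p \<in> cspace E"
    and \<mu>_sol: "\<And>j p f. j \<in> S \<Longrightarrow> p \<in> cspace A \<Longrightarrow> f \<in> Fs \<Longrightarrow> pairing E (gradient E f (m p)) (\<mu> j p) = 0"
    and \<mu>_diag: "\<And>i j p. i \<in> S \<Longrightarrow> j \<in> S \<Longrightarrow> \<mu> j p i = (if i = j then g p else 0)"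
    and \<mu>_span: "\<And>v p. p \<in> cspace A \<Longrightarrow> v \<in> cspace E \<Longrightarrow>
      (\<And>f. f \<in> Fs \<Longrightarrow> pairing E (gradient E f (m p)) v = 0) \<Longrightarrow>
      cscale (g p) v = (\<Sum>j\<in>S. cscale (v j) (\<mu> j p))"
    using sol unfolding solution_basis_def by simp_all
  have orth: "pairing E (\<kappa> i p) (\<mu> j p) = 0" if ij: "i \<in> K" "j \<in> S" and p: "p \<in> cspace A" for i j p
  proof -
    have "(\<lambda>p. pairing E (\<kappa> i p) (\<mu> j p)) \<in> poly_funs \<rat> A"
      unfolding pairing_def using ij \<kappa>_poly \<mu>_poly by (intro poly_funs_sum neg1 poly_funs.mult) auto
    moreover have "pairing E (\<kappa> i p0) (\<mu> j p0) = 0"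
    proof -
      have "cfun.span (t i) \<subseteq> annihilator E {\<mu> j p0}"
      proof (rule cfun.span_minimal[OF _ subspace_annihilator])
        have "t i \<subseteq> (\<lambda>f. gradient E f (m p0)) ` Fs" using Fs(3) ij by blast
        then show "t i \<subseteq> annihilator E {\<mu> j p0}"
          using \<mu>_sol[OF ij(2) p0] by (auto simp: annihilator_def gradient_cspace pairing_commute)
      qed
      then show ?thesis using t[OF ij(1)] by (auto simp: annihilator_def pairing_commute)
    qed
    ultimately show ?thesis using generic p by blast
  qed
  have \<mu>_im: "\<mu> j p \<in> im p" if j: "j \<in> S" and p: "p \<in> cspace A" "h p \<noteq> 0" for j p
  proof (rule in_im_if_annihilated[OF \<mu>_cspace[OF j]])
    fix w assume "w \<in> stress p"
    then obtain c where w: "w = (\<Sum>j\<in>K. cscale (c j) (\<kappa> j p))" using stress_span[OF p] by blast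
    have "pairing E (\<mu> j p) (\<kappa> i p) = 0" if "i \<in> K" for i
      using orth[OF that j p(1)] by (simp add: pairing_commute)
    then show "pairing E w (\<mu> j p) = 0"
      by (simp add: w pairing_commute[of E _ "\<mu> j p"] pairing_sum_right pairing_scale_right)
  qed
  have tangent_span: "cscale (g p) v = (\<Sum>j\<in>S. cscale (v j) (\<mu> j p))"
    if "p \<in> cspace A" "v \<in> tangent_space E M (m p)" for p v
  proof (rule \<mu>_span[OF that(1)])
    show "v \<in> cspace E" using that by (simp add: tangent_space_def)
    show "pairing E (gradient E f (m p)) v = 0" if "f \<in> Fs" for f
    proof -
      have "f \<in> poly_funs UNIV E" "\<forall>y\<in>M. f y = 0"
        using that Fs(1) by (auto simp: VQ_def intro: poly_funs_UNIV)
      then show ?thesis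
        using \<open>v \<in> tangent_space E M (m p)\<close> unfolding pairing_gradient tangent_space_poly_funs by blast
    qed
  qed
  \<comment> \<open>Nonvanishing of \<open>h\<close> makes the \<open>\<kappa> j\<close> span the
    stresses, nonvanishing of \<open>g\<close> makes the \<open>\<mu> j\<close> span the tangent
    space.\<close>
  define \<Delta> where "\<Delta> p = h p * g p" for p
  have tangent_im: "tangent_space E M (m p) = im p" if p: "p \<in> cspace A" "\<Delta> p \<noteq> 0" for p
  proof (rule antisym[OF subsetI im_tangent[OF p(1)]])
    fix v assume "v \<in> tangent_space E M (m p)"
    then have "cscale (inverse (g p)) (cscale (g p) v) = cscale (inverse (g p)) (\<Sum>j\<in>S. cscale (v j) (\<mu> j p))"
      using tangent_span p by simp
    then have "v = cscale (inverse (g p)) (\<Sum>j\<in>S. cscale (v j) (\<mu> j p))"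
      using p by (simp add: \<Delta>_def)
    also have "\<dots> \<in> im p"
      using \<mu>_im p by (intro cfun.subspace_scale cfun.subspace_sum subspace_im) (auto simp: \<Delta>_def)
    finally show "v \<in> im p" .
  qed
  show ?thesis
  proof (rule that[where \<Delta> = \<Delta> and K = K and S = S and \<kappa> = \<kappa> and g = g and \<mu> = \<mu>])
    show "\<Delta> \<in> poly_funs \<rat> A" unfolding \<Delta>_def[abs_def] using h(1) g(1) by (rule poly_funs.mult)
    show "\<exists>p\<in>cspace A. \<Delta> p \<noteq> 0" using p0 h g by (auto simp: \<Delta>_def)
    show "cscale (g p) v = (\<Sum>j\<in>S. cscale (v j) (\<mu> j p))" if "p \<in> cspace A" "\<Delta> p \<noteq> 0" "v \<in> im p" for p v
      using tangent_span tangent_im that by blast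
  qed (use K S \<kappa>_poly \<kappa>_stress stress_span \<mu>_diag \<mu>_im tangent_im in \<open>auto simp: \<Delta>_def\<close>)
qed

lemma zero_on_M_generic:
  assumes F: "\<rat> \<subseteq> F" and generic: "\<And>f. f \<in> poly_funs F A \<Longrightarrow> f p = 0 \<Longrightarrow> \<forall>y\<in>cspace A. f y = 0"
    and f: "f \<in> poly_funs F E" "f (m p) = 0" and x: "x \<in> M"
  shows "f x = 0"
  using generic[OF comp_m_poly[OF f(1) F]] f x zero_on_M[OF poly_funs_UNIV[OF f(1)]] by blast

section \<open>The dimension of \<open>M\<close> as the rank of the differential\<close>

context
  fixes \<Delta> g :: "('a \<Rightarrow> complex) \<Rightarrow> complex" and S :: "'e set" and \<mu> :: "'e \<Rightarrow> ('a \<Rightarrow> complex) \<Rightarrow> 'e \<Rightarrow> complex"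
  assumes \<Delta>: "\<Delta> \<in> poly_funs \<rat> A" "\<exists>p\<in>cspace A. \<Delta> p \<noteq> 0" and S: "S \<subseteq> E"
    and g: "\<And>p. \<Delta> p \<noteq> 0 \<Longrightarrow> g p \<noteq> 0"
    and diag: "\<And>i j p. i \<in> S \<Longrightarrow> j \<in> S \<Longrightarrow> \<mu> j p i = (if i = j then g p else 0)"
    and \<mu>_im: "\<And>j p. j \<in> S \<Longrightarrow> p \<in> cspace A \<Longrightarrow> \<Delta> p \<noteq> 0 \<Longrightarrow> \<mu> j p \<in> im p"
    and \<mu>_span: "\<And>p v. p \<in> cspace A \<Longrightarrow> \<Delta> p \<noteq> 0 \<Longrightarrow> v \<in> im p \<Longrightarrow>
      cscale (g p) v = (\<Sum>j\<in>S. cscale (v j) (\<mu> j p))"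
begin

lemma finite_S: "finite S"
  using S finite_E finite_subset by blast

lemma im_expand:
  assumes "p \<in> cspace A" "\<Delta> p \<noteq> 0" "v \<in> im p"
  shows "v = (\<Sum>j\<in>S. cscale (v j / g p) (\<mu> j p))"
proof -
  have "cscale (inverse (g p)) (cscale (g p) v) = (\<Sum>j\<in>S. cscale (inverse (g p) * v j) (\<mu> j p))"
    using \<mu>_span[OF assms] by (simp only: cfun.scale_sum_right cfun.scale_scale)
  then show ?thesis using g[OF assms(2)] by (simp add: divide_inverse mult.commute)
qed

lemma dim_im:
  assumes "p \<in> cspace A" "\<Delta> p \<noteq> 0"
  shows "cfun.dim (im p) = card S"
proof (rule cfun.dim_unique)
  note ind = diagonal_independent[OF finite_S g[OF assms(2)] diag]
  show "(\<lambda>j. \<mu> j p) ` S \<subseteq> im p" using \<mu>_im assms by auto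
  show "cfun.independent ((\<lambda>j. \<mu> j p) ` S)" by (rule ind(2))
  show "card ((\<lambda>j. \<mu> j p) ` S) = card S" using ind(1) by (rule card_image)
  show "im p \<subseteq> cfun.span ((\<lambda>j. \<mu> j p) ` S)"
  proof
    fix v assume "v \<in> im p"
    then have "v = (\<Sum>j\<in>S. cscale (v j / g p) (\<mu> j p))" using im_expand assms by blast
    also have "\<dots> \<in> cfun.span ((\<lambda>j. \<mu> j p) ` S)"
      by (intro cfun.span_sum cfun.span_scale cfun.span_base imageI)
    finally show "v \<in> cfun.span ((\<lambda>j. \<mu> j p) ` S)" .
  qed
qed

text \<open>At a configuration that is generic over the coefficients of algebraically independent
  polynomials, derivations realize every value of their differentials.\<close>

lemma alg_independent_bound:
  assumes f: "\<And>k. k < n \<Longrightarrow> f k \<in> cpolys E" and ind: "alg_independent_on M n f"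
  shows "n \<le> card S"
proof -
  define F where "F = \<rat> \<union> (\<Union>k<n. Poly_Mapping.lookup (f k) ` Poly_Mapping.keys (f k))"
  have "countable F" unfolding F_def by (auto intro: countable_rat countable_finite)
  then obtain p where p: "p \<in> cspace A"
    and generic: "\<And>f. f \<in> poly_funs F A \<Longrightarrow> f p = 0 \<Longrightarrow> \<forall>y\<in>cspace A. f y = 0"
    using exists_generic_point[OF _ finite_A] by blast
  have QF: "\<rat> \<subseteq> F" and neg1: "-1 \<in> F" by (auto simp: F_def)
  have "\<Delta> \<in> poly_funs F A" using \<Delta>(1) poly_funs_mono[OF QF order_refl] by blast
  then have \<Delta>p: "\<Delta> p \<noteq> 0" using generic \<Delta>(2) by blast
  define fe where "fe k = poly_eval (f k)" for k
  have fe: "fe k \<in> poly_funs F E" if "k < n" for k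
    unfolding fe_def using that f by (intro poly_eval_in_poly_funs neg1) (auto simp: F_def)
  define y where "y = (\<lambda>k. fe k (m p))"
  define L where "L q = (\<lambda>k. if k < n then dd E (fe k) (m p) q else 0)" for q
  have onto: "\<exists>q\<in>im p. L q = w" if w: "w \<in> cspace {..<n}" for w
  proof -
    \<comment> \<open>A relation over \<open>F\<close> among the values \<open>y\<close> holds on
      all of \<open>M\<close> by genericity of \<open>p\<close>, so independence makes it trivial.
      Hence \<open>y\<close> may be given arbitrary derivatives \<open>w\<close>.\<close>
    have "dd {..<n} G y w = 0" if G: "G \<in> poly_funs F {..<n}" "G y = 0" for G
    proof -
      have GM: "G (\<lambda>k. fe k x) = 0" if "x \<in> M" for x
      proof (rule zero_on_M_generic[where f = "\<lambda>x. G (\<lambda>k. fe k x)", OF QF generic])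
        show "(\<lambda>x. G (\<lambda>k. fe k x)) \<in> poly_funs F E" by (rule poly_funs_comp[OF G(1)]) (simp add: fe)
        show "G (\<lambda>k. fe k (m p)) = 0" using G(2) by (simp add: y_def)
      qed (use that in auto)
      obtain G' where G': "G' \<in> cpolys {..<n}" "poly_eval G' = G"
        using poly_funs_UNIV[OF G(1)] unfolding poly_eval_cpolys[symmetric] by auto
      then have "G' = 0" using ind GM unfolding alg_independent_on_def fe_def by blast
      then have "G = (\<lambda>_. 0)" using G'(2) by (auto simp: poly_eval_zero)
      then show ?thesis by (simp add: dd_const)
    qed
    then obtain D where D: "derivation D" "\<And>c. c \<in> F \<Longrightarrow> D c = 0" "\<And>k. k < n \<Longrightarrow> D (y k) = w k"
      using exists_derivation[OF neg1 finite_lessThan] by (metis lessThan_iff)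
    obtain q where q: "q \<in> cspace A" "\<And>e. D (m p e) = B p q e"
      using derivation_m[OF D(1)] by blast
    have "L (B p q) k = w k" for k
    proof (cases "k < n")
      case True
      have "D (fe k (m p)) = dd E (fe k) (m p) (\<lambda>e. D (m p e))"
        by (rule derivation_poly_fun[OF D(1,2) finite_E fe[OF True]])
      then show ?thesis using D(3)[OF True] True q(2) by (simp add: L_def y_def)
    next
      case False
      then show ?thesis using w by (simp add: L_def cspace_def)
    qed
    then show ?thesis using q(1) by (auto simp: im_def)
  qed
  have L_sum: "L (\<Sum>j\<in>S. cscale (c j) (\<mu> j p)) = (\<Sum>j\<in>S. cscale (c j) (L (\<mu> j p)))" for c
  proof
    fix k
    have "(\<Sum>j\<in>S. cscale (c j) (\<mu> j p)) = (\<lambda>i. \<Sum>j\<in>S. c j * \<mu> j p i)"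
      by (rule ext) (simp add: sum_apply cscale_def)
    then show "L (\<Sum>j\<in>S. cscale (c j) (\<mu> j p)) k = (\<Sum>j\<in>S. cscale (c j) (L (\<mu> j p))) k"
      by (simp add: L_def sum_apply cscale_def dd_sum_right dd_scale_right)
  qed
  have "unit_vec ` {..<n} \<subseteq> cfun.span ((\<lambda>j. L (\<mu> j p)) ` S)"
  proof clarify
    fix k assume "k < n"
    then obtain q where q: "q \<in> im p" "L q = unit_vec k"
      using onto[of "unit_vec k"] unit_vec_cspace[of k "{..<n}"] by auto
    have "L q = (\<Sum>j\<in>S. cscale (q j / g p) (L (\<mu> j p)))"
      using im_expand[OF p \<Delta>p q(1)] L_sum by metis
    also have "\<dots> \<in> cfun.span ((\<lambda>j. L (\<mu> j p)) ` S)"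
      by (intro cfun.span_sum cfun.span_scale cfun.span_base imageI)
    finally show "unit_vec k \<in> cfun.span ((\<lambda>j. L (\<mu> j p)) ` S)" using q(2) by simp
  qed
  moreover have un: "inj_on unit_vec {..<n}" "cfun.independent (unit_vec ` {..<n})"
    using diagonal_independent[of "{..<n}" 1 unit_vec] by (auto simp: unit_vec_def)
  ultimately have "card (unit_vec ` {..<n}) \<le> card ((\<lambda>j. L (\<mu> j p)) ` S)"
    using cfun.independent_span_bound finite_S by blast
  also have "\<dots> \<le> card S" by (rule card_image_le[OF finite_S])
  finally show ?thesis by (simp add: card_image[OF un(1)])
qed

text \<open>The coordinates in \<open>S\<close> are independent: as \<mu> is diagonal there,
  \<open>im p\<close> projects onto all of \<open>cspace S\<close>, and images of lines through
  \<open>p\<close> are paths in \<open>M\<close> with these velocities.\<close>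

lemma exists_alg_independent:
  "\<exists>f. (\<forall>k<card S. f k \<in> cpolys E) \<and> alg_independent_on M (card S) f"
proof -
  obtain \<phi> where \<phi>: "bij_betw \<phi> {..<card S} S"
    using ex_bij_betw_nat_finite[OF finite_S] by (auto simp: atLeast0LessThan)
  have "\<exists>f\<in>cpolys E. poly_eval f = (\<lambda>x. x i)" if "i \<in> S" for i
  proof -
    have "(\<lambda>x. x i) \<in> poly_eval ` cpolys E"
      unfolding poly_eval_cpolys using that S by (intro poly_funs.var) auto
    then show ?thesis by (auto simp: image_iff)
  qed
  then obtain F where F: "\<And>i. i \<in> S \<Longrightarrow> F i \<in> cpolys E" "\<And>i. i \<in> S \<Longrightarrow> poly_eval (F i) = (\<lambda>x. x i)"
    by metis
  have \<phi>S: "\<phi> k \<in> S" if "k < card S" for k using \<phi> that by (auto dest: bij_betwE)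
  obtain p where p: "p \<in> cspace A" "\<Delta> p \<noteq> 0" using \<Delta>(2) by blast
  have "alg_independent_on M (card S) (\<lambda>k. F (\<phi> k))"
    unfolding alg_independent_on_def
  proof (intro ballI impI)
    fix G assume G: "G \<in> cpolys {..<card S}"
      and z: "\<forall>x\<in>M. poly_eval G (\<lambda>k. poly_eval (F (\<phi> k)) x) = 0"
    have GP: "poly_eval G \<in> poly_funs UNIV {..<card S}" using G poly_eval_cpolys by blast
    show "G = 0"
    proof (rule cpoly_eq_0[OF finite_lessThan G])
      fix x assume x: "x \<in> cspace {..<card S}"
      show "poly_eval G x = 0"
      proof (rule zero_if_zero_along_paths[OF finite_lessThan GP _ x])
        fix u assume "u \<in> cspace {..<card S}"
        define v where "v = (\<Sum>j\<in>S. cscale (u (the_inv_into {..<card S} \<phi> j) / g p) (\<mu> j p))"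
        have "v \<in> im p" unfolding v_def using p \<mu>_im
          by (intro cfun.subspace_sum cfun.subspace_scale subspace_im) auto
        then obtain r where r: "r \<in> cspace A" "v = B p r" by (auto simp: im_def)
        have vu: "v (\<phi> k) = u k" if "k < card S" for k
        proof -
          have "v (\<phi> k) = (\<Sum>j\<in>S. if j = \<phi> k then u (the_inv_into {..<card S} \<phi> j) else 0)"
            unfolding v_def sum_apply
            using g[OF p(2)] diag \<phi>S[OF that] by (intro sum.cong) (auto simp: cscale_def)
          also have "\<dots> = u (the_inv_into {..<card S} \<phi> (\<phi> k))"
            using \<phi>S[OF that] finite_S by simp
          also have "\<dots> = u k"
            using \<phi> that by (subst the_inv_into_f_f) (auto simp: bij_betw_def)
          finally show ?thesis .
        qed
        \<comment> \<open>Half speed makes the linear coefficient \<open>B p r\<close> instead of 2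
          \<open>B p r\<close>.\<close>
        define P where "P k = [:m p (\<phi> k), B p r (\<phi> k), m r (\<phi> k) / 4:]" for k
        have Pm: "poly (P k) t = m (p + cscale (t / 2) r) (\<phi> k)" for k t
          by (simp add: P_def m_line power2_eq_square algebra_simps)
        have "poly_eval G (\<lambda>k. poly (P k) t) = 0" for t
        proof -
          have "p + cscale (t / 2) r \<in> cspace A" using p r by (intro cspace_add cspace_scale)
          then have "poly_eval G (\<lambda>k. poly_eval (F (\<phi> k)) (m (p + cscale (t / 2) r))) = 0"
            using z m_in_M by blast
          moreover have "poly_eval G (\<lambda>k. poly (P k) t) =
              poly_eval G (\<lambda>k. poly_eval (F (\<phi> k)) (m (p + cscale (t / 2) r)))"
            by (rule poly_funs_cong[OF GP]) (simp add: Pm F(2) \<phi>S)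
          ultimately show ?thesis by simp
        qed
        moreover have "\<forall>k\<in>{..<card S}. coeff (P k) 0 = m p (\<phi> k) \<and> coeff (P k) 1 = u k"
          using vu r(2) by (simp add: P_def)
        ultimately show "\<exists>P. (\<forall>k\<in>{..<card S}. coeff (P k) 0 = m p (\<phi> k) \<and> coeff (P k) 1 = u k) \<and>
            (\<forall>t. poly_eval G (\<lambda>k. poly (P k) t) = 0)" by blast
      qed
    qed
  qed
  then show ?thesis using F(1) \<phi>S by (intro exI[of _ "\<lambda>k. F (\<phi> k)"]) auto
qed

lemma variety_dim_M: "variety_dim E M = card S"
  unfolding variety_dim_def
proof (rule Greatest_equality)
  show "\<exists>f. (\<forall>k<card S. f k \<in> cpolys E) \<and> alg_independent_on M (card S) f"
    by (rule exists_alg_independent)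
next
  fix n assume "\<exists>f. (\<forall>k<n. f k \<in> cpolys E) \<and> alg_independent_on M n f"
  then obtain f where "\<And>k. k < n \<Longrightarrow> f k \<in> cpolys E" "alg_independent_on M n f" by blast
  then show "n \<le> card S" by (rule alg_independent_bound)
qed

end

end

text \<open>Once the tangent spaces are known, \<open>S\<close>, \<open>g\<close> and \<mu> only
  serve to compute the dimension, which survives here as \<open>smooth\<close>.\<close>

locale regular_quadratic_map = quadratic_map A E b
  for A :: "'a set" and E :: "'e set" and b +
  fixes \<Delta> :: "('a \<Rightarrow> complex) \<Rightarrow> complex" and K :: "'e set"
    and \<kappa> :: "'e \<Rightarrow> ('a \<Rightarrow> complex) \<Rightarrow> 'e \<Rightarrow> complex"
  assumes \<Delta>_poly: "\<Delta> \<in> poly_funs \<rat> A" and \<Delta>_nonzero: "\<exists>p\<in>cspace A. \<Delta> p \<noteq> 0"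
    and \<kappa>_poly: "\<And>j e. j \<in> K \<Longrightarrow> (\<lambda>p. \<kappa> j p e) \<in> poly_funs \<rat> A"
    and \<kappa>_stress: "\<And>j p. j \<in> K \<Longrightarrow> p \<in> cspace A \<Longrightarrow> \<kappa> j p \<in> stress p"
    and stress_expand: "\<And>p \<omega>. p \<in> cspace A \<Longrightarrow> \<Delta> p \<noteq> 0 \<Longrightarrow> \<omega> \<in> stress p \<Longrightarrow>
      \<exists>c. \<omega> = (\<Sum>j\<in>K. cscale (c j) (\<kappa> j p))"
    and tangent_eq_im: "\<And>p. p \<in> cspace A \<Longrightarrow> \<Delta> p \<noteq> 0 \<Longrightarrow> tangent_space E M (m p) = im p"
    and smooth: "\<And>p. p \<in> cspace A \<Longrightarrow> \<Delta> p \<noteq> 0 \<Longrightarrow> smooth_point E M (m p)"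

lemma (in quadratic_map) exists_regular: "\<exists>\<Delta> K \<kappa>. regular_quadratic_map A E b \<Delta> K \<kappa>"
proof -
  obtain \<Delta> g :: "('a \<Rightarrow> complex) \<Rightarrow> complex" and K S :: "'e set"
    and \<kappa> \<mu> :: "'e \<Rightarrow> ('a \<Rightarrow> complex) \<Rightarrow> 'e \<Rightarrow> complex"
    where \<Delta>: "\<Delta> \<in> poly_funs \<rat> A" "\<exists>p\<in>cspace A. \<Delta> p \<noteq> 0" and K: "K \<subseteq> E" and S: "S \<subseteq> E"
    and \<kappa>: "\<And>j e. j \<in> K \<Longrightarrow> (\<lambda>p. \<kappa> j p e) \<in> poly_funs \<rat> A"
      "\<And>j p. j \<in> K \<Longrightarrow> p \<in> cspace A \<Longrightarrow> \<kappa> j p \<in> stress p"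
      "\<And>p \<omega>. p \<in> cspace A \<Longrightarrow> \<Delta> p \<noteq> 0 \<Longrightarrow> \<omega> \<in> stress p \<Longrightarrow> \<exists>c. \<omega> = (\<Sum>j\<in>K. cscale (c j) (\<kappa> j p))"
    and \<mu>: "\<And>p. \<Delta> p \<noteq> 0 \<Longrightarrow> g p \<noteq> 0"
      "\<And>i j p. i \<in> S \<Longrightarrow> j \<in> S \<Longrightarrow> \<mu> j p i = (if i = j then g p else 0)"
      "\<And>j p. j \<in> S \<Longrightarrow> p \<in> cspace A \<Longrightarrow> \<Delta> p \<noteq> 0 \<Longrightarrow> \<mu> j p \<in> im p"
      "\<And>p v. p \<in> cspace A \<Longrightarrow> \<Delta> p \<noteq> 0 \<Longrightarrow> v \<in> im p \<Longrightarrow>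
        cscale (g p) v = (\<Sum>j\<in>S. cscale (v j) (\<mu> j p))"
    and T: "\<And>p. p \<in> cspace A \<Longrightarrow> \<Delta> p \<noteq> 0 \<Longrightarrow> tangent_space E M (m p) = im p"
    by (rule exists_regular_locus) (rule that; assumption)
  have smooth: "smooth_point E M (m p)" if "p \<in> cspace A" "\<Delta> p \<noteq> 0" for p
    unfolding smooth_point_def
    using that m_in_M T dim_im[OF \<Delta> S \<mu>] variety_dim_M[OF \<Delta> S \<mu>] by simp
  have "regular_quadratic_map A E b \<Delta> K \<kappa>"
    by (unfold_locales; use \<Delta> \<kappa> T smooth in blast)
  then show ?thesis by blast
qed

section \<open>Coordinate matroids of linear subspaces\<close>

lemma coord_proj_cspace: "coord_proj J x \<in> cspace J"
  by (simp add: coord_proj_def cspace_def)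

lemma coord_proj_add: "coord_proj J (x + y) = coord_proj J x + coord_proj J y"
  by (rule ext) (simp add: coord_proj_def)

lemma coord_proj_scale: "coord_proj J (cscale c x) = cscale c (coord_proj J x)"
  by (rule ext) (simp add: coord_proj_def cscale_def)

lemma coord_proj_zero: "coord_proj J 0 = 0"
  by (rule ext) (simp add: coord_proj_def)

lemma subspace_coord_proj:
  assumes "cfun.subspace U"
  shows "cfun.subspace (coord_proj J ` U)"
proof -
  have "0 \<in> coord_proj J ` U"
    by (rule image_eqI[of _ _ 0]) (simp_all only: coord_proj_zero cfun.subspace_0[OF assms])
  moreover have "x + y \<in> coord_proj J ` U" if "x \<in> coord_proj J ` U" "y \<in> coord_proj J ` U" for x y
    using that cfun.subspace_add[OF assms] by (auto simp flip: coord_proj_add)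
  moreover have "cscale c x \<in> coord_proj J ` U" if "x \<in> coord_proj J ` U" for x c
    using that cfun.subspace_scale[OF assms] by (auto simp flip: coord_proj_scale)
  ultimately show ?thesis by (simp add: cfun.subspace_def)
qed

lemma coord_proj_eqD: "coord_proj J x = u \<Longrightarrow> i \<in> J \<Longrightarrow> x i = u i"
  by (auto simp: coord_proj_def)

lemma coord_proj_surj_iff:
  "coord_proj J ` U = cspace J \<longleftrightarrow> (\<forall>u\<in>cspace J. \<exists>x\<in>U. \<forall>i\<in>J. x i = u i)"
proof
  assume "coord_proj J ` U = cspace J"
  then show "\<forall>u\<in>cspace J. \<exists>x\<in>U. \<forall>i\<in>J. x i = u i"
    by (metis coord_proj_eqD imageE)
next
  assume a: "\<forall>u\<in>cspace J. \<exists>x\<in>U. \<forall>i\<in>J. x i = u i"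
  show "coord_proj J ` U = cspace J"
  proof (intro subset_antisym subsetI)
    fix u assume u: "u \<in> cspace J"
    then obtain x where x: "x \<in> U" "\<forall>i\<in>J. x i = u i" using a by blast
    then have "u = coord_proj J x"
      by (intro cspace_eqI[OF u coord_proj_cspace]) (simp add: coord_proj_def)
    then show "u \<in> coord_proj J ` U" using x(1) by blast
  qed (auto simp: coord_proj_cspace)
qed

text \<open>A functional on \<open>J\<close> vanishing on the projection, extended by 0 to
  \<open>E\<close>, lies in the double annihilator of \<open>T\<close>, which is \<open>T\<close>.
  So the obstructions to surjectivity are the nonzero vectors of \<open>T\<close> supported in
  \<open>J\<close>.\<close>

lemma coord_proj_annihilator_surj_iff:
  assumes E: "finite E" and T: "cfun.subspace T" "T \<subseteq> cspace E" and J: "J \<subseteq> E"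
  shows "coord_proj J ` annihilator E T = cspace J \<longleftrightarrow> (\<forall>v\<in>T. (\<forall>e\<in>E - J. v e = 0) \<longrightarrow> v = 0)"
proof
  assume surj: "coord_proj J ` annihilator E T = cspace J"
  show "\<forall>v\<in>T. (\<forall>e\<in>E - J. v e = 0) \<longrightarrow> v = 0"
  proof (intro ballI impI)
    fix v assume v: "v \<in> T" "\<forall>e\<in>E - J. v e = 0"
    have "v e = 0" if e: "e \<in> J" for e
    proof -
      obtain x where x: "x \<in> annihilator E T" "\<forall>i\<in>J. x i = unit_vec e i"
        using surj unit_vec_cspace[OF e] unfolding coord_proj_surj_iff by blast
      have "0 = pairing E v x" using x(1) v(1) by (simp add: annihilator_def)
      also have "\<dots> = pairing E (unit_vec e) v"
        unfolding pairing_def using v(2) x(2) J e by (intro sum.cong) (auto simp: unit_vec_def)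
      also have "\<dots> = v e" using e J by (intro pairing_unit_vec[OF E]) auto
      finally show ?thesis by simp
    qed
    then show "v = 0" using v T(2) by (intro cspace_eqI[OF _ cspace_0, of _ E]) auto
  qed
next
  assume inj: "\<forall>v\<in>T. (\<forall>e\<in>E - J. v e = 0) \<longrightarrow> v = 0"
  show "coord_proj J ` annihilator E T = cspace J"
  proof (rule ccontr)
    assume "coord_proj J ` annihilator E T \<noteq> cspace J"
    moreover have sub: "coord_proj J ` annihilator E T \<subseteq> cspace J" by (auto simp: coord_proj_cspace)
    ultimately obtain u where u: "u \<in> cspace J" "u \<notin> coord_proj J ` annihilator E T" by blast
    obtain w where w: "w \<in> cspace J" "\<And>y. y \<in> coord_proj J ` annihilator E T \<Longrightarrow> pairing J w y = 0"
      "pairing J w u \<noteq> 0"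
      using separating_functional[OF finite_subset[OF J E] subspace_coord_proj[OF subspace_annihilator] sub u]
      by metis
    have wE: "w \<in> cspace E" using w(1) J by (auto simp: cspace_def)
    have orth: "pairing E x w = 0" if x: "x \<in> annihilator E T" for x
    proof -
      have "pairing E x w = (\<Sum>i\<in>J. x i * w i)"
        unfolding pairing_def using w(1) J E by (intro sum.mono_neutral_right) (auto simp: cspace_def)
      also have "\<dots> = pairing J w (coord_proj J x)"
        unfolding pairing_def by (intro sum.cong) (auto simp: coord_proj_def)
      finally show ?thesis using w(2) x by simp
    qed
    have "w \<in> T" by (rule in_subspace_if_annihilated[OF E T wE orth])
    moreover have "\<forall>e\<in>E - J. w e = 0" using w(1) by (auto simp: cspace_def)
    ultimately have "w = 0" using inj by blast
    then show False using w(3) by (simp add: pairing_def)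
  qed
qed

text \<open>If \<open>v e\<close> were nonzero, multiples of \<open>v\<close> would adjust the value
  at \<open>e\<close> without changing the values on \<open>B\<close>, and \<open>B\<close> could be
  enlarged by \<open>e\<close>.\<close>

lemma zero_if_zero_on_maximal:
  assumes T: "cfun.subspace T" and B: "coord_proj B ` T = cspace B"
    and max: "\<And>e. e \<in> X - B \<Longrightarrow> coord_proj (insert e B) ` T \<noteq> cspace (insert e B)"
    and v: "v \<in> T" "\<And>e. e \<in> B \<Longrightarrow> v e = 0" and e: "e \<in> X"
  shows "v e = 0"
proof (rule ccontr)
  assume ve: "v e \<noteq> 0"
  then have eB: "e \<in> X - B" using v(2) e by auto
  have "\<exists>x\<in>T. \<forall>i\<in>insert e B. x i = u i" if u: "u \<in> cspace (insert e B)" for u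
  proof -
    obtain t where t: "t \<in> T" "\<forall>i\<in>B. t i = coord_proj B u i"
      using B coord_proj_cspace[of B u] unfolding coord_proj_surj_iff by blast
    define x where "x = t + cscale ((u e - t e) / v e) v"
    have "x \<in> T" unfolding x_def using t(1) v(1) T by (intro cfun.subspace_add cfun.subspace_scale)
    moreover have "x e = u e" using ve by (simp add: x_def cscale_def)
    moreover have "x i = u i" if "i \<in> B" for i
      using that t(2) v(2) by (simp add: x_def cscale_def coord_proj_def)
    ultimately show ?thesis by blast
  qed
  then have "coord_proj (insert e B) ` T = cspace (insert e B)" by (subst coord_proj_surj_iff) blast
  then show False using max eB by blast
qed

text \<open>\<open>J\<close> is independent for the annihilator iff restricting \<open>T\<close> to
  the coordinates in \<open>E - J\<close> is injective, and this holds iff \<open>E - J\<close>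
  contains a base for \<open>T\<close>.\<close>

lemma dual_matroid_annihilator:
  assumes E: "finite E" and T: "cfun.subspace T" "T \<subseteq> cspace E"
  shows "(E, {J. J \<subseteq> E \<and> coord_proj J ` annihilator E T = cspace J}) =
    dual_matroid (E, {J. J \<subseteq> E \<and> coord_proj J ` T = cspace J})"
proof -
  define ind where "ind B \<longleftrightarrow> coord_proj B ` T = cspace B" for B
  define base where "base B \<longleftrightarrow> B \<subseteq> E \<and> ind B \<and> (\<forall>C\<subseteq>E. ind C \<longrightarrow> B \<subseteq> C \<longrightarrow> C = B)" for B
  have "B \<in> matroid_bases (E, {J. J \<subseteq> E \<and> coord_proj J ` T = cspace J}) \<longleftrightarrow> base B" for B
    by (simp add: matroid_bases_def base_def ind_def conj_assoc imp_conjL)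
  then have dual: "dual_matroid (E, {J. J \<subseteq> E \<and> coord_proj J ` T = cspace J}) =
      (E, {J. \<exists>B. base B \<and> J \<subseteq> E - B})"
    by (simp add: dual_matroid_def Bex_def)
  have "(J \<subseteq> E \<and> coord_proj J ` annihilator E T = cspace J) \<longleftrightarrow> (\<exists>B. base B \<and> J \<subseteq> E - B)" for J
  proof
    assume "\<exists>B. base B \<and> J \<subseteq> E - B"
    then obtain B where B: "base B" "J \<subseteq> E - B" by blast
    have "v = 0" if v: "v \<in> T" "\<forall>e\<in>E - J. v e = 0" for v
    proof -
      have "v e = 0" if "e \<in> E" for e
      proof (rule zero_if_zero_on_maximal[OF T(1) _ _ v(1) _ that])
        show "coord_proj B ` T = cspace B" using B by (simp add: base_def ind_def)
        show "coord_proj (insert e B) ` T \<noteq> cspace (insert e B)" if "e \<in> E - B" for e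
        proof
          assume "coord_proj (insert e B) ` T = cspace (insert e B)"
          then have "insert e B = B" using B(1) that unfolding base_def ind_def by (meson DiffD1 insert_subset subset_insertI)
          then show False using that by blast
        qed
        show "v e = 0" if "e \<in> B" for e using B v(2) that by (auto simp: base_def)
      qed
      then show ?thesis using v(1) T(2) by (intro cspace_eqI[OF _ cspace_0, of _ E]) auto
    qed
    then show "J \<subseteq> E \<and> coord_proj J ` annihilator E T = cspace J"
      using B coord_proj_annihilator_surj_iff[OF E T, of J] by blast
  next
    assume J: "J \<subseteq> E \<and> coord_proj J ` annihilator E T = cspace J"
    then have inj: "v = 0" if "v \<in> T" "\<forall>e\<in>E - J. v e = 0" for v
      using that coord_proj_annihilator_surj_iff[OF E T, of J] by blast
    have "ind {}" using cfun.subspace_0[OF T(1)] unfolding ind_def coord_proj_surj_iff by blast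
    then have "{B. B \<subseteq> E - J \<and> ind B} \<noteq> {}" by blast
    moreover have "finite {B. B \<subseteq> E - J \<and> ind B}" using E by simp
    ultimately have "\<exists>B\<in>{B. B \<subseteq> E - J \<and> ind B}. \<forall>C\<in>{B. B \<subseteq> E - J \<and> ind B}. B \<subseteq> C \<longrightarrow> B = C"
      by (intro finite_has_maximal)
    then obtain B where B: "B \<subseteq> E - J" "ind B"
      and max': "\<forall>C. C \<subseteq> E - J \<and> ind C \<longrightarrow> B \<subseteq> C \<longrightarrow> B = C" by auto
    have max: "C = B" if "C \<subseteq> E - J" "ind C" "B \<subseteq> C" for C using max' that by blast
    have zero: "v = 0" if v: "v \<in> T" "\<And>e. e \<in> B \<Longrightarrow> v e = 0" for v
    proof -
      have "v e = 0" if "e \<in> E - J" for e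
      proof (rule zero_if_zero_on_maximal[OF T(1) _ _ v that])
        show "coord_proj B ` T = cspace B" using B by (simp add: ind_def)
        show "coord_proj (insert e B) ` T \<noteq> cspace (insert e B)" if "e \<in> E - J - B" for e
        proof
          assume "coord_proj (insert e B) ` T = cspace (insert e B)"
          then have "insert e B = B" using B(1) that by (intro max) (auto simp: ind_def)
          then show False using that by blast
        qed
      qed
      then show ?thesis using inj v(1) by blast
    qed
    \<comment> \<open>A larger independent \<open>C\<close> would give a vector of \<open>T\<close>
      that is 0 on \<open>B\<close> and 1 at some \<open>e\<close>, contradicting
      \<open>zero\<close>. So maximality inside \<open>E - J\<close> extends to
      \<open>E\<close>.\<close>
    have "C = B" if C: "C \<subseteq> E" "ind C" "B \<subseteq> C" for C
    proof (rule ccontr)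
      assume "C \<noteq> B"
      then obtain e where e: "e \<in> C" "e \<notin> B" using C by blast
      obtain v where v: "v \<in> T" "\<forall>i\<in>C. v i = unit_vec e i"
        using C(2) unit_vec_cspace[OF e(1)] unfolding ind_def coord_proj_surj_iff by blast
      have "v = 0" using v e C(3) by (intro zero) (auto simp: unit_vec_def)
      then show False using v(2) e(1) by (auto simp: unit_vec_def)
    qed
    then have "base B" using B by (auto simp: base_def)
    then show "\<exists>B. base B \<and> J \<subseteq> E - B" using B(1) J by blast
  qed
  then show ?thesis unfolding dual by simp
qed

text \<open>A polynomial in the \<open>J\<close>-coordinates takes the same value at a point and at
  its projection, so density can be tested on \<open>X\<close> itself.\<close>

lemma dense_projection_iff:
  "zariski_closure J (coord_proj J ` X) = cspace J \<longleftrightarrow>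
    (\<forall>g\<in>poly_funs UNIV J. (\<forall>x\<in>X. g x = 0) \<longrightarrow> (\<forall>y\<in>cspace J. g y = 0))"
proof -
  have eq: "g (coord_proj J x) = g x" if "g \<in> poly_funs UNIV J" for g x
    by (rule poly_funs_cong[OF that]) (simp add: coord_proj_def)
  show ?thesis
  proof
    assume c: "zariski_closure J (coord_proj J ` X) = cspace J"
    show "\<forall>g\<in>poly_funs UNIV J. (\<forall>x\<in>X. g x = 0) \<longrightarrow> (\<forall>y\<in>cspace J. g y = 0)"
    proof (intro ballI impI)
      fix g y assume g: "g \<in> poly_funs UNIV J" "\<forall>x\<in>X. g x = 0" and y: "y \<in> cspace J"
      show "g y = 0"
      proof (rule zero_on_zariski_closure[OF g(1)])
        show "y \<in> zariski_closure J (coord_proj J ` X)" using c y by simp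
        show "g x = 0" if "x \<in> coord_proj J ` X" for x using that g(2) eq[OF g(1)] by auto
      qed
    qed
  next
    assume d: "\<forall>g\<in>poly_funs UNIV J. (\<forall>x\<in>X. g x = 0) \<longrightarrow> (\<forall>y\<in>cspace J. g y = 0)"
    show "zariski_closure J (coord_proj J ` X) = cspace J"
    proof (rule subset_antisym[OF zariski_closure_cspace subsetI])
      fix y assume y: "y \<in> cspace J"
      show "y \<in> zariski_closure J (coord_proj J ` X)"
      proof (rule in_zariski_closureI[OF y])
        fix g assume g: "g \<in> poly_funs UNIV J" "\<And>y. y \<in> coord_proj J ` X \<Longrightarrow> g y = 0"
        then have "\<forall>x\<in>X. g x = 0" using eq by (metis imageI)
        then show "g y = 0" using d g(1) y by blast
      qed
    qed
  qed
qed

lemma subspace_perp_eq_annihilator: "L \<subseteq> cspace I \<Longrightarrow> subspace_perp I L = annihilator I L"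
  by (auto simp: subspace_perp_def hyperplane_perp_def annihilator_def pairing_def mult.commute)

section \<open>The dual variety\<close>

context regular_quadratic_map
begin

lemma stress_cspace: "\<omega> \<in> stress p \<Longrightarrow> \<omega> \<in> cspace E"
  by (simp add: stress_def annihilator_def)

lemma stress_in_dual_variety:
  assumes "p \<in> cspace A" "\<Delta> p \<noteq> 0" "\<omega> \<in> stress p"
  shows "\<omega> \<in> dual_variety E M"
proof -
  have "\<omega> \<in> subspace_perp E (tangent_space E M (m p))"
    using assms tangent_eq_im[OF assms(1,2)] by (simp add: subspace_perp_eq_annihilator[OF im_cspace] stress_def)
  then have "\<omega> \<in> (\<Union>x\<in>{x. smooth_point E M x}. subspace_perp E (tangent_space E M x))"
    using smooth[OF assms(1,2)] by blast
  moreover have "(\<Union>x\<in>{x. smooth_point E M x}. subspace_perp E (tangent_space E M x)) \<subseteq> cspace E"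
    by (auto simp: subspace_perp_def)
  ultimately show ?thesis
    unfolding dual_variety_def using subset_zariski_closure by blast
qed

lemma gradient_in_stress:
  assumes p: "p \<in> cspace A" and f: "f \<in> poly_funs UNIV E" "\<forall>x\<in>M. f x = 0"
  shows "gradient E f (m p) \<in> stress p"
  using im_tangent[OF p] f unfolding stress_def annihilator_def tangent_space_poly_funs
  by (auto simp: gradient_cspace pairing_commute[of E _ "gradient E f (m p)"] pairing_gradient)

text \<open>A conormal vector at any point of \<open>M\<close> is a combination of gradients of polynomials vanishing on
  \<open>M\<close>; the same combination at \<open>m p\<close> is a stress of \<open>p\<close>.\<close>

lemma zero_on_dual_variety:
  assumes f: "f \<in> poly_funs UNIV E"
    and z: "\<And>p \<omega>. p \<in> cspace A \<Longrightarrow> \<Delta> p \<noteq> 0 \<Longrightarrow> \<omega> \<in> stress p \<Longrightarrow> f \<omega> = 0"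
    and \<omega>: "\<omega> \<in> dual_variety E M"
  shows "f \<omega> = 0"
proof (rule zero_on_zariski_closure[OF f _ \<omega>[unfolded dual_variety_def]])
  fix \<eta> assume "\<eta> \<in> (\<Union>x\<in>{x. smooth_point E M x}. subspace_perp E (tangent_space E M x))"
  then obtain x where x: "x \<in> M" "\<eta> \<in> subspace_perp E (tangent_space E M x)"
    by (auto simp: smooth_point_def)
  have "tangent_space E M x \<subseteq> cspace E" by (auto simp: tangent_space_def)
  then have \<eta>: "\<eta> \<in> annihilator E (tangent_space E M x)"
    using x(2) subspace_perp_eq_annihilator by blast
  define V where "V = {f \<in> poly_funs UNIV E. \<forall>x\<in>M. f x = 0}"
  define X where "X = (\<lambda>f. gradient E f x) ` V"
  have X: "X \<subseteq> cspace E" by (auto simp: X_def gradient_cspace)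
  have "\<eta> \<in> cfun.span X"
  proof (rule in_subspace_if_annihilated[OF finite_E cfun.subspace_span cfun.span_minimal[OF X subspace_cspace]])
    show "\<eta> \<in> cspace E" using \<eta> by (simp add: annihilator_def)
    fix w assume w: "w \<in> annihilator E (cfun.span X)"
    have "dd E f x w = 0" if "f \<in> V" for f
    proof -
      have "gradient E f x \<in> cfun.span X" using that by (intro cfun.span_base) (auto simp: X_def)
      then show ?thesis using w by (auto simp: annihilator_def pairing_gradient)
    qed
    then have "w \<in> tangent_space E M x"
      using w by (auto simp: tangent_space_poly_funs annihilator_def V_def)
    then show "pairing E w \<eta> = 0" using \<eta> by (simp add: annihilator_def)
  qed
  then obtain t r where t: "finite t" "t \<subseteq> X" "\<eta> = (\<Sum>a\<in>t. cscale (r a) a)"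
    unfolding cfun.span_explicit by blast
  have "\<exists>f\<in>V. a = gradient E f x" if "a \<in> t" for a using that t(2) by (auto simp: X_def)
  then obtain \<phi> where \<phi>: "\<And>a. a \<in> t \<Longrightarrow> \<phi> a \<in> V \<and> a = gradient E (\<phi> a) x" by metis
  define \<Gamma> where "\<Gamma> y = (\<Sum>a\<in>t. cscale (r a) (gradient E (\<phi> a) y))" for y
  have \<Gamma>x: "\<Gamma> x = \<eta>" unfolding \<Gamma>_def t(3) using \<phi> by (intro sum.cong) auto
  have \<Gamma>_poly: "(\<lambda>y. \<Gamma> y e) \<in> poly_funs UNIV E" if "e \<in> E" for e
    unfolding \<Gamma>_def sum_apply cscale_def gradient_def using that \<phi>
    by (auto simp: V_def intro!: poly_funs_sum poly_funs.mult poly_funs.const pd_poly_funs)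
  have "(\<lambda>y. f (\<lambda>e. \<Gamma> y e)) \<in> poly_funs UNIV E" by (rule poly_funs_comp[OF f \<Gamma>_poly])
  then have f\<Gamma>: "(\<lambda>y. f (\<Gamma> y)) \<in> poly_funs UNIV E" by simp
  have "f (\<Gamma> (m p)) = 0" if p: "p \<in> cspace A" for p
  proof -
    obtain a where a: "a \<in> cspace A" "\<Delta> a \<noteq> 0" using \<Delta>_nonzero by blast
    show ?thesis
    proof (rule poly_funs_zero_if_zero_off[OF finite_A comp_m_poly[OF f\<Gamma> subset_UNIV] \<Delta>_poly a _ p])
      fix q assume q: "q \<in> cspace A" "\<Delta> q \<noteq> 0"
      have "\<Gamma> (m q) \<in> stress q"
        unfolding \<Gamma>_def stress_def
        using gradient_in_stress[OF q(1)] \<phi> unfolding stress_def V_def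
        by (intro cfun.subspace_sum cfun.subspace_scale subspace_annihilator) auto
      then show "f (\<Gamma> (m q)) = 0" using z q by blast
    qed
  qed
  then have "f (\<Gamma> x) = 0" using zero_on_M[OF f\<Gamma> _ x(1)] by blast
  then show "f \<eta> = 0" by (simp add: \<Gamma>x)
qed

text \<open>All but finitely many configurations on the line are regular, and their stresses lie in
  the dual variety; \<open>f\<close> along the path is a polynomial in \<open>t\<close>, hence
  zero.\<close>

lemma zero_on_dual_variety_line:
  assumes f: "f \<in> poly_funs UNIV E" "\<And>\<eta>. \<eta> \<in> dual_variety E M \<Longrightarrow> f \<eta> = 0"
    and p: "p \<in> cspace A" "\<Delta> p \<noteq> 0" and q: "q \<in> cspace A"
    and path: "\<And>t. (\<lambda>e. poly (P e) t) \<in> stress (p + cscale t q)"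
  shows "f (\<lambda>e. poly (P e) t) = 0"
proof -
  obtain Q where Q: "\<And>t. f (\<lambda>e. poly (P e) t) = poly Q t"
    using poly_funs_path[OF finite_E f(1)] by metis
  define L where "L a = [:p a, q a:]" for a
  have L: "(\<lambda>a. poly (L a) t) = p + cscale t q" for t by (auto simp: L_def cscale_def)
  obtain R where R: "\<And>t. \<Delta> (\<lambda>a. poly (L a) t) = poly R t"
    using poly_funs_path[OF finite_A \<Delta>_poly] by metis
  have "poly R 0 \<noteq> 0" using R[of 0] p by (simp add: L cscale_def plus_fun_def)
  then have "R \<noteq> 0" by auto
  then have "Q = 0"
  proof (rule poly_eq_0_cofinite)
    fix t assume "poly R t \<noteq> 0"
    then have "\<Delta> (p + cscale t q) \<noteq> 0" using R L by metis
    moreover have "p + cscale t q \<in> cspace A" using p q by (intro cspace_add cspace_scale)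
    ultimately have "(\<lambda>e. poly (P e) t) \<in> dual_variety E M"
      by (intro stress_in_dual_variety[OF _ _ path])
    then show "poly Q t = 0" using f(2) Q by metis
  qed
  then show ?thesis using Q by simp
qed

end

section \<open>Generic stresses\<close>

locale generic_quadratic_stress = regular_quadratic_map A E b \<Delta> K \<kappa>
  for A :: "'a set" and E :: "'e set" and b \<Delta> K \<kappa> +
  fixes \<omega> :: "'e \<Rightarrow> complex"
  assumes \<omega>: "generic_point E (dual_variety E M) \<omega>"
begin

lemma \<omega>_in: "\<omega> \<in> dual_variety E M"
  using \<omega> by (simp add: generic_point_def)

lemma generic:
  assumes "f \<in> poly_funs \<rat> E" "f \<omega> = 0"
  shows "\<forall>y\<in>dual_variety E M. f y = 0"
proof -
  obtain g where g: "g \<in> rational_cpolys E" "poly_eval g = f"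
    using assms(1) unfolding poly_eval_rational_cpolys[symmetric] by auto
  then have "\<forall>y\<in>dual_variety E M. poly_eval g y = 0"
    using \<omega> assms(2) unfolding generic_point_def by blast
  then show ?thesis by (simp add: g(2))
qed

text \<open>By genericity of \<omega>, the polynomials used are the rational equations of the dual
  variety. On \<open>E\<close>, the members of \<open>T\<close> are exactly the values on \<omega>
  of derivations of the complex numbers.\<close>

definition T :: "('e \<Rightarrow> complex) set" where
  "T = {v \<in> cspace E. \<forall>f\<in>poly_funs \<rat> E. f \<omega> = 0 \<longrightarrow> dd E f \<omega> v = 0}"

definition contact :: "('e \<Rightarrow> complex) set" where
  "contact = {x. smooth_point E M x \<and> tangent_space E M x \<subseteq> hyperplane_perp E \<omega>}"

lemma T_cspace: "T \<subseteq> cspace E"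
  by (auto simp: T_def)

lemma subspace_T: "cfun.subspace T"
proof -
  have "T = annihilator E {gradient E f \<omega> |f. f \<in> poly_funs \<rat> E \<and> f \<omega> = 0}"
    unfolding T_def annihilator_def by (auto simp: pairing_gradient)
  then show ?thesis by (simp add: subspace_annihilator)
qed

text \<open>\<open>M\<close> is a cone, and \<open>x\<close> is the velocity of scaling at
  \<open>x\<close>. As \<open>m\<close> is quadratic, the factor \<open>s\<close> on
  \<open>M\<close> comes from \<open>csqrt s\<close> on configurations.\<close>

lemma scaling_M:
  assumes x: "x \<in> M"
  shows "x \<in> tangent_space E M x"
proof -
  have xE: "x \<in> cspace E" using x zariski_closure_cspace unfolding M_def by blast
  have "dd E f x x = 0" if f: "f \<in> poly_funs UNIV E" "\<forall>y\<in>M. f y = 0" for f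
  proof -
    have scale: "f (\<lambda>e. s * x e) = 0" for s
    proof (rule zero_on_M[where f = "\<lambda>x. f (\<lambda>e. s * x e)", OF _ _ x])
      show "(\<lambda>x. f (\<lambda>e. s * x e)) \<in> poly_funs UNIV E"
        by (rule poly_funs_comp[OF f(1), where \<phi> = "\<lambda>e x. s * x e"]) (intro poly_funs.mult poly_funs.const poly_funs.var UNIV_I)
      fix p assume p: "p \<in> cspace A"
      have "m (cscale (csqrt s) p) = (\<lambda>e. s * m p e)"
        unfolding m_def B_scale_left B_scale_right
        by (simp add: cscale_def mult.assoc[symmetric] power2_eq_square[symmetric])
      then show "f (\<lambda>e. s * m p e) = 0"
        using f(2) m_in_M[OF cspace_scale[OF p, of "csqrt s"]] by metis
    qed
    define P where "P e = [:x e, x e:]" for e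
    obtain Q where Q: "\<And>t. f (\<lambda>e. poly (P e) t) = poly Q t"
      "coeff Q 1 = dd E f (\<lambda>i. coeff (P i) 0) (\<lambda>i. coeff (P i) 1)"
      using poly_funs_path[OF finite_E f(1)] by metis
    have "poly Q t = 0" for t
    proof -
      have "(\<lambda>e. poly (P e) t) = (\<lambda>e. (1 + t) * x e)" by (auto simp: P_def algebra_simps)
      then show ?thesis using Q(1)[of t] scale by simp
    qed
    then have "Q = 0" using poly_all_0_iff_0 by blast
    then show ?thesis using Q(2) by (simp add: P_def)
  qed
  then show ?thesis using xE by (simp add: tangent_space_poly_funs)
qed

lemma zero_on_M_if_zero_at_rational_points:
  assumes f: "f \<in> poly_funs UNIV E"
    and z: "\<And>p. p \<in> cspace A \<Longrightarrow> (\<And>a. p a \<in> \<rat>) \<Longrightarrow> f (m p) = 0" and x: "x \<in> M"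
  shows "f x = 0"
proof (rule zero_on_M[OF f _ x])
  show "f (m p) = 0" if "p \<in> cspace A" for p
    using poly_funs_zero_if_zero_on_Rats[OF finite_A comp_m_poly[OF f subset_UNIV] _ that] z by blast
qed

lemma m_rational:
  assumes "\<And>a. p a \<in> \<rat>"
  shows "m p e \<in> \<rat>"
  unfolding m_def B_def using assms b_Rats by (auto intro!: Rats_sum Rats_mult)

text \<open>Reciprocity: if \<open>D\<close> is a derivation with \<open>D \<omega> = v\<close>, then \<open>D x\<close> is tangent to \<open>M\<close> at \<open>x\<close>, because
  \<open>M\<close> has a dense set of rational points. Hence \<open>\<omega>\<close> annihilates both \<open>x\<close> and \<open>D x\<close>, and applying
  \<open>D\<close> to \<open>\<Sum>\<omega>\<^sub>e x\<^sub>e = 0\<close> gives the claim.\<close>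

lemma contact_orthogonal_T:
  assumes x: "x \<in> M" and tx: "tangent_space E M x \<subseteq> hyperplane_perp E \<omega>" and v: "v \<in> T"
  shows "pairing E v x = 0"
proof -
  have neg1: "-1 \<in> (\<rat> :: complex set)" by simp
  have "dd E f \<omega> v = 0" if "f \<in> poly_funs \<rat> E" "f \<omega> = 0" for f
    using v that by (simp add: T_def)
  then obtain D where D: "derivation D" "\<And>e. e \<in> E \<Longrightarrow> D (\<omega> e) = v e"
    using exists_derivation[OF neg1 finite_E, of \<omega> v] by metis
  define Dx where "Dx e = (if e \<in> E then D (x e) else 0)" for e
  have "dd E f x Dx = 0" if f: "f \<in> poly_funs UNIV E" "\<forall>y\<in>M. f y = 0" for f
  proof -
    obtain g where g: "g \<in> poly_funs UNIV E" "\<And>y. D (f y) = g y + dd E f y (\<lambda>i. D (y i))"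
      using derivation_poly_fun_coeffs[OF D(1) finite_E f(1)] by blast
    \<comment> \<open>Here \<open>g\<close> is \<open>f\<close> with \<open>D\<close> applied to its
      coefficients. At a rational point \<open>D\<close> kills the coordinates, so there
      \<open>g\<close> is \<open>D 0\<close>.\<close>
    have "g x = 0"
    proof (rule zero_on_M_if_zero_at_rational_points[OF g(1) _ x])
      fix p :: "'a \<Rightarrow> complex" assume p: "p \<in> cspace A" "\<And>a. p a \<in> \<rat>"
      have "D (m p e) = 0" for e by (rule derivation_Rats[OF D(1) m_rational[OF p(2)]])
      then have "dd E f (m p) (\<lambda>i. D (m p i)) = 0" by (simp add: dd_def)
      then show "g (m p) = 0"
        using g(2)[of "m p"] f(2) m_in_M[OF p(1)] derivation_0[OF D(1)] by simp
    qed
    then have "dd E f x (\<lambda>i. D (x i)) = 0"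
      using g(2)[of x] f(2) x derivation_0[OF D(1)] by simp
    moreover have "dd E f x Dx = dd E f x (\<lambda>i. D (x i))" by (rule dd_cong) (simp add: Dx_def)
    ultimately show ?thesis by simp
  qed
  then have "Dx \<in> tangent_space E M x" by (simp add: tangent_space_poly_funs Dx_def cspace_def)
  then have Dx: "(\<Sum>e\<in>E. \<omega> e * D (x e)) = 0"
    using tx by (auto simp: hyperplane_perp_def Dx_def)
  have "(\<Sum>e\<in>E. \<omega> e * x e) = 0" using scaling_M[OF x] tx by (auto simp: hyperplane_perp_def)
  then have "0 = D (\<Sum>e\<in>E. \<omega> e * x e)" using derivation_0[OF D(1)] by simp
  also have "\<dots> = (\<Sum>e\<in>E. \<omega> e * D (x e) + D (\<omega> e) * x e)"
    using D(1) by (simp add: derivation_sum derivation_def)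
  also have "\<dots> = (\<Sum>e\<in>E. D (\<omega> e) * x e)" by (simp add: sum.distrib Dx)
  also have "\<dots> = pairing E v x" using D(2) by (simp add: pairing_def)
  finally show ?thesis by simp
qed

lemma B_unit_vec: "a \<in> A \<Longrightarrow> a' \<in> A \<Longrightarrow> B (unit_vec a) (unit_vec a') e = (if e \<in> E then b e a a' else 0)"
  by (simp add: B_def unit_vec_def finite_A if_distrib[of "\<lambda>u. _ * u"] if_distrib[of "\<lambda>u. u * _"] cong: if_cong)

text \<open>The kernel of the stress matrix of \<open>\<omega>\<close> is spanned by vectors that are rational polynomials in
  \<open>\<omega>\<close>. If \<open>\<Delta>\<close> vanished on it, then it would vanish on the kernel of a dense set of stresses, which
  is false by construction of the dual variety.\<close>

lemma exists_regular_configuration: "\<exists>p\<in>cspace A. \<Delta> p \<noteq> 0 \<and> \<omega> \<in> stress p"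
proof (rule ccontr)
  assume neg: "\<not> (\<exists>p\<in>cspace A. \<Delta> p \<noteq> 0 \<and> \<omega> \<in> stress p)"
  have neg1: "-1 \<in> (\<rat> :: complex set)" by simp
  have dualE: "dual_variety E M \<subseteq> cspace E"
    unfolding dual_variety_def by (rule zariski_closure_cspace)
  \<comment> \<open>Row \<open>a\<close> of the stress matrix of \<eta>, linear in \<eta> with
    rational coefficients.\<close>
  define eqn where "eqn a \<eta> = (\<lambda>a'. pairing E \<eta> (B (unit_vec a') (unit_vec a)))" for a \<eta>
  have eqn_poly: "(\<lambda>\<eta>. eqn a \<eta> a') \<in> poly_funs \<rat> E" if "a \<in> A" "a' \<in> A" for a a'
    unfolding eqn_def pairing_def using that b_Rats
    by (intro poly_funs_sum neg1 poly_funs.mult) (auto simp: B_unit_vec intro: poly_funs.intros)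
  have eqn_pairing: "pairing A (eqn a \<eta>) p = pairing E (B p (unit_vec a)) \<eta>" if "p \<in> cspace A" for a \<eta> p
  proof -
    have "pairing E \<eta> (B p (unit_vec a)) = pairing E \<eta> (B (unit_vec a) p)" by (simp add: B_commute)
    also have "\<dots> = (\<Sum>a'\<in>A. p a' * pairing E \<eta> (B (unit_vec a) (unit_vec a')))"
      by (subst cspace_expand[OF finite_A that]) (simp add: B_sum_right B_scale_right pairing_sum_right pairing_scale_right)
    also have "\<dots> = pairing A (eqn a \<eta>) p"
      unfolding pairing_def[of A] eqn_def by (intro sum.cong) (simp_all add: B_commute[of "unit_vec a"] mult.commute)
    finally show ?thesis by (simp add: pairing_commute)
  qed
  have stress_eqn: "\<eta> \<in> stress p \<longleftrightarrow> (\<forall>a\<in>A. pairing A (eqn a \<eta>) p = 0)"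
    if "\<eta> \<in> dual_variety E M" "p \<in> cspace A" for \<eta> p
    using that dualE eqn_pairing[OF that(2)] by (auto simp: stress_iff)
  obtain S h \<sigma> where basis: "solution_basis \<rat> E (dual_variety E M) \<omega> A eqn A S h \<sigma>"
    using elimination[where eqn = eqn and K = A, OF neg1 \<omega>_in generic finite_A finite_A eqn_poly] by blast
  have S: "S \<subseteq> A" and h: "h \<in> poly_funs \<rat> E" "h \<omega> \<noteq> 0"
    and \<sigma>_poly: "\<And>j i. j \<in> S \<Longrightarrow> (\<lambda>z. \<sigma> j z i) \<in> poly_funs \<rat> E"
    and \<sigma>_cspace: "\<And>j z. j \<in> S \<Longrightarrow> \<sigma> j z \<in> cspace A"
    and \<sigma>_sol: "\<And>j z a. j \<in> S \<Longrightarrow> z \<in> dual_variety E M \<Longrightarrow> a \<in> A \<Longrightarrow> pairing A (eqn a z) (\<sigma> j z) = 0"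
    and \<sigma>_span: "\<And>y z. z \<in> dual_variety E M \<Longrightarrow> y \<in> cspace A \<Longrightarrow> (\<forall>a\<in>A. pairing A (eqn a z) y = 0) \<Longrightarrow>
      cscale (h z) y = (\<Sum>j\<in>S. cscale (y j) (\<sigma> j z))"
    using basis unfolding solution_basis_def by simp_all
  have fS: "finite S" using S finite_A finite_subset by blast
  define q where "q c z = (\<Sum>j\<in>S. cscale (c j) (\<sigma> j z))" for c z
  have q_cspace: "q c z \<in> cspace A" for c z
    unfolding q_def by (intro cspace_sum cspace_scale \<sigma>_cspace)
  have q_stress: "z \<in> stress (q c z)" if "z \<in> dual_variety E M" for c z
    unfolding stress_eqn[OF that q_cspace] using \<sigma>_sol that
    by (simp add: q_def pairing_sum_right pairing_scale_right)
  have q_apply: "q c z a = (\<Sum>j\<in>S. c j * \<sigma> j z a)" for c z a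
    by (simp add: q_def sum_apply cscale_def)
  \<comment> \<open>For rational \<open>c\<close> this is a rational polynomial in \<open>z\<close>
    that vanishes at \<omega> by assumption, so genericity spreads it over the dual variety.\<close>
  have \<Delta>_rational: "\<Delta> (q c z) = 0" if c: "\<And>j. c j \<in> \<rat>" and z: "z \<in> dual_variety E M" for c z
  proof -
    have "(\<lambda>z. q c z a) \<in> poly_funs \<rat> E" for a
      unfolding q_apply using c \<sigma>_poly by (intro poly_funs_sum neg1 poly_funs.mult poly_funs.const) auto
    then have "(\<lambda>z. \<Delta> (\<lambda>a. q c z a)) \<in> poly_funs \<rat> E" by (rule poly_funs_comp[OF \<Delta>_poly])
    moreover have "\<Delta> (\<lambda>a. q c \<omega> a) = 0" using neg q_cspace q_stress[OF \<omega>_in] by blast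
    ultimately have "\<forall>z\<in>dual_variety E M. \<Delta> (\<lambda>a. q c z a) = 0" by (rule generic)
    then show ?thesis using z by blast
  qed
  have \<Delta>_q: "\<Delta> (q c z) = 0" if c: "c \<in> cspace S" and z: "z \<in> dual_variety E M" for c z
  proof -
    have "(\<lambda>c. q c z a) \<in> poly_funs UNIV S" for a
      unfolding q_apply by (intro poly_funs_sum poly_funs.mult poly_funs.var poly_funs.const) auto
    then have \<Delta>q: "(\<lambda>c. \<Delta> (\<lambda>a. q c z a)) \<in> poly_funs UNIV S"
      by (rule poly_funs_comp[OF poly_funs_UNIV[OF \<Delta>_poly]])
    show ?thesis
      by (rule poly_funs_zero_if_zero_on_Rats[OF fS \<Delta>q _ c]) (blast intro: \<Delta>_rational[OF _ z])
  qed
  \<comment> \<open>Where \<open>h\<close> is nonzero, every kernel vector has the form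
    \<open>q c \<eta>\<close>, and there \<Delta> vanishes. So \<open>h\<close> vanishes on all
    stresses of regular configurations, and therefore at \<omega>.\<close>
  have "h \<omega> = 0"
  proof (rule zero_on_dual_variety[OF poly_funs_UNIV[OF h(1)] _ \<omega>_in])
    fix p \<eta> assume p: "p \<in> cspace A" "\<Delta> p \<noteq> 0" and \<eta>: "\<eta> \<in> stress p"
    have \<eta>d: "\<eta> \<in> dual_variety E M" by (rule stress_in_dual_variety[OF p \<eta>])
    show "h \<eta> = 0"
    proof (rule ccontr)
      assume h\<eta>: "h \<eta> \<noteq> 0"
      define c where "c j = (if j \<in> S then inverse (h \<eta>) * p j else 0)" for j
      have "cscale (h \<eta>) p = (\<Sum>j\<in>S. cscale (p j) (\<sigma> j \<eta>))"
        using \<eta> stress_eqn[OF \<eta>d p(1)] by (intro \<sigma>_span[OF \<eta>d p(1)]) simp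
      then have "cscale (inverse (h \<eta>)) (cscale (h \<eta>) p) = (\<Sum>j\<in>S. cscale (inverse (h \<eta>) * p j) (\<sigma> j \<eta>))"
        by (simp only: cfun.scale_sum_right cfun.scale_scale)
      then have "p = (\<Sum>j\<in>S. cscale (inverse (h \<eta>) * p j) (\<sigma> j \<eta>))" using h\<eta> by simp
      also have "\<dots> = q c \<eta>" unfolding q_def c_def by (intro sum.cong) auto
      finally have "p = q c \<eta>" .
      moreover have "c \<in> cspace S" by (simp add: c_def cspace_def)
      ultimately show False using \<Delta>_q[OF _ \<eta>d] p(2) by metis
    qed
  qed
  then show False using h(2) by simp
qed

section \<open>Kernel lines, paths of stresses, and the complement of \<open>T\<close>\<close>

lemma contactI:
  assumes "p \<in> cspace A" "\<Delta> p \<noteq> 0" "\<omega> \<in> stress p"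
  shows "m p \<in> contact"
  unfolding contact_def
  using smooth[OF assms(1,2)] assms(3) im_cspace
  by (auto simp: tangent_eq_im[OF assms(1,2)] stress_def annihilator_def hyperplane_perp_def pairing_def mult.commute)

lemma contact_subset: "contact \<subseteq> annihilator E T"
proof
  fix x assume x: "x \<in> contact"
  then have xM: "x \<in> M" by (simp add: contact_def smooth_point_def)
  then have "x \<in> cspace E" using zariski_closure_cspace unfolding M_def by blast
  then show "x \<in> annihilator E T"
    using x xM contact_orthogonal_T by (auto simp: annihilator_def contact_def)
qed

lemma stress_line:
  assumes "\<omega> \<in> stress p" "\<omega> \<in> stress r"
  shows "\<omega> \<in> stress (p + cscale t r)"
  using assms by (simp add: stress_iff B_add_left B_scale_left pairing_commute[of E _ \<omega>]
      pairing_add_right pairing_scale_right)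

text \<open>The line stays in the kernel of the stress matrix and leaves the regular locus for
  finitely many \<open>t\<close> only, so almost all its points map into
  \<open>contact\<close>.\<close>

lemma zero_along_kernel_line:
  assumes f: "\<And>x. x \<in> contact \<Longrightarrow> f x = 0" "f \<in> poly_funs UNIV E"
    and p: "p \<in> cspace A" "\<Delta> p \<noteq> 0" "\<omega> \<in> stress p" and r: "r \<in> cspace A" "\<omega> \<in> stress r"
  shows "f (m (p + cscale t r)) = 0"
proof -
  define L where "L a = [:p a, r a:]" for a
  have L: "(\<lambda>a. poly (L a) t) = p + cscale t r" for t by (auto simp: L_def cscale_def)
  obtain R where R: "\<And>t. \<Delta> (\<lambda>a. poly (L a) t) = poly R t"
    using poly_funs_path[OF finite_A \<Delta>_poly] by metis
  obtain Q where Q: "\<And>t. f (m (\<lambda>a. poly (L a) t)) = poly Q t"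
    using poly_funs_path[OF finite_A comp_m_poly[OF f(2) subset_UNIV]] by metis
  have "poly R 0 \<noteq> 0" using R[of 0] p by (simp add: L_def)
  then have "R \<noteq> 0" by auto
  then have "Q = 0"
  proof (rule poly_eq_0_cofinite)
    fix t assume "poly R t \<noteq> 0"
    then have "\<Delta> (p + cscale t r) \<noteq> 0" using R L by metis
    moreover have "p + cscale t r \<in> cspace A" using p r by (intro cspace_add cspace_scale)
    ultimately have "m (p + cscale t r) \<in> contact"
      by (intro contactI stress_line p(3) r(2))
    then show "poly Q t = 0" using f(1) Q L by metis
  qed
  then show ?thesis using Q[of t] by (simp add: L)
qed

text \<open>Along a kernel line, pairing with \<open>v\<close> gives a zero polynomial in
  \<open>t\<close>, whose linear coefficient is twice the claimed quantity.\<close>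

lemma T_orthogonal_kernel_image:
  assumes v: "v \<in> T" and p: "p \<in> cspace A" "\<Delta> p \<noteq> 0" "\<omega> \<in> stress p"
    and r: "r \<in> cspace A" "\<omega> \<in> stress r"
  shows "pairing E v (B p r) = 0"
proof -
  have "pairing E v (m (p + cscale t r)) = 0" for t
  proof (rule zero_along_kernel_line[OF _ _ p r])
    show "pairing E v x = 0" if "x \<in> contact" for x
      using contact_subset that v by (auto simp: annihilator_def)
    show "pairing E v \<in> poly_funs UNIV E"
      unfolding pairing_def[abs_def] by (intro poly_funs_sum poly_funs.mult poly_funs.const poly_funs.var) auto
  qed
  moreover have "pairing E v (m (p + cscale t r)) =
      poly [:pairing E v (m p), 2 * pairing E v (B p r), pairing E v (m r):] t" for t
    by (simp add: pairing_def m_line algebra_simps sum.distrib sum_distrib_left power2_eq_square)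
  ultimately have "[:pairing E v (m p), 2 * pairing E v (B p r), pairing E v (m r):] = 0"
    using poly_all_0_iff_0 by metis
  then show ?thesis by simp
qed

text \<open>First-order deformations \<open>(q, v)\<close> of \<open>(p, \<omega>)\<close>: the equation \<open>v\<cdot>B p r + \<omega>\<cdot>B q r = 0\<close> is solvable for
  \<open>q\<close> because the form \<open>\<omega>\<cdot>B\<close> is symmetric, and a solution integrates to a polynomial path because
  the stress spaces near \<open>p\<close> are spanned by the vectors \<open>\<kappa> j\<close>.\<close>

lemma exists_stress_path:
  assumes p: "p \<in> cspace A" "\<Delta> p \<noteq> 0" "\<omega> \<in> stress p" and v: "v \<in> cspace E"
    and orth: "\<And>r. r \<in> cspace A \<Longrightarrow> \<omega> \<in> stress r \<Longrightarrow> pairing E v (B p r) = 0"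
  shows "\<exists>P. \<exists>q\<in>cspace A. (\<forall>e. coeff (P e) 0 = \<omega> e) \<and> (\<forall>e. coeff (P e) 1 = v e) \<and>
    (\<forall>t. (\<lambda>e. poly (P e) t) \<in> stress (p + cscale t q))"
proof -
  have \<omega>E: "\<omega> \<in> cspace E" using p(3) by (rule stress_cspace)
  \<comment> \<open>The functional taking \<open>w\<close> to the pairing of \<eta> with
    \<open>B r w\<close>, written as a vector; for \<omega> it is the stress matrix applied to
    \<open>r\<close>.\<close>
  define row where "row \<eta> r = (\<lambda>a. if a \<in> A then pairing E \<eta> (B r (unit_vec a)) else 0)" for \<eta> r
  have row_cspace: "row \<eta> r \<in> cspace A" for \<eta> r by (simp add: row_def cspace_def)
  have row_pairing: "pairing A w (row \<eta> r) = pairing E \<eta> (B r w)" if "w \<in> cspace A" for w \<eta> r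
  proof -
    have "pairing E \<eta> (B r w) = (\<Sum>a\<in>A. w a * pairing E \<eta> (B r (unit_vec a)))"
      by (subst cspace_expand[OF finite_A that]) (simp add: B_sum_right B_scale_right pairing_sum_right pairing_scale_right)
    then show ?thesis by (simp add: pairing_def[of A] row_def)
  qed
  define nr where "nr = cscale (-1) (row v p)"
  have nr_pairing: "pairing A w nr = - pairing E v (B p w)" if "w \<in> cspace A" for w
    unfolding nr_def pairing_scale_right row_pairing[OF that] by simp
  define U where "U = row \<omega> ` cspace A"
  have row_add: "row \<omega> r + row \<omega> r' = row \<omega> (r + r')" for r r'
    by (rule ext) (simp add: row_def B_add_left pairing_add_right)
  have row_scale: "cscale c (row \<omega> r) = row \<omega> (cscale c r)" for c r
    by (rule ext) (simp add: row_def B_scale_left pairing_scale_right cscale_apply)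
  have "cfun.subspace U"
  proof -
    have "row \<omega> 0 = 0"
      by (rule ext) (simp add: row_def B_commute[of 0] B_zero_right pairing_zero_right del: zero_fun_apply, simp)
    then have "0 \<in> U" unfolding U_def by (metis cspace_0 imageI)
    moreover have "x + y \<in> U" if "x \<in> U" "y \<in> U" for x y
      using that unfolding U_def by (auto simp: row_add intro!: imageI cspace_add)
    moreover have "cscale c x \<in> U" if "x \<in> U" for x c
      using that unfolding U_def by (auto simp: row_scale intro!: imageI cspace_scale)
    ultimately show ?thesis by (simp add: cfun.subspace_def)
  qed
  moreover have "U \<subseteq> cspace A" by (auto simp: U_def row_cspace)
  moreover have "nr \<in> cspace A" unfolding nr_def by (intro cspace_scale row_cspace)
  \<comment> \<open>\<open>U\<close> is the image of the stress matrix. By symmetry its annihilator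
    is the kernel, on which \<open>nr\<close> vanishes by \<open>orth\<close>; hence the linear
    system for \<open>q\<close> is solvable.\<close>
  moreover have "pairing A w nr = 0" if w: "w \<in> annihilator A U" for w
  proof -
    have wA: "w \<in> cspace A" using w by (simp add: annihilator_def)
    have "pairing E \<omega> (B w q) = 0" if "q \<in> cspace A" for q
    proof -
      have "pairing A w (row \<omega> q) = 0" using w that by (auto simp: annihilator_def U_def pairing_commute)
      then show ?thesis using row_pairing[OF wA] by (simp add: B_commute)
    qed
    then have "\<omega> \<in> stress w" using \<omega>E by (auto simp: stress_def annihilator_def im_def pairing_commute)
    then show ?thesis using orth[OF wA] nr_pairing[OF wA] by simp
  qed
  ultimately have "nr \<in> U" using in_subspace_if_annihilated[OF finite_A] by blast
  then obtain q where q: "q \<in> cspace A" "nr = row \<omega> q" by (auto simp: U_def)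
  have first_order: "pairing E v (B p r) + pairing E \<omega> (B q r) = 0" if r: "r \<in> cspace A" for r
  proof -
    have "pairing E \<omega> (B q r) = pairing A r nr" using row_pairing[OF r] q(2) by simp
    then show ?thesis using nr_pairing[OF r] by simp
  qed
  obtain c where c: "\<omega> = (\<Sum>j\<in>K. cscale (c j) (\<kappa> j p))" using stress_expand[OF p] by blast
  define L where "L a = [:p a, q a:]" for a
  have L: "(\<lambda>a. poly (L a) t) = p + cscale t q" for t by (auto simp: L_def cscale_def)
  have line: "p + cscale t q \<in> cspace A" for t using p q by (intro cspace_add cspace_scale)
  have "\<exists>R. \<forall>t. \<kappa> j (p + cscale t q) e = poly R t" if "j \<in> K" for j e
    using poly_funs_path[OF finite_A \<kappa>_poly[OF that, of e], of L] unfolding L by metis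
  then obtain R where R: "\<And>j e t. j \<in> K \<Longrightarrow> \<kappa> j (p + cscale t q) e = poly (R j e) t" by metis
  have R0: "coeff (R j e) 0 = \<kappa> j p e" if "j \<in> K" for j e
  proof -
    have "p + cscale 0 q = p" by (rule ext) (simp add: cscale_def)
    then show ?thesis using R[OF that, of 0 e] by (simp add: poly_0_coeff_0)
  qed
  have comb_stress: "(\<lambda>e. \<Sum>j\<in>K. f j * poly (R j e) t) \<in> stress (p + cscale t q)" for f t
  proof -
    have "(\<lambda>e. \<Sum>j\<in>K. f j * poly (R j e) t) = (\<Sum>j\<in>K. cscale (f j) (\<kappa> j (p + cscale t q)))"
      by (rule ext) (simp add: sum_apply cscale_apply R)
    also have "\<dots> \<in> stress (p + cscale t q)"
      unfolding stress_def
      by (intro cfun.subspace_sum cfun.subspace_scale subspace_annihilator \<kappa>_stress[OF _ line, unfolded stress_def])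
    finally show ?thesis .
  qed
  \<comment> \<open>Keeping the coefficients of \<omega> constant gives a path of stresses starting
    at \<omega>, but its velocity \<open>v0\<close> may differ from \<open>v\<close>.\<close>
  define \<gamma> where "\<gamma> e = (\<Sum>j\<in>K. smult (c j) (R j e))" for e
  have \<gamma>0: "coeff (\<gamma> e) 0 = \<omega> e" for e
    by (subst c) (simp add: \<gamma>_def coeff_sum R0 sum_apply cscale_def)
  have \<gamma>_stress: "(\<lambda>e. poly (\<gamma> e) t) \<in> stress (p + cscale t q)" for t
    using comb_stress[of c] by (simp add: \<gamma>_def poly_sum)
  define v0 where "v0 e = coeff (\<gamma> e) 1" for e
  have v0E: "v0 \<in> cspace E"
  proof -
    have "\<gamma> e = 0" if "e \<notin> E" for e
    proof -
      have "poly (\<gamma> e) t = 0" for t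
        using stress_cspace[OF \<gamma>_stress] that by (simp add: cspace_def)
      then show ?thesis using poly_all_0_iff_0 by blast
    qed
    then show ?thesis by (simp add: v0_def cspace_def)
  qed
  have first_order0: "pairing E v0 (B p r) + pairing E \<omega> (B q r) = 0" if r: "r \<in> cspace A" for r
  proof -
    have "poly (\<Sum>e\<in>E. \<gamma> e * [:B p r e, B q r e:]) t = 0" for t
    proof -
      have "0 = pairing E (\<lambda>e. poly (\<gamma> e) t) (B (p + cscale t q) r)"
        using stress_pairing[OF \<gamma>_stress r] by simp
      also have "\<dots> = poly (\<Sum>e\<in>E. \<gamma> e * [:B p r e, B q r e:]) t"
        by (simp add: pairing_def poly_sum B_add_left B_scale_left cscale_apply algebra_simps)
      finally show ?thesis by simp
    qed
    then have "(\<Sum>e\<in>E. \<gamma> e * [:B p r e, B q r e:]) = 0" using poly_all_0_iff_0 by blast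
    then have "0 = coeff (\<Sum>e\<in>E. \<gamma> e * [:B p r e, B q r e:]) 1" by simp
    also have "\<dots> = (\<Sum>e\<in>E. v0 e * B p r e + \<omega> e * B q r e)"
      by (simp add: coeff_sum coeff_mult \<gamma>0 v0_def algebra_simps)
    finally show ?thesis by (simp add: pairing_def sum.distrib)
  qed
  \<comment> \<open>Both velocities solve the same first-order equation with the same
    \<open>q\<close>, so their difference is a stress of \<open>p\<close>.\<close>
  have "pairing E (v - v0) (B p r) = 0" if "r \<in> cspace A" for r
    using first_order[OF that] first_order0[OF that]
    unfolding pairing_diff_left by (metis add_right_cancel right_minus_eq)
  then have "v - v0 \<in> stress p"
    using v v0E unfolding stress_def annihilator_def im_def by (auto simp: pairing_commute intro: cspace_diff)
  then obtain d where d: "v - v0 = (\<Sum>j\<in>K. cscale (d j) (\<kappa> j p))" using stress_expand[OF p(1,2)] by blast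
  \<comment> \<open>The coefficients become \<open>c j + t * d j\<close>: the factor
    \<open>t\<close>, written as \<open>pCons 0\<close>, keeps the starting point and adds
    \<open>v - v0\<close> to the velocity.\<close>
  define P where "P e = \<gamma> e + (\<Sum>j\<in>K. smult (d j) (pCons 0 (R j e)))" for e
  show ?thesis
  proof (intro exI[of _ P] bexI[of _ q] conjI allI)
    show "q \<in> cspace A" by fact
    show "coeff (P e) 0 = \<omega> e" for e by (simp add: P_def \<gamma>0 coeff_sum)
    show "coeff (P e) 1 = v e" for e
    proof -
      have "coeff (P e) 1 = v0 e + (v - v0) e"
        by (subst d) (simp add: P_def v0_def coeff_sum R0 sum_apply cscale_def)
      then show ?thesis by simp
    qed
    show "(\<lambda>e. poly (P e) t) \<in> stress (p + cscale t q)" for t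
    proof -
      have "(\<lambda>e. poly (P e) t) = (\<lambda>e. \<Sum>j\<in>K. (c j + t * d j) * poly (R j e) t)"
        by (rule ext) (simp add: P_def \<gamma>_def poly_sum sum.distrib algebra_simps)
      then show ?thesis using comb_stress by simp
    qed
  qed
qed

text \<open>A rational polynomial vanishing at \<omega> vanishes along the path of stresses with
  velocity \<open>v\<close>, and its linear coefficient there is its differential applied to
  \<open>v\<close>.\<close>

lemma in_T_if_orthogonal:
  assumes p: "p \<in> cspace A" "\<Delta> p \<noteq> 0" "\<omega> \<in> stress p" and v: "v \<in> cspace E"
    and orth: "\<And>r. r \<in> cspace A \<Longrightarrow> \<omega> \<in> stress r \<Longrightarrow> pairing E v (B p r) = 0"
  shows "v \<in> T"
proof -
  obtain P q where P: "q \<in> cspace A" "\<And>e. coeff (P e) 0 = \<omega> e" "\<And>e. coeff (P e) 1 = v e"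
    "\<And>t. (\<lambda>e. poly (P e) t) \<in> stress (p + cscale t q)"
    using exists_stress_path[OF p v] orth by blast
  have "dd E f \<omega> v = 0" if f: "f \<in> poly_funs \<rat> E" "f \<omega> = 0" for f
  proof -
    obtain Q where Q: "\<And>t. f (\<lambda>e. poly (P e) t) = poly Q t"
      "coeff Q 1 = dd E f (\<lambda>i. coeff (P i) 0) (\<lambda>i. coeff (P i) 1)"
      using poly_funs_path[OF finite_E f(1)] by metis
    have "poly Q t = 0" for t
      using zero_on_dual_variety_line[OF poly_funs_UNIV[OF f(1)] _ p(1,2) P(1,4)] generic[OF f] Q(1) by simp
    then have "Q = 0" using poly_all_0_iff_0 by blast
    then show ?thesis using Q(2) P(2,3) by simp
  qed
  then show ?thesis using v by (simp add: T_def)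
qed

lemma annihilator_T_subset:
  assumes p: "p \<in> cspace A" "\<Delta> p \<noteq> 0" "\<omega> \<in> stress p" and x: "x \<in> annihilator E T"
  shows "\<exists>r\<in>cspace A. \<omega> \<in> stress r \<and> x = B p r"
proof -
  define Ker where "Ker = {r \<in> cspace A. \<omega> \<in> stress r}"
  have \<omega>E: "\<omega> \<in> cspace E" using p(3) by (rule stress_cspace)
  have zero: "0 \<in> Ker"
  proof -
    have "B 0 q = 0" for q by (metis B_commute B_zero_right)
    then show ?thesis using \<omega>E by (simp add: Ker_def stress_iff cspace_0 pairing_def)
  qed
  have add: "r + s \<in> Ker" if "r \<in> Ker" "s \<in> Ker" for r s
    using that stress_line[of r s 1] by (auto simp: Ker_def intro: cspace_add)
  have scale: "cscale k r \<in> Ker" if "r \<in> Ker" for k r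
    using that stress_line[of 0 r k] zero by (auto simp: Ker_def intro: cspace_scale)
  have sub: "cfun.subspace (B p ` Ker)"
  proof -
    have "0 \<in> B p ` Ker" using zero B_zero_right by (metis imageI)
    moreover have "y + z \<in> B p ` Ker" if "y \<in> B p ` Ker" "z \<in> B p ` Ker" for y z
      using that add by (auto simp flip: B_add_right)
    moreover have "cscale k y \<in> B p ` Ker" if "y \<in> B p ` Ker" for y k
      using that scale by (auto simp flip: B_scale_right)
    ultimately show ?thesis by (simp add: cfun.subspace_def)
  qed
  have "x \<in> B p ` Ker"
  proof (rule in_subspace_if_annihilated[OF finite_E sub])
    show "B p ` Ker \<subseteq> cspace E" by (auto simp: B_cspace)
    show "x \<in> cspace E" using x by (simp add: annihilator_def)
    fix w assume w: "w \<in> annihilator E (B p ` Ker)"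
    have "w \<in> T"
      using w by (intro in_T_if_orthogonal[OF p]) (auto simp: annihilator_def Ker_def pairing_commute)
    then show "pairing E w x = 0" using x by (simp add: annihilator_def)
  qed
  then show ?thesis by (auto simp: Ker_def)
qed

text \<open>Density excludes rational relations among the \<open>J\<close>-coordinates of \<omega>,
  so a derivation can take any values on them, and its values on \<omega> form a vector of
  \<open>T\<close>. Conversely, each vector of \<open>T\<close> is the velocity of a path of
  stresses, and \<open>zero_if_zero_along_paths\<close> applies.\<close>

lemma dual_variety_projection_dense_iff:
  assumes J: "J \<subseteq> E"
  shows "zariski_closure J (coord_proj J ` dual_variety E M) = cspace J \<longleftrightarrow> coord_proj J ` T = cspace J"
proof
  have fJ: "finite J" using J finite_E finite_subset by blast
  assume dense: "zariski_closure J (coord_proj J ` dual_variety E M) = cspace J"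
  have neg1: "-1 \<in> (\<rat> :: complex set)" by simp
  have "\<exists>v\<in>T. \<forall>i\<in>J. v i = u i" if u: "u \<in> cspace J" for u
  proof -
    have "dd J g \<omega> u = 0" if g: "g \<in> poly_funs \<rat> J" "g \<omega> = 0" for g
    proof -
      have "g \<in> poly_funs \<rat> E" using g(1) poly_funs_mono[OF order_refl J] by blast
      then have "\<forall>x\<in>dual_variety E M. g x = 0" using generic g(2) by blast
      then have "\<forall>y\<in>cspace J. g y = 0"
        using dense poly_funs_UNIV[OF g(1)] unfolding dense_projection_iff by blast
      then have "g = (\<lambda>_. 0)" by (intro poly_fun_eq_0[OF g(1)]) blast
      then show ?thesis by (simp add: dd_const)
    qed
    then obtain D where D: "derivation D" "\<And>i. i \<in> J \<Longrightarrow> D (\<omega> i) = u i"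
      using exists_derivation[OF neg1 fJ] by metis
    define v where "v e = (if e \<in> E then D (\<omega> e) else 0)" for e
    have "dd E f \<omega> v = 0" if f: "f \<in> poly_funs \<rat> E" "f \<omega> = 0" for f
    proof -
      have "dd E f \<omega> v = dd E f \<omega> (\<lambda>e. D (\<omega> e))" by (rule dd_cong) (simp add: v_def)
      also have "\<dots> = D (f \<omega>)"
        by (rule derivation_poly_fun[OF D(1) derivation_Rats[OF D(1)] finite_E f(1), symmetric])
      finally show ?thesis using f(2) derivation_0[OF D(1)] by simp
    qed
    then have "v \<in> T" by (simp add: T_def v_def cspace_def)
    moreover have "\<forall>i\<in>J. v i = u i" using D(2) J by (auto simp: v_def)
    ultimately show ?thesis by blast
  qed
  then show "coord_proj J ` T = cspace J" by (subst coord_proj_surj_iff) blast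
next
  have fJ: "finite J" using J finite_E finite_subset by blast
  assume surj: "coord_proj J ` T = cspace J"
  obtain p where p: "p \<in> cspace A" "\<Delta> p \<noteq> 0" "\<omega> \<in> stress p"
    using exists_regular_configuration by blast
  show "zariski_closure J (coord_proj J ` dual_variety E M) = cspace J"
    unfolding dense_projection_iff
  proof (intro ballI impI)
    fix g y assume g: "g \<in> poly_funs UNIV J" "\<forall>x\<in>dual_variety E M. g x = 0" and y: "y \<in> cspace J"
    have gE: "g \<in> poly_funs UNIV E" using g(1) poly_funs_mono[OF order_refl J] by blast
    show "g y = 0"
    proof (rule zero_if_zero_along_paths[OF fJ g(1) _ y])
      fix u assume "u \<in> cspace J"
      then obtain v where v: "v \<in> T" "\<forall>i\<in>J. v i = u i" using surj unfolding coord_proj_surj_iff by blast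
      have vE: "v \<in> cspace E" using v(1) T_cspace by blast
      obtain P q where P: "q \<in> cspace A" "\<And>e. coeff (P e) 0 = \<omega> e" "\<And>e. coeff (P e) 1 = v e"
        "\<And>t. (\<lambda>e. poly (P e) t) \<in> stress (p + cscale t q)"
        using exists_stress_path[OF p vE] T_orthogonal_kernel_image[OF v(1) p] by blast
      have "g (\<lambda>j. poly (P j) t) = 0" for t
        using zero_on_dual_variety_line[OF gE _ p(1,2) P(1,4)] g(2) by blast
      then show "\<exists>P. (\<forall>j\<in>J. coeff (P j) 0 = \<omega> j \<and> coeff (P j) 1 = u j) \<and> (\<forall>t. g (\<lambda>j. poly (P j) t) = 0)"
        using P(2,3) v(2) by (intro exI[of _ P]) simp
    qed
  qed
qed

text \<open>If the projected annihilator were proper, a nonzero linear form would vanish on it and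
  thus on \<open>contact\<close>. Conversely, each vector of the annihilator is some
  \<open>B p r\<close>, the velocity of the image of a kernel line at half speed.\<close>

lemma contact_projection_dense_iff:
  assumes J: "J \<subseteq> E"
  shows "zariski_closure J (coord_proj J ` zariski_closure E contact) = cspace J \<longleftrightarrow>
    coord_proj J ` annihilator E T = cspace J"
proof
  have fJ: "finite J" using J finite_E finite_subset by blast
  assume dense: "zariski_closure J (coord_proj J ` zariski_closure E contact) = cspace J"
  show "coord_proj J ` annihilator E T = cspace J"
  proof (rule ccontr)
    assume "coord_proj J ` annihilator E T \<noteq> cspace J"
    moreover have sub: "coord_proj J ` annihilator E T \<subseteq> cspace J" by (auto simp: coord_proj_cspace)
    ultimately obtain u where u: "u \<in> cspace J" "u \<notin> coord_proj J ` annihilator E T" by blast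
    obtain w where w: "w \<in> cspace J" "\<And>y. y \<in> coord_proj J ` annihilator E T \<Longrightarrow> pairing J w y = 0"
      "pairing J w u \<noteq> 0"
      using separating_functional[OF fJ subspace_coord_proj[OF subspace_annihilator] sub u] by metis
    have wJ: "pairing J w \<in> poly_funs UNIV J"
      unfolding pairing_def[abs_def] by (intro poly_funs_sum poly_funs.mult poly_funs.const poly_funs.var) auto
    then have wE: "pairing J w \<in> poly_funs UNIV E" using poly_funs_mono[OF order_refl J] by blast
    have "pairing J w x = 0" if "x \<in> zariski_closure E contact" for x
    proof (rule zero_on_zariski_closure[OF wE _ that])
      fix x assume "x \<in> contact"
      then have "coord_proj J x \<in> coord_proj J ` annihilator E T" using contact_subset by blast
      then have "pairing J w (coord_proj J x) = 0" by (rule w(2))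
      then show "pairing J w x = 0" by (simp add: pairing_def coord_proj_def)
    qed
    then show False using dense wJ u(1) w(3) unfolding dense_projection_iff by blast
  qed
next
  have fJ: "finite J" using J finite_E finite_subset by blast
  assume surj: "coord_proj J ` annihilator E T = cspace J"
  obtain p where p: "p \<in> cspace A" "\<Delta> p \<noteq> 0" "\<omega> \<in> stress p"
    using exists_regular_configuration by blast
  have contactE: "contact \<subseteq> cspace E" using contact_subset by (auto simp: annihilator_def)
  show "zariski_closure J (coord_proj J ` zariski_closure E contact) = cspace J"
    unfolding dense_projection_iff
  proof (intro ballI impI)
    fix g y assume g: "g \<in> poly_funs UNIV J" "\<forall>x\<in>zariski_closure E contact. g x = 0" and y: "y \<in> cspace J"
    have gE: "g \<in> poly_funs UNIV E" using g(1) poly_funs_mono[OF order_refl J] by blast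
    have gc: "g x = 0" if "x \<in> contact" for x using g(2) subset_zariski_closure[OF contactE] that by blast
    show "g y = 0"
    proof (rule zero_if_zero_along_paths[OF fJ g(1) _ y])
      fix u assume "u \<in> cspace J"
      then obtain x where x: "x \<in> annihilator E T" "\<forall>i\<in>J. x i = u i"
        using surj unfolding coord_proj_surj_iff by blast
      obtain r where r: "r \<in> cspace A" "\<omega> \<in> stress r" "x = B p r"
        using annihilator_T_subset[OF p x(1)] by blast
      define P where "P e = [:m p e, B p r e, m r e / 4:]" for e
      have "(\<lambda>e. poly (P e) t) = m (p + cscale (t / 2) r)" for t
        by (rule ext) (simp add: P_def m_line power2_eq_square algebra_simps)
      then have "g (\<lambda>e. poly (P e) t) = 0" for t
        using zero_along_kernel_line[OF gc gE p r(1,2)] by simp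
      moreover have "\<forall>j\<in>J. coeff (P j) 0 = m p j \<and> coeff (P j) 1 = u j"
        using x(2) r(3) by (simp add: P_def)
      ultimately show "\<exists>P. (\<forall>j\<in>J. coeff (P j) 0 = m p j \<and> coeff (P j) 1 = u j) \<and>
          (\<forall>t. g (\<lambda>j. poly (P j) t) = 0)" by blast
    qed
  qed
qed

theorem contact_matroid_eq_dual:
  "algebraic_matroid E (zariski_closure E contact) = dual_matroid (algebraic_matroid E (dual_variety E M))"
proof -
  have "algebraic_matroid E (zariski_closure E contact) =
      (E, {J. J \<subseteq> E \<and> coord_proj J ` annihilator E T = cspace J})"
    unfolding algebraic_matroid_def using contact_projection_dense_iff by auto
  also have "\<dots> = dual_matroid (E, {J. J \<subseteq> E \<and> coord_proj J ` T = cspace J})"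
    by (rule dual_matroid_annihilator[OF finite_E subspace_T T_cspace])
  also have "(E, {J. J \<subseteq> E \<and> coord_proj J ` T = cspace J}) = algebraic_matroid E (dual_variety E M)"
    unfolding algebraic_matroid_def using dual_variety_projection_dense_iff by auto
  finally show ?thesis .
qed

end

section \<open>Frameworks\<close>

theorem theorem3p9:
  fixes d :: nat and V :: "'v set" and E :: "'v set set" and \<omega> :: "'v set \<Rightarrow> complex"
  assumes "d \<ge> 1"
    and "finite_simple_graph V E"
    and "E \<noteq> {}"
    and "generic_stress d V E \<omega>"
  shows "algebraic_matroid E (contact_locus d V E \<omega>) =
    dual_matroid (generic_stress_matroid d V E)"
proof -
  have V: "finite V" and edge: "\<And>e. e \<in> E \<Longrightarrow> \<exists>u v. u \<in> V \<and> v \<in> V \<and> u \<noteq> v \<and> e = {u, v}"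
    using assms(2) unfolding finite_simple_graph_def by blast+
  define A where "A = V \<times> {..<d}"
  obtain src tgt where ends: "\<And>e. e \<in> E \<Longrightarrow> src e \<in> V \<and> tgt e \<in> V \<and> src e \<noteq> tgt e \<and> e = {src e, tgt e}"
    using edge by metis
  \<comment> \<open>\<open>s e\<close> is the signed incidence vector of \<open>e\<close>; reversing
    the orientation does not affect the products in \<open>b e\<close>. Then \<open>b e\<close> is
    the rank-one Laplacian of the edge, repeated for each of the \<open>d\<close>
    coordinates.\<close>
  define s :: "'v set \<Rightarrow> 'v \<Rightarrow> complex" where
    "s e u = (if u = src e then 1 else if u = tgt e then -1 else 0)" for e u
  define b where "b e a a' = (if snd a = snd a' then s e (fst a) * s e (fst a') else 0)"
    for e :: "'v set" and a a' :: "'v \<times> nat"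
  have "E \<subseteq> Pow V" using edge by blast
  then have "finite E" using V finite_subset by blast
  then interpret Q: quadratic_map A E b
    by unfold_locales (auto simp: A_def V b_def s_def)
  have sum_s: "(\<Sum>u\<in>V. s e u * f u) = f (src e) - f (tgt e)" if "e \<in> E" for e and f :: "'v \<Rightarrow> complex"
  proof -
    have st: "src e \<in> V" "tgt e \<in> V" "src e \<noteq> tgt e" using ends[OF that] by auto
    have "(\<Sum>u\<in>V. s e u * f u) = (\<Sum>u\<in>{src e, tgt e}. s e u * f u)"
      using st V by (intro sum.mono_neutral_right) (auto simp: s_def)
    also have "\<dots> = f (src e) - f (tgt e)" using st by (simp add: s_def)
    finally show ?thesis .
  qed
  have m_eq: "Q.m p = measurement d E p" for p
  proof
    fix e
    show "Q.m p e = measurement d E p e"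
    proof (cases "e \<in> E")
      case False
      then show ?thesis by (simp add: Q.m_def Q.B_def measurement_def)
    next
      case True
      have "Q.m p e = (\<Sum>a\<in>A. \<Sum>a'\<in>A. b e a a' * (p a * p a'))"
        using True by (simp add: Q.m_def Q.B_def)
      also have "\<dots> = (\<Sum>u\<in>V. \<Sum>i<d. \<Sum>v\<in>V. \<Sum>j<d.
          if i = j then s e u * s e v * (p (u, i) * p (v, j)) else 0)"
        unfolding A_def sum.cartesian_product' by (intro sum.cong refl) (simp add: b_def)
      also have "\<dots> = (\<Sum>u\<in>V. \<Sum>i<d. \<Sum>v\<in>V. s e u * s e v * (p (u, i) * p (v, i)))"
        by (intro sum.cong refl) simp
      also have "\<dots> = (\<Sum>i<d. \<Sum>u\<in>V. \<Sum>v\<in>V. s e u * s e v * (p (u, i) * p (v, i)))"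
        by (rule sum.swap)
      also have "\<dots> = (\<Sum>i<d. (\<Sum>u\<in>V. s e u * p (u, i)) * (\<Sum>v\<in>V. s e v * p (v, i)))"
        by (simp add: sum_product algebra_simps)
      also have "\<dots> = sq_dist d p (src e) (tgt e)"
        by (simp add: sum_s[OF True] sq_dist_def power2_eq_square)
      also have "\<dots> = measurement d E p e"
        using measurement_edge[of "src e" "tgt e" E d p] ends[OF True] True by simp
      finally show ?thesis .
    qed
  qed
  have M_eq: "Q.M = measurement_variety d V E"
    unfolding Q.M_def measurement_variety_def A_def[symmetric] m_eq by simp
  obtain \<Delta> K \<kappa> where "regular_quadratic_map A E b \<Delta> K \<kappa>" using Q.exists_regular by blast
  then interpret R: regular_quadratic_map A E b \<Delta> K \<kappa> .
  interpret S: generic_quadratic_stress A E b \<Delta> K \<kappa> \<omega>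
    using assms(4) by unfold_locales (simp add: generic_stress_def generic_stress_variety_def M_eq)
  show ?thesis
    using S.contact_matroid_eq_dual
    by (simp add: S.contact_def M_eq contact_locus_def generic_stress_matroid_def generic_stress_variety_def)
qed

end
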